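(* Suppose Assumption A (see context) holds. Let $D_g$ be a fixed diameter bound, $D_g\ge\operatorname{diam}(\operatorname{dom}(g_2))$, and let $B_f\ge1$ be a Lipschitz constant for $f$ on $\operatorname{dom}(g_2)$. Let the inputs of the algorithm BiVFA described in the context satisfy $0<\delta_{\rm init}\le 1/B_f$, $0<\epsilon\le\min\{1,4\delta_{\rm init}\}$, $x^f_{\rm init},x^g_{\rm init}\in\operatorname{dom}(g_2)$. Then BiVFA$(\epsilon,D_g,B_f,\delta_{\rm init},x^f_{\rm init},x^g_{\rm init})$ returns an $(\epsilon,\epsilon)$-optimal solution of (SBO), i.e. a point $\widehat x\in\operatorname{dom}(g_2)$ with $f(\widehat x)-p^*\le\epsilon$ and $g(\widehat x)-g^*\le\epsilon$, and its total number of basic operations satisfies $$T_{\rm BiVFA}=T_{\rm pre}+\mathcal O\!\left(D_g\sqrt{\frac{L_{g_1}}{\epsilon}}+\sqrt{\frac{C_D}{\epsilon}\left(L_{g_1}+L_{f_1}\Omega_gQ_{\rm init}\right)}\left(1+\log\frac1\epsilon\right)^3\right),$$ where $$T_{\rm pre}=\mathcal O\!\left(\left[\sqrt{C_DL_{f_1}\Omega_g}\,Q_{\rm init}+\sqrt{C_DL_{g_1}}\sqrt{Q_{\rm init}}\right](1+\log Q_{\rm init})^2\right).$$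
   Context: **Problem.** $f=f_1+f_2$, $g=g_1+g_2$ on $\mathbb R^n$; $f_1,g_1:\mathbb R^n\to\mathbb R$ are convex and continuously differentiable with gradients Lipschitz with constants $L_{f_1}>0$, $L_{g_1}\ge1$; $f_2,g_2:\mathbb R^n\to\mathbb R\cup\{+\infty\}$ are proper, l.s.c., convex. (SBO) is: $\min_x f(x)$ s.t. $x\in\arg\min_{z\in\mathbb R^n}g(z)$. The lower-level and SBO solution sets are assumed nonempty. $g^*=\min_{\operatorname{dom}(g_2)}g$, $f^*=\min_{\operatorname{dom}(g_2)}f$, and $p^*$ is the optimal value of (SBO). **Assumption A.** (i) The restriction of $g_2$ to $\operatorname{dom}(g_2)$ is continuous; $\operatorname{dom}(g_2)$ is nonempty, compact, convex; $\operatorname{dom}(g_2)\subseteq\operatorname{dom}(f_2)$; $f_2$ is $l_{f_2}$-Lipschitz on $\operatorname{dom}(g_2)$. (ii) $p^*>f^*$. **Constants.** $\Omega_g=\sup_{x\in\operatorname{dom}(g_2)}\{g(x)-g^*+1\}<\infty$, $C_D=1+D_g(1+D_g)$, $\bar g(c)=\min\{g(x): f(x)\le c\}$, $m_0=\bar g((p^*+f^* )/2)-g^*>0$, $Q_{\rm init}=\max\{1/\delta_{\rm init},\,8/(p^*-f^* ),\,8/m_0\}$. $[a]_+=\max\{a,0\}$. **Operations and $\mathcal O$.** A basic operation is one evaluation of $f_1,f_2,g_1,g_2,\nabla f_1,\nabla g_1$, $\operatorname{prox}_{\tau(g_2+\theta f_2)}$ or $\operatorname{prox}_{\tau(f_2+I_{\operatorname{dom}(g_2)})}$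 ($\tau>0$, $\theta\ge0$; $I_C$ is the indicator function of $C$, equal to $0$ on $C$ and $+\infty$ elsewhere). Constants hidden in $\mathcal O$ are independent of $\epsilon$; they may depend (through logarithmic factors) on the fixed problem data and $\delta_{\rm init}$. **Black-box APG subroutines** (for $\varphi=\varphi_1+\varphi_2$, $\varphi_1$ convex differentiable with $L_{\varphi_1}$-Lipschitz gradient, $L_{\varphi_1}>0$, $\varphi_2$ proper l.s.c. convex with computable prox; a proximal-gradient operation uses a bounded number of basic operations). ${\rm APG}_0(\varphi_1,\varphi_2,\delta,x_{\rm init},D)$, with $\delta>0$ and $D\ge\operatorname{dist}(x_{\rm init},\arg\min\varphi)$, returns $\tilde x\in\operatorname{dom}(\varphi_2)$ with $\varphi(\tilde x)-\min\varphi\le\delta$ within $\mathcal O(D\sqrt{L_{\varphi_1}/\delta})$ proximal-gradient operations. ${\rm APG}_\mu(\varphi_1,\varphi_2,\delta,x_{\rm init})$, where $\varphi_1$ is $\mu$-strongly convex with $\mu>0$, $\operatorname{diam}(\operatorname{dom}\varphi_2)\le D$ and $x_{\rm init}\in\operatorname{dom}(\varphi_2)$, returns $\tilde x\in\operatorname{dom}(\varphi_2)$ with $\operatorname{dist}(0,\partial\varphi(\tilde x))\le\delta$ using $\mathcal O(\sqrt{L_{\varphi_1}/\mu}\,(1+\lceil\log_2(L_{\varphi_1}D/\delta)\rceil_+))$ proximal-gradient operations ($\lceil a\rceil_+$ is the smallest nonnegative integer $\ge a$). **Routine Dual$(\phi,\psi,\sigma,M,x_{\rm init};\delta)$**, $\phi=\phi_1+\phi_2$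 with $\phi_1$ $\mu_{\phi_1}$-strongly convex, $\psi=\psi_1+\psi_2$. Set $\varepsilon_1=\mu_{\phi_1}\delta^2$, $\varepsilon_2=\delta$, $\varepsilon_3=4M\delta$ and $A(z)={\rm APG}_\mu(\phi_1+z\psi_1,\phi_2+z\psi_2,\varepsilon_1,x_{\rm init})$. *Interval search*: $\tilde x=A(0)$; if $[\psi(\tilde x)]_+\le\varepsilon_2$ return $(\tilde x,0)$. Else $a=0$, $b=\sigma$, $\tilde x_a=\tilde x$, $\tilde x_b=A(b)$; while $[\psi(\tilde x_b)]_+>\varepsilon_2$ and $b<M$: $a\gets b$, $b\gets2b$, $\tilde x_a\gets\tilde x_b$, $\tilde x_b\gets A(b)$. If $|b\psi(\tilde x_b)|\le\varepsilon_3$ return $(\tilde x_b,b)$. *Bisection*: otherwise, while $b-a>\mu_{\phi_1}\delta^3$: $z=(a+b)/2$, $x=A(z)$; if $[\psi(x)]_+>\varepsilon_2$ set $a\gets z,\tilde x_a\gets x$; else if $|z\psi(x)|\le\varepsilon_3$ return $(x,z)$; else $b\gets z,\tilde x_b\gets x$. On loop exit return $(\tilde x_b,b)$. **Routine LBInit$(\delta_{\rm init},D_g,B_f,x^f_{\rm init},x^g_{\rm init})$** ($D_g>0$). Start with $\Delta\gets2\delta_{\rm init}$, $x_f\gets x^f_{\rm init}$, $x_g^{\rm ref}\gets x^g_{\rm init}$, $\tilde x\gets x^f_{\rm init}$. For $k=0,1,\dots$: $\Delta\gets\Delta/2$; $x_f\gets{\rm APG}_0(f_1,f_2+I_{\operatorname{dom}(g_2)},\Delta,x_f,D_g)$;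 $x_g^{\rm ref}\gets{\rm APG}_0(g_1,g_2,\Delta,x_g^{\rm ref},D_g)$; $l\gets f(x_f)+\Delta$; $M_\Delta\gets\max\{(g(x_f)-g(x_g^{\rm ref})+1)/\Delta,1\}$; $C_\Delta\gets4C_DM_\Delta$; $\eta\gets\Delta/C_D$; $(\tilde x,\cdot)\gets$ Dual$(G_\eta,f-l,1,M_\Delta,\tilde x;\Delta/C_\Delta)$; if $g(\tilde x)-g(x_g^{\rm ref})>\Delta$ return $(l,\Delta,x_f,M_\Delta)$. Here and below $G_\eta=g+\frac\eta2\|\cdot-x_f\|^2$, and Dual is applied to $(G_\eta,f-c)$ with $\phi_1=g_1+\frac\eta2\|\cdot-x_f\|^2$, $\phi_2=g_2$, $\psi_1=f_1-c$, $\psi_2=f_2$, $\mu_{\phi_1}=\eta$. **VTest.** Given $(l_0,\Delta,x_f,M_\Delta)$ returned by LBInit and $C_\Delta=4C_DM_\Delta$, for $c\ge l_0$, $0<\delta\le1/B_f$, $x_{\rm in}\in\operatorname{dom}(g_2)$: VTest$(c,\delta,x_{\rm in})=$ Dual$(G_\eta,f-c,1,M_\Delta,x_{\rm in};\delta/C_\Delta)$ with $\eta=\delta/C_D$. **Algorithm BiVFA.** 1. $(l_0,\Delta,x_f,M_\Delta)\gets$ LBInit$(\delta_{\rm init},D_g,B_f,x^f_{\rm init},x^g_{\rm init})$. 2. $x_g\gets{\rm APG}_0(g_1,g_2,\epsilon/2,x^g_{\rm init},D_g)$, $u_0\gets f(x_g)$; if $u_0-l_0\le\epsilon$ return $x_g$.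 3. $t\gets0$, $x_u\gets x_g$, $\delta_0^{\rm in}\gets\delta_{\rm init}$. 4. While $u_t-l_t>\epsilon$: set $w_t=u_t-l_t$, $c_t=(l_t+u_t)/2$, $\delta_t^0=\min\{\delta_t^{\rm in},w_t/4\}$, $j=0$; $(x_{c_t},\cdot)\gets$ VTest$(c_t,\delta_t^0,x_u)$; while $\epsilon/2<g(x_{c_t})-g(x_g)\le\delta_t^j$: $j\gets j+1$, $\delta_t^j\gets\delta_t^{j-1}/2$, $(x_{c_t},\cdot)\gets$ VTest$(c_t,\delta_t^j,x_{c_t})$. Then $\delta_t\gets\delta_t^j$, $\delta_{t+1}^{\rm in}\gets\delta_t$; if $g(x_{c_t})-g(x_g)>\delta_t$ set $(l_{t+1},u_{t+1})=(c_t,u_t)$; else $x_u\gets x_{c_t}$, $(l_{t+1},u_{t+1})=(l_t,f(x_u))$; $t\gets t+1$. 5. Return $x_u$. *)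

theory Defs
  imports "HOL-Analysis.Analysis" "HOL-Library.Monad_Syntax"
begin

section \<open>Convex analysis for functions with values in \<open>\<real> \<union> {+\<infinity>}\<close>\<close>

definition effdom :: "('a \<Rightarrow> ereal) \<Rightarrow> 'a set" where
  "effdom h = {x. h x < \<infinity>}"

definition proper_lsc_convex :: "('a::euclidean_space \<Rightarrow> ereal) \<Rightarrow> bool" where
  "proper_lsc_convex h \<longleftrightarrow>
     effdom h \<noteq> {} \<and> (\<forall>x. h x \<noteq> -\<infinity>) \<and>
     (\<forall>x. h x \<le> Liminf (at x) h) \<and>
     convex {(x, r::real). h x \<le> ereal r}"

definition subdifferential :: "('a::euclidean_space \<Rightarrow> ereal) \<Rightarrow> 'a \<Rightarrow> 'a set" where
  "subdifferential h x = {s. \<forall>y. h x + ereal (s \<bullet> (y - x)) \<le> h y}"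

definition ind :: "'a set \<Rightarrow> 'a \<Rightarrow> ereal" where
  "ind C x = (if x \<in> C then 0 else \<infinity>)"

definition smooth_convex :: "real \<Rightarrow> ('a::euclidean_space \<Rightarrow> real) \<Rightarrow> bool" where
  "smooth_convex L \<phi> \<longleftrightarrow>
     convex_on UNIV \<phi> \<and> (\<exists>G. (\<forall>x. GDERIV \<phi> x :> G x) \<and> L-lipschitz_on UNIV G)"

definition strongly_convex :: "real \<Rightarrow> ('a::euclidean_space \<Rightarrow> real) \<Rightarrow> bool" where
  "strongly_convex \<mu> \<phi> \<longleftrightarrow>
     (\<forall>x y. \<forall>t\<in>{0..1}.
        \<phi> ((1 - t) *\<^sub>R x + t *\<^sub>R y)
          \<le> (1 - t) * \<phi> x + t * \<phi> y - \<mu> / 2 * t * (1 - t) * (norm (x - y))\<^sup>2)"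

definition composite :: "('a \<Rightarrow> real) \<Rightarrow> ('a \<Rightarrow> ereal) \<Rightarrow> 'a \<Rightarrow> ereal" where
  "composite \<phi>1 \<phi>2 x = ereal (\<phi>1 x) + \<phi>2 x"

definition argmin_set :: "('a \<Rightarrow> ereal) \<Rightarrow> 'a set \<Rightarrow> 'a set" where
  "argmin_set h S = {x. is_arg_min h (\<lambda>y. y \<in> S) x}"


section \<open>The simple bilevel problem\<close>

text \<open>\<open>Lf1\<close> and \<open>Lg1\<close> are the Lipschitz constants of the gradients of \<open>f1\<close> and \<open>g1\<close> that are
  handed to the accelerated proximal gradient subroutines.\<close>

record 'a sbo =
  f1 :: "'a \<Rightarrow> real"
  f2 :: "'a \<Rightarrow> ereal"
  g1 :: "'a \<Rightarrow> real"
  g2 :: "'a \<Rightarrow> ereal"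
  Lf1 :: real
  Lg1 :: real

definition fobj :: "'a sbo \<Rightarrow> 'a \<Rightarrow> ereal" where
  "fobj P = composite (f1 P) (f2 P)"

definition gobj :: "'a sbo \<Rightarrow> 'a \<Rightarrow> ereal" where
  "gobj P = composite (g1 P) (g2 P)"

abbreviation domg :: "'a sbo \<Rightarrow> 'a set" where
  "domg P \<equiv> effdom (g2 P)"

definition lower_solutions :: "'a sbo \<Rightarrow> 'a set" where
  "lower_solutions P = argmin_set (gobj P) UNIV"

definition sbo_solutions :: "'a sbo \<Rightarrow> 'a set" where
  "sbo_solutions P = argmin_set (fobj P) (lower_solutions P)"

definition sbo_problem :: "'a::euclidean_space sbo \<Rightarrow> bool" where
  "sbo_problem P \<longleftrightarrow>
     0 < Lf1 P \<and> smooth_convex (Lf1 P) (f1 P) \<and>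
     1 \<le> Lg1 P \<and> smooth_convex (Lg1 P) (g1 P) \<and>
     proper_lsc_convex (f2 P) \<and> proper_lsc_convex (g2 P) \<and>
     lower_solutions P \<noteq> {} \<and> sbo_solutions P \<noteq> {}"

text \<open>All the optimal values below are finite under \<open>sbo_problem\<close> and \<open>assumption_A\<close>; they are
  formed in \<^typ>\<open>ereal\<close> and then read as real numbers.\<close>

definition g_star :: "'a sbo \<Rightarrow> real" where
  "g_star P = real_of_ereal (INF x\<in>domg P. gobj P x)"

definition f_star :: "'a sbo \<Rightarrow> real" where
  "f_star P = real_of_ereal (INF x\<in>domg P. fobj P x)"

definition p_star :: "'a sbo \<Rightarrow> real" where
  "p_star P = real_of_ereal (INF x\<in>lower_solutions P. fobj P x)"

definition g_bar :: "'a sbo \<Rightarrow> real \<Rightarrow> real" where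
  "g_bar P c = real_of_ereal (INF x\<in>{x. fobj P x \<le> ereal c}. gobj P x)"

definition assumption_A :: "'a::euclidean_space sbo \<Rightarrow> bool" where
  "assumption_A P \<longleftrightarrow>
     continuous_on (domg P) (g2 P) \<and>
     domg P \<noteq> {} \<and> compact (domg P) \<and> convex (domg P) \<and>
     domg P \<subseteq> effdom (f2 P) \<and>
     (\<exists>l. l-lipschitz_on (domg P) (\<lambda>x. real_of_ereal (f2 P x))) \<and>
     f_star P < p_star P"

definition eps_optimal :: "'a sbo \<Rightarrow> real \<Rightarrow> real \<Rightarrow> 'a \<Rightarrow> bool" where
  "eps_optimal P \<epsilon>f \<epsilon>g x \<longleftrightarrow>
     x \<in> domg P \<and>
     fobj P x - ereal (p_star P) \<le> ereal \<epsilon>f \<and>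
     gobj P x - ereal (g_star P) \<le> ereal \<epsilon>g"

definition Omega_g :: "'a sbo \<Rightarrow> real" where
  "Omega_g P = real_of_ereal (SUP x\<in>domg P. gobj P x - ereal (g_star P) + 1)"

definition C_D :: "real \<Rightarrow> real" where
  "C_D Dg = 1 + Dg * (1 + Dg)"

definition m_0 :: "'a sbo \<Rightarrow> real" where
  "m_0 P = g_bar P ((p_star P + f_star P) / 2) - g_star P"

definition Q_init :: "'a sbo \<Rightarrow> real \<Rightarrow> real" where
  "Q_init P \<delta>init = max (1 / \<delta>init) (max (8 / (p_star P - f_star P)) (8 / m_0 P))"


section \<open>Computations with a count of basic operations\<close>

text \<open>\<^term>\<open>None\<close> is a computation that does not terminate; \<^term>\<open>Some (r, n)\<close> is one that
  returns \<^term>\<open>r\<close> after \<^term>\<open>n\<close> basic operations.\<close>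

type_synonym 'r comp = "('r \<times> nat) option"

definition return :: "'r \<Rightarrow> 'r comp" where
  "return r = Some (r, 0)"

definition bind_comp :: "'r comp \<Rightarrow> ('r \<Rightarrow> 's comp) \<Rightarrow> 's comp" where
  "bind_comp m k =
     Option.bind m (\<lambda>p. Option.bind (k (fst p)) (\<lambda>q. Some (fst q, snd p + snd q)))"

no_adhoc_overloading Monad_Syntax.bind \<rightleftharpoons> Option.bind
adhoc_overloading Monad_Syntax.bind \<rightleftharpoons> bind_comp

lemma bind_comp_mono [partial_function_mono]:
  assumes "mono_option B" and "\<And>y. mono_option (\<lambda>f. C y f)"
  shows "mono_option (\<lambda>f. bind_comp (B f) (\<lambda>y. C y f))"
  unfolding bind_comp_def
  by (intro bind_mono assms) (simp_all add: monotone_def option.leq_refl)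

text \<open>Iterates the body until it yields \<open>Inr r\<close>; \<open>Inl s\<close> asks for another round in state \<open>s\<close>.\<close>

partial_function (option) loop :: "('s \<Rightarrow> ('s + 'r) comp) \<Rightarrow> 's \<Rightarrow> 'r comp" where
  "loop body s = do {
     x \<leftarrow> body s;
     (case x of Inl s' \<Rightarrow> loop body s' | Inr r \<Rightarrow> return r)
   }"

text \<open>Evaluating \<open>\<phi>1 + \<phi>2\<close> takes one evaluation of each summand.  The algorithms evaluate only at
  points where \<open>\<phi>2\<close> is finite.\<close>

definition evaluate :: "('a \<Rightarrow> real) \<Rightarrow> ('a \<Rightarrow> ereal) \<Rightarrow> 'a \<Rightarrow> real comp" where
  "evaluate \<phi>1 \<phi>2 x = Some (\<phi>1 x + real_of_ereal (\<phi>2 x), 2)"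

definition evalf :: "'a sbo \<Rightarrow> 'a \<Rightarrow> real comp" where
  "evalf P = evaluate (f1 P) (f2 P)"

definition evalg :: "'a sbo \<Rightarrow> 'a \<Rightarrow> real comp" where
  "evalg P = evaluate (g1 P) (g2 P)"


section \<open>Black-box accelerated proximal gradient subroutines\<close>

text \<open>A black box returns a point together with the number of basic operations it has used.  It is
  told the Lipschitz constant \<open>L\<close> of the gradient of \<open>\<phi>1\<close>, and in the strongly convex case the
  modulus \<open>\<mu>\<close>:

  \<^item> \<open>apg0 L \<phi>1 \<phi>2 \<delta> xinit D\<close>
  \<^item> \<open>apgmu \<mu> L \<phi>1 \<phi>2 \<delta> xinit\<close>\<close>

type_synonym 'a apg0 =
  "real \<Rightarrow> ('a \<Rightarrow> real) \<Rightarrow> ('a \<Rightarrow> ereal) \<Rightarrow> real \<Rightarrow> 'a \<Rightarrow> real \<Rightarrow> 'a \<times> nat"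

type_synonym 'a apgmu =
  "real \<Rightarrow> real \<Rightarrow> ('a \<Rightarrow> real) \<Rightarrow> ('a \<Rightarrow> ereal) \<Rightarrow> real \<Rightarrow> 'a \<Rightarrow> 'a \<times> nat"

text \<open>The nonsmooth functions whose proximal maps are basic operations.  Since
  \<^prop>\<open>(0::ereal) * \<infinity> = 0\<close>, the case \<^prop>\<open>\<theta> = 0\<close> is \<open>g2\<close> itself.\<close>

definition prox_available :: "'a sbo \<Rightarrow> ('a \<Rightarrow> ereal) \<Rightarrow> bool" where
  "prox_available P \<phi>2 \<longleftrightarrow>
     (\<exists>\<theta>\<ge>0. \<phi>2 = (\<lambda>x. g2 P x + ereal \<theta> * f2 P x)) \<or>
     \<phi>2 = (\<lambda>x. f2 P x + ind (domg P) x)"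

text \<open>In both specifications \<open>N\<close> is the number of proximal-gradient operations, each of which uses
  at most \<open>\<kappa>\<close> basic operations, and \<open>K\<close> is the constant of the \<open>\<O>\<close>-bound on \<open>N\<close>.  The summand
  \<open>1\<close> in the first bound is there because \<open>N\<close> is an integer: \<open>D * sqrt (L / \<delta>)\<close> may be smaller
  than one.\<close>

definition apg0_spec :: "nat \<Rightarrow> real \<Rightarrow> 'a::euclidean_space sbo \<Rightarrow> 'a apg0 \<Rightarrow> bool" where
  "apg0_spec \<kappa> K P apg0 \<longleftrightarrow>
     (\<forall>L \<phi>1 \<phi>2 \<delta> xinit D.
        0 < L \<and> smooth_convex L \<phi>1 \<and> proper_lsc_convex \<phi>2 \<and> prox_available P \<phi>2 \<and> 0 < \<delta> \<and>
        argmin_set (composite \<phi>1 \<phi>2) UNIV \<noteq> {} \<and>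
        infdist xinit (argmin_set (composite \<phi>1 \<phi>2) UNIV) \<le> D
        \<longrightarrow> (case apg0 L \<phi>1 \<phi>2 \<delta> xinit D of (x, n) \<Rightarrow>
              x \<in> effdom \<phi>2 \<and>
              composite \<phi>1 \<phi>2 x - (INF y. composite \<phi>1 \<phi>2 y) \<le> ereal \<delta> \<and>
              (\<exists>N::nat. n \<le> \<kappa> * N \<and> real N \<le> K * (1 + D * sqrt (L / \<delta>)))))"

text \<open>The subdifferential is required to be nonempty because \<^const>\<open>infdist\<close> gives distance \<open>0\<close> to
  the empty set, and the domain to be bounded because \<^const>\<open>diameter\<close> is meaningful only then.\<close>

definition apgmu_spec :: "nat \<Rightarrow> real \<Rightarrow> 'a::euclidean_space sbo \<Rightarrow> 'a apgmu \<Rightarrow> bool" where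
  "apgmu_spec \<kappa> K P apgmu \<longleftrightarrow>
     (\<forall>\<mu> L \<phi>1 \<phi>2 \<delta> xinit D.
        0 < L \<and> smooth_convex L \<phi>1 \<and> 0 < \<mu> \<and> strongly_convex \<mu> \<phi>1 \<and>
        proper_lsc_convex \<phi>2 \<and> prox_available P \<phi>2 \<and> 0 < \<delta> \<and>
        bounded (effdom \<phi>2) \<and> diameter (effdom \<phi>2) \<le> D \<and> xinit \<in> effdom \<phi>2
        \<longrightarrow> (case apgmu \<mu> L \<phi>1 \<phi>2 \<delta> xinit of (x, n) \<Rightarrow>
              x \<in> effdom \<phi>2 \<and>
              subdifferential (composite \<phi>1 \<phi>2) x \<noteq> {} \<and>
              infdist 0 (subdifferential (composite \<phi>1 \<phi>2) x) \<le> \<delta> \<and>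
              (\<exists>N::nat. n \<le> \<kappa> * N \<and>
                 real N \<le> K * (sqrt (L / \<mu>) * (1 + of_int (max 0 \<lceil>log 2 (L * D / \<delta>)\<rceil>))))))"


section \<open>The algorithm\<close>

text \<open>\<open>\<phi> = \<phi>1 + \<phi>2\<close> and \<open>\<psi> = \<psi>1 + \<psi>2\<close>, where \<open>\<phi>1\<close> is \<open>\<mu>\<close>-strongly convex and \<open>L\<phi>\<close>, \<open>L\<psi>\<close> are
  Lipschitz constants of the gradients of \<open>\<phi>1\<close>, \<open>\<psi>1\<close>.  In the loop states, \<open>vb\<close> is the value
  of \<open>\<psi>\<close> at \<open>xb\<close>.\<close>

definition dual ::
  "'a apgmu \<Rightarrow> real \<Rightarrow> real \<Rightarrow> real
    \<Rightarrow> ('a \<Rightarrow> real) \<Rightarrow> ('a \<Rightarrow> ereal) \<Rightarrow> ('a \<Rightarrow> real) \<Rightarrow> ('a \<Rightarrow> ereal)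
    \<Rightarrow> real \<Rightarrow> real \<Rightarrow> 'a \<Rightarrow> real \<Rightarrow> ('a \<times> real) comp" where
  "dual apgmu \<mu> L\<phi> L\<psi> \<phi>1 \<phi>2 \<psi>1 \<psi>2 \<sigma> M xinit \<delta> =
    (let \<epsilon>1 = \<mu> * \<delta>\<^sup>2; \<epsilon>2 = \<delta>; \<epsilon>3 = 4 * M * \<delta>;
         A = (\<lambda>z. do {
           x \<leftarrow> Some (apgmu \<mu> (L\<phi> + z * L\<psi>) (\<lambda>x. \<phi>1 x + z * \<psi>1 x) (\<lambda>x. \<phi>2 x + ereal z * \<psi>2 x)
                  \<epsilon>1 xinit);
           v \<leftarrow> evaluate \<psi>1 \<psi>2 x;
           return (x, v) })
     in do {
       (x0, v0) \<leftarrow> A 0;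
       (if max v0 0 \<le> \<epsilon>2 then return (x0, 0)
        else do {
          (x\<sigma>, v\<sigma>) \<leftarrow> A \<sigma>;
          (a, b, xa, xb, vb) \<leftarrow> loop (\<lambda>(a, b, xa, xb, vb).
             if max vb 0 > \<epsilon>2 \<and> b < M
             then do {
               (x, v) \<leftarrow> A (2 * b);
               return (Inl (b, 2 * b, xb, x, v)) }
             else return (Inr (a, b, xa, xb, vb)))
            (0, \<sigma>, x0, x\<sigma>, v\<sigma>);
          (if \<bar>b * vb\<bar> \<le> \<epsilon>3 then return (xb, b)
           else loop (\<lambda>(a, b, xa, xb).
             if b - a > \<mu> * \<delta> ^ 3
             then do {
               let z = (a + b) / 2;
               (x, v) \<leftarrow> A z;
               return
                 (if max v 0 > \<epsilon>2 then Inl (z, b, x, xb)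
                  else if \<bar>z * v\<bar> \<le> \<epsilon>3 then Inr (x, z)
                  else Inl (a, z, xa, x)) }
             else return (Inr (xb, b)))
            (a, b, xa, xb)) }) })"

text \<open>\<open>Dual(G\<^sub>\<eta>, f - c, 1, M, xin; \<delta>)\<close> with \<open>G\<^sub>\<eta> = g + \<eta>/2 \<parallel>\<cdot> - xf\<parallel>\<^sup>2\<close>\<close>

definition dual_penalized ::
  "'a::euclidean_space sbo \<Rightarrow> 'a apgmu \<Rightarrow> real \<Rightarrow> 'a \<Rightarrow> real \<Rightarrow> real \<Rightarrow> 'a \<Rightarrow> real
    \<Rightarrow> ('a \<times> real) comp" where
  "dual_penalized P apgmu \<eta> xf c M xin \<delta> =
     dual apgmu \<eta> (Lg1 P + \<eta>) (Lf1 P)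
       (\<lambda>x. g1 P x + \<eta> / 2 * (norm (x - xf))\<^sup>2) (g2 P)
       (\<lambda>x. f1 P x - c) (f2 P) 1 M xin \<delta>"

text \<open>\<open>Bf\<close> is an input of the method, but it enters only through the requirement
  \<open>\<delta>init \<le> 1 / Bf\<close>.\<close>

definition LBInit ::
  "'a::euclidean_space sbo \<Rightarrow> 'a apg0 \<Rightarrow> 'a apgmu \<Rightarrow> real \<Rightarrow> real \<Rightarrow> real \<Rightarrow> 'a \<Rightarrow> 'a
    \<Rightarrow> (real \<times> real \<times> 'a \<times> real) comp" where
  "LBInit P apg0 apgmu \<delta>init Dg Bf xfinit xginit =
     loop (\<lambda>(\<Delta>', xf', xref', xt'). do {
       let \<Delta> = \<Delta>' / 2;
       xf \<leftarrow> Some (apg0 (Lf1 P) (f1 P) (\<lambda>x. f2 P x + ind (domg P) x) \<Delta> xf' Dg);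
       xref \<leftarrow> Some (apg0 (Lg1 P) (g1 P) (g2 P) \<Delta> xref' Dg);
       vf \<leftarrow> evalf P xf;
       let l = vf + \<Delta>;
       vgf \<leftarrow> evalg P xf;
       vgref \<leftarrow> evalg P xref;
       let M = max ((vgf - vgref + 1) / \<Delta>) 1;
       let C = 4 * C_D Dg * M;
       let \<eta> = \<Delta> / C_D Dg;
       (xt, z) \<leftarrow> dual_penalized P apgmu \<eta> xf l M xt' (\<Delta> / C);
       vgt \<leftarrow> evalg P xt;
       return (if vgt - vgref > \<Delta> then Inr (l, \<Delta>, xf, M) else Inl (\<Delta>, xf, xref, xt))
     }) (2 * \<delta>init, xfinit, xginit, xfinit)"

definition VTest ::
  "'a::euclidean_space sbo \<Rightarrow> 'a apgmu \<Rightarrow> real \<Rightarrow> 'a \<Rightarrow> real \<Rightarrow> real \<Rightarrow> real \<Rightarrow> 'a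
    \<Rightarrow> ('a \<times> real) comp" where
  "VTest P apgmu Dg xf M c \<delta> xin =
     dual_penalized P apgmu (\<delta> / C_D Dg) xf c M xin (\<delta> / (4 * C_D Dg * M))"

text \<open>The outer loop state is \<open>(l\<^sub>t, u\<^sub>t, x\<^sub>u, \<delta>\<^sub>t\<^sup>i\<^sup>n)\<close>, the inner one \<open>(x\<^sub>c, \<delta>\<^sub>t\<^sup>j, g(x\<^sub>c))\<close>.\<close>

definition BiVFA ::
  "'a::euclidean_space sbo \<Rightarrow> 'a apg0 \<Rightarrow> 'a apgmu \<Rightarrow> real \<Rightarrow> real \<Rightarrow> real \<Rightarrow> real \<Rightarrow> 'a \<Rightarrow> 'a
    \<Rightarrow> 'a comp" where
  "BiVFA P apg0 apgmu \<epsilon> Dg Bf \<delta>init xfinit xginit = do {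
     (l0, \<Delta>, xf, M) \<leftarrow> LBInit P apg0 apgmu \<delta>init Dg Bf xfinit xginit;
     xg \<leftarrow> Some (apg0 (Lg1 P) (g1 P) (g2 P) (\<epsilon> / 2) xginit Dg);
     u0 \<leftarrow> evalf P xg;
     (if u0 - l0 \<le> \<epsilon> then return xg
      else do {
        vg \<leftarrow> evalg P xg;
        loop (\<lambda>(l, u, xu, \<delta>in).
          if u - l > \<epsilon>
          then do {
            let w = u - l;
            let c = (l + u) / 2;
            let \<delta>0 = min \<delta>in (w / 4);
            (x0, z0) \<leftarrow> VTest P apgmu Dg xf M c \<delta>0 xu;
            v0 \<leftarrow> evalg P x0;
            (xc, \<delta>, v) \<leftarrow> loop (\<lambda>(x, \<delta>, v).
               if \<epsilon> / 2 < v - vg \<and> v - vg \<le> \<delta>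
               then do {
                 (x', z') \<leftarrow> VTest P apgmu Dg xf M c (\<delta> / 2) x;
                 v' \<leftarrow> evalg P x';
                 return (Inl (x', \<delta> / 2, v')) }
               else return (Inr (x, \<delta>, v)))
              (x0, \<delta>0, v0);
            (if v - vg > \<delta> then return (Inl (c, u, xu, \<delta>))
             else do {
               u' \<leftarrow> evalf P xc;
               return (Inl (l, u', xc, \<delta>)) }) }
          else return (Inr xu))
         (l0, u0, xg, \<delta>init) }) }"


section \<open>Quantities of the complexity bound\<close>

text \<open>The constants hidden in \<open>\<O>\<close> may depend on the problem data and on \<open>\<delta>init\<close> only through
  logarithmic factors, that is, through a power of the following quantity.  The numbers
  \<open>1 / \<delta>init\<close>, \<open>1 / (p* - f*)\<close> and \<open>1 / m\<^sub>0\<close> are covered by \<^const>\<open>Q_init\<close>.\<close>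

definition log_data :: "'a sbo \<Rightarrow> real \<Rightarrow> real \<Rightarrow> real \<Rightarrow> real" where
  "log_data P Dg Bf \<delta>init =
     1 + ln (1 + Lf1 P + Lg1 P + Dg + Bf + Omega_g P + Q_init P \<delta>init)"

definition bound_pre :: "'a sbo \<Rightarrow> real \<Rightarrow> real \<Rightarrow> real" where
  "bound_pre P Dg \<delta>init =
     (sqrt (C_D Dg * Lf1 P * Omega_g P) * Q_init P \<delta>init
       + sqrt (C_D Dg * Lg1 P) * sqrt (Q_init P \<delta>init)) * (1 + ln (Q_init P \<delta>init))\<^sup>2"

definition bound_main :: "'a sbo \<Rightarrow> real \<Rightarrow> real \<Rightarrow> real \<Rightarrow> real" where
  "bound_main P Dg \<delta>init \<epsilon> =
     Dg * sqrt (Lg1 P / \<epsilon>)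
       + sqrt (C_D Dg / \<epsilon> * (Lg1 P + Lf1 P * Omega_g P * Q_init P \<delta>init))
         * (1 + ln (1 / \<epsilon>)) ^ 3"

end

theory Submission
  imports Defs
begin

text \<open>Write \<open>S\<close> for the domain of \<open>g2\<close>, on which both objectives are finite and continuous.

  \<^bold>\<open>The test.\<close>  The dual search is run on the problem of minimising
  \<open>G\<^sub>\<eta> = g + \<eta>/2 \<parallel>\<cdot> - xf\<parallel>\<^sup>2\<close> subject to \<open>f \<le> c\<close>.  For a multiplier \<open>z\<close> it gets a point that is almost
  stationary for \<open>G\<^sub>\<eta> + z (f - c)\<close>, and strong convexity turns this into a quantitative
  near-minimality (\<open>near_stationary_estimate\<close>).  Comparing the near-minimality at two multipliers shows
  that these points depend on \<open>z\<close> in a Lipschitz way up to the accuracy of the solver.  Since the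
  bisection separates a point with \<open>f - c > \<delta>\<close> from one with \<open>f - c < -2\<delta>\<close>, its interval can never
  become as short as its tolerance, and the search must end at a point that is almost feasible and
  almost complementary (\<open>runs_dual\<close>).  The slack of \<open>xf\<close> bounds the multipliers by \<open>2 M\<close>.  It follows
  that a test for the value \<open>c\<close> at level \<open>t\<close> returns \<open>x\<close> with \<open>f(x) \<le> c + t/4\<close> and
  \<open>g(x) \<le> g(y) + t\<close> for all \<open>y \<in> S\<close> with \<open>f(y) \<le> c\<close> (\<open>runs_VTest\<close>).

  \<^bold>\<open>Correctness.\<close>  If \<open>c \<ge> p*\<close>, then \<open>y\<close> can be a solution of the bilevel problem and
  \<open>g(x) \<le> g* + t\<close>; so a larger value of \<open>g(x)\<close> certifies \<open>c < p*\<close> (\<open>test_lower_bound\<close>).  This justifies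
  the lower bound of the initialisation and every increase of \<open>l\<close>.  A point that replaces \<open>x\<^sub>u\<close> satisfies
  \<open>g(x) \<le> g* + \<epsilon>\<close>, and at the end \<open>f(x\<^sub>u) \<le> l + \<epsilon> \<le> p* + \<epsilon>\<close>.

  \<^bold>\<open>Complexity.\<close>  The initialisation ends once \<open>\<Delta> \<le> 1/Q\<close>, because then the tested value is below
  \<open>(p* + f*)/2\<close>, where \<open>g\<close> exceeds \<open>g*\<close> by \<open>m\<^sub>0\<close>; hence \<open>1/\<Delta> \<le> 2 Q\<close> and \<open>M \<le> 2 \<Omega> Q\<close>.  In the search phase
  the level of the tests never grows and stays above \<open>\<epsilon>/4\<close>, and each round shrinks the bracket to at
  most \<open>3/4\<close> of its width, so there are only logarithmically many tests.  Each test solves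
  logarithmically many subproblems, at a cost of the square root of their condition number times
  another logarithm.  The rounds of all loops are counted with potentials (\<open>runs_loop\<close>).\<close>


section \<open>Total correctness with operation counts\<close>

text \<open>\<open>runs m Q\<close>: the computation \<open>m\<close> terminates and its result and operation count satisfy \<open>Q\<close>.\<close>

definition runs :: "'r comp \<Rightarrow> ('r \<Rightarrow> nat \<Rightarrow> bool) \<Rightarrow> bool" where
  "runs m Q \<longleftrightarrow> (\<exists>r n. m = Some (r, n) \<and> Q r n)"

lemma runs_Some [simp]: "runs (Some (r, n)) Q = Q r n"
  by (simp add: runs_def)

lemma runs_return [simp]: "runs (return r) Q = Q r 0"
  by (simp add: return_def)

lemma runs_bind [simp]: "runs (bind_comp m k) Q = runs m (\<lambda>r n. runs (k r) (\<lambda>q j. Q q (n + j)))"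
  by (cases m) (auto simp: runs_def bind_comp_def bind_eq_Some_conv)

lemma runs_mono: "runs m Q \<Longrightarrow> (\<And>r n. Q r n \<Longrightarrow> Q' r n) \<Longrightarrow> runs m Q'"
  by (auto simp: runs_def)

lemma runs_evaluate [simp]: "runs (evaluate \<phi>1 \<phi>2 x) Q = Q (\<phi>1 x + real_of_ereal (\<phi>2 x)) 2"
  by (simp add: evaluate_def)

text \<open>Amortised analysis of a loop with invariant \<open>I\<close>: every round is paid for by a decrease of the
  nonnegative potential \<open>\<Phi>\<close>, and the part \<open>\<Psi>\<close> of the potential is left over at the exit.  Since a
  round that continues takes at least one operation, the potential also proves termination.\<close>

lemma runs_loop:
  fixes \<Phi> :: "'s \<Rightarrow> real" and \<Psi> :: "'r \<Rightarrow> real"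
  assumes I: "I s"
    and nonneg: "\<And>s. I s \<Longrightarrow> 0 \<le> \<Phi> s"
    and step: "\<And>s. I s \<Longrightarrow> runs (body s) (\<lambda>x n. case x of
        Inl s' \<Rightarrow> I s' \<and> 1 \<le> n \<and> real n + \<Phi> s' \<le> \<Phi> s
      | Inr r \<Rightarrow> R r \<and> real n + \<Psi> r \<le> \<Phi> s)"
  shows "runs (loop body s) (\<lambda>r n. R r \<and> real n + \<Psi> r \<le> \<Phi> s)"
  using I
proof (induction "nat \<lfloor>\<Phi> s\<rfloor>" arbitrary: s rule: less_induct)
  case less
  from step[OF less.prems] obtain x n where x: "body s = Some (x, n)"
    and Q: "case x of Inl s' \<Rightarrow> I s' \<and> 1 \<le> n \<and> real n + \<Phi> s' \<le> \<Phi> s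
      | Inr r \<Rightarrow> R r \<and> real n + \<Psi> r \<le> \<Phi> s"
    by (auto simp: runs_def)
  show ?case
  proof (cases x)
    case (Inr r)
    then show ?thesis using x Q by (subst loop.simps) simp
  next
    case (Inl s')
    with Q have s': "I s'" "1 \<le> n" "real n + \<Phi> s' \<le> \<Phi> s" by auto
    have "nat \<lfloor>\<Phi> s'\<rfloor> < nat \<lfloor>\<Phi> s\<rfloor>" using s' nonneg[OF s'(1)] by linarith
    from less.hyps[OF this s'(1)] have "runs (loop body s') (\<lambda>r k. R r \<and> real k + \<Psi> r \<le> \<Phi> s')" .
    then show ?thesis
      using x Inl s'(3) by (subst loop.simps) (auto elim!: runs_mono)
  qed
qed


section \<open>Convex functions with values in the extended reals\<close>

text \<open>A continuous convex function on a closed set, extended by \<open>\<infinity>\<close>.  All nonsmooth parts handed to the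
  black boxes have this form.\<close>

lemma proper_lsc_convex_extension:
  fixes q :: "'a::euclidean_space \<Rightarrow> real"
  assumes "S \<noteq> {}" "closed S" and q: "convex_on S q" "continuous_on S q"
  shows "proper_lsc_convex (\<lambda>x. if x \<in> S then ereal (q x) else \<infinity>)"
proof -
  let ?h = "\<lambda>x. if x \<in> S then ereal (q x) else \<infinity>"
  have "?h x \<le> Liminf (at x) ?h" for x
    unfolding le_Liminf_iff
  proof (intro allI impI)
    fix y assume y: "y < ?h x"
    show "\<forall>\<^sub>F u in at x. y < ?h u"
    proof (cases "x \<in> S")
      case False
      have "\<forall>\<^sub>F u in at x. u \<in> - S"
        using \<open>closed S\<close> False
        by (metis ComplI at_within_open eventually_at_topological open_Compl)
      then show ?thesis
        by eventually_elim (use y False in simp)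
    next
      case True
      have "((\<lambda>u. ereal (q u)) \<longlongrightarrow> ereal (q x)) (at x within S)"
        using q(2) True by (auto simp: continuous_on_def)
      then have "\<forall>\<^sub>F u in at x within S. y < ereal (q u)"
        by (rule order_tendstoD(1)) (use y True in simp)
      then show ?thesis
        unfolding eventually_at_filter using True
        by eventually_elim (use y in \<open>auto simp: less_top[symmetric]\<close>)
    qed
  qed
  moreover have "convex {(x, r::real). ?h x \<le> ereal r}"
  proof -
    have "{(x, r::real). ?h x \<le> ereal r} = {(x, r). x \<in> S \<and> q x \<le> r}"
      by (auto split: if_splits)
    also have "\<dots> = epigraph S q" by (auto simp: epigraph_def)
    finally show ?thesis using q(1) by (simp add: convex_epigraph)
  qed
  moreover have "effdom ?h = S" by (auto simp: effdom_def)
  ultimately show ?thesis using \<open>S \<noteq> {}\<close> by (auto simp: proper_lsc_convex_def)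
qed

lemma proper_lsc_convex_imp_convex_on:
  assumes h: "proper_lsc_convex h" and "convex S" "S \<subseteq> effdom h"
  shows "convex_on S (\<lambda>x. real_of_ereal (h x))"
proof -
  have fin: "h x = ereal (real_of_ereal (h x))" if "x \<in> S" for x
    using that assms by (cases "h x") (auto simp: effdom_def proper_lsc_convex_def)
  have cvx: "convex {(x, r::real). h x \<le> ereal r}" using h by (simp add: proper_lsc_convex_def)
  show ?thesis
    unfolding convex_on_def
  proof (intro conjI ballI allI impI)
    fix x y and u v :: real
    assume xy: "x \<in> S" "y \<in> S" and uv: "0 \<le> u" "0 \<le> v" "u + v = 1"
    have "(x, real_of_ereal (h x)) \<in> {(x, r::real). h x \<le> ereal r}"
      "(y, real_of_ereal (h y)) \<in> {(x, r::real). h x \<le> ereal r}"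
      using fin xy by auto
    from convexD[OF cvx this uv]
    have *: "h (u *\<^sub>R x + v *\<^sub>R y) \<le> ereal (u * real_of_ereal (h x) + v * real_of_ereal (h y))"
      by auto
    have "u *\<^sub>R x + v *\<^sub>R y \<in> S" using convexD[OF \<open>convex S\<close> xy uv] .
    from fin[OF this] * show "real_of_ereal (h (u *\<^sub>R x + v *\<^sub>R y))
        \<le> u * real_of_ereal (h x) + v * real_of_ereal (h y)"
      by (metis ereal_less_eq(3))
  qed fact
qed

lemma smooth_convex_add_scaled:
  assumes \<phi>: "smooth_convex L \<phi>" and \<psi>: "smooth_convex L' \<psi>" and "0 \<le> z"
  shows "smooth_convex (L + z * L') (\<lambda>x. \<phi> x + z * \<psi> x)"
proof -
  obtain G G' where G: "\<forall>x. GDERIV \<phi> x :> G x" "L-lipschitz_on UNIV G"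
    and G': "\<forall>x. GDERIV \<psi> x :> G' x" "L'-lipschitz_on UNIV G'"
    using \<phi> \<psi> by (auto simp: smooth_convex_def)
  have "GDERIV (\<lambda>x. \<phi> x + z * \<psi> x) x :> G x + z *\<^sub>R G' x" for x
  proof (rule GDERIV_subst)
    show "GDERIV (\<lambda>x. \<phi> x + z * \<psi> x) x :> G x + (z *\<^sub>R G' x + \<psi> x *\<^sub>R 0)"
      by (intro GDERIV_add GDERIV_mult GDERIV_const G(1)[rule_format] G'(1)[rule_format])
  qed simp
  moreover have "(L + z * L')-lipschitz_on UNIV (\<lambda>x. G x + z *\<^sub>R G' x)"
    by (intro lipschitz_on_add G lipschitz_on_cmult_nonneg G' \<open>0 \<le> z\<close>)
  moreover have "convex_on UNIV (\<lambda>x. \<phi> x + z * \<psi> x)"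
    using \<phi> \<psi> \<open>0 \<le> z\<close> by (auto simp: smooth_convex_def intro!: convex_on_add convex_on_cmul)
  ultimately show ?thesis
    unfolding smooth_convex_def by (intro conjI exI[of _ "\<lambda>x. G x + z *\<^sub>R G' x"]) auto
qed

lemma smooth_convex_const: "smooth_convex 0 (\<lambda>x. c)"
  unfolding smooth_convex_def
  by (auto simp: convex_on_const intro!: GDERIV_const lipschitz_on_constant exI[of _ "\<lambda>x. 0"])

lemma smooth_convex_diff_const:
  assumes "smooth_convex L \<phi>"
  shows "smooth_convex L (\<lambda>x. \<phi> x - c)"
  using smooth_convex_add_scaled[OF assms smooth_convex_const[of "-c"], of 1] by simp

lemma continuous_on_smooth_convex: "smooth_convex L \<phi> \<Longrightarrow> continuous_on A \<phi>"
  unfolding smooth_convex_def gderiv_def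
  by (meson continuous_at_imp_continuous_on has_derivative_continuous)

lemma norm_sq_convex_combination:
  fixes a x y :: "'a::real_inner"
  shows "(norm ((1 - t) *\<^sub>R x + t *\<^sub>R y - a))\<^sup>2
    = (1 - t) * (norm (x - a))\<^sup>2 + t * (norm (y - a))\<^sup>2 - t * (1 - t) * (norm (x - y))\<^sup>2"
proof -
  have "(1 - t) *\<^sub>R x + t *\<^sub>R y - a = (1 - t) *\<^sub>R (x - a) + t *\<^sub>R (y - a)"
    by (simp add: algebra_simps)
  moreover have "x - y = (x - a) - (y - a)" by simp
  ultimately show ?thesis
    unfolding power2_norm_eq_inner
    by (simp only: inner_add_left inner_add_right inner_diff_left inner_diff_right
        inner_scaleR_left inner_scaleR_right) (simp add: inner_commute algebra_simps)
qed

lemma smooth_convex_quadratic: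
  fixes a :: "'a::euclidean_space"
  assumes "0 \<le> \<eta>"
  shows "smooth_convex \<eta> (\<lambda>x. \<eta> / 2 * (norm (x - a))\<^sup>2)"
proof -
  have "GDERIV (\<lambda>x. \<eta> / 2 * (norm (x - a))\<^sup>2) x :> \<eta> *\<^sub>R (x - a)" for x
    unfolding gderiv_def power2_norm_eq_inner
    by (auto intro!: derivative_eq_intros simp: inner_commute algebra_simps)
  moreover have "\<eta>-lipschitz_on UNIV (\<lambda>x. \<eta> *\<^sub>R (x - a))"
    using assms by (auto simp: lipschitz_on_def dist_norm simp flip: scaleR_diff_right)
  moreover have "convex_on UNIV (\<lambda>x. \<eta> / 2 * (norm (x - a))\<^sup>2)"
  proof (intro convex_onI convex_UNIV)
    fix t x y assume t: "0 < (t::real)" "t < 1"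
    have "(norm ((1 - t) *\<^sub>R x + t *\<^sub>R y - a))\<^sup>2
      \<le> (1 - t) * (norm (x - a))\<^sup>2 + t * (norm (y - a))\<^sup>2"
      unfolding norm_sq_convex_combination using t by simp
    then have "\<eta> / 2 * (norm ((1 - t) *\<^sub>R x + t *\<^sub>R y - a))\<^sup>2
      \<le> \<eta> / 2 * ((1 - t) * (norm (x - a))\<^sup>2 + t * (norm (y - a))\<^sup>2)"
      using assms by (intro mult_left_mono) auto
    also have "\<dots> = (1 - t) * (\<eta> / 2 * (norm (x - a))\<^sup>2) + t * (\<eta> / 2 * (norm (y - a))\<^sup>2)"
      by (simp add: field_simps)
    finally show "\<eta> / 2 * (norm ((1 - t) *\<^sub>R x + t *\<^sub>R y - a))\<^sup>2
      \<le> (1 - t) * (\<eta> / 2 * (norm (x - a))\<^sup>2) + t * (\<eta> / 2 * (norm (y - a))\<^sup>2)" .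
  qed
  ultimately show ?thesis
    unfolding smooth_convex_def by (intro conjI exI[of _ "\<lambda>x. \<eta> *\<^sub>R (x - a)"]) auto
qed

lemma strongly_convex_quadratic:
  fixes a :: "'a::euclidean_space"
  shows "strongly_convex \<eta> (\<lambda>x. \<eta> / 2 * (norm (x - a))\<^sup>2)"
  unfolding strongly_convex_def norm_sq_convex_combination by (simp add: field_simps)

lemma strongly_convex_add:
  assumes "strongly_convex \<mu> \<phi>" "convex_on UNIV \<psi>"
  shows "strongly_convex \<mu> (\<lambda>x. \<psi> x + \<phi> x)"
  unfolding strongly_convex_def
proof (intro allI ballI)
  fix x y and t :: real assume t: "t \<in> {0..1}"
  have "\<psi> ((1 - t) *\<^sub>R x + t *\<^sub>R y) \<le> (1 - t) * \<psi> x + t * \<psi> y"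
    using assms(2) t by (intro convex_onD) auto
  moreover have "\<phi> ((1 - t) *\<^sub>R x + t *\<^sub>R y)
      \<le> (1 - t) * \<phi> x + t * \<phi> y - \<mu> / 2 * t * (1 - t) * (norm (x - y))\<^sup>2"
    using assms(1) t by (auto simp: strongly_convex_def)
  ultimately show "\<psi> ((1 - t) *\<^sub>R x + t *\<^sub>R y) + \<phi> ((1 - t) *\<^sub>R x + t *\<^sub>R y)
    \<le> (1 - t) * (\<psi> x + \<phi> x) + t * (\<psi> y + \<phi> y) - \<mu> / 2 * t * (1 - t) * (norm (x - y))\<^sup>2"
    by (simp add: algebra_simps)
qed

text \<open>A point with a subgradient of norm at most \<open>e\<close> almost minimises the function, and strong
  convexity strengthens the estimate by a quadratic term.  Here \<open>h\<close> is the finite part of an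
  extended real function with effective domain \<open>S\<close>.\<close>

lemma near_stationary_estimate:
  fixes h :: "'a::euclidean_space \<Rightarrow> real"
  assumes "convex S" "x \<in> S" "y \<in> S"
    and k: "\<And>y. y \<in> S \<Longrightarrow> k y = ereal (h y)"
    and ne: "subdifferential k x \<noteq> {}" and dist: "infdist 0 (subdifferential k x) \<le> e"
    and sc: "\<And>t. 0 < t \<Longrightarrow> t < 1 \<Longrightarrow> h ((1 - t) *\<^sub>R x + t *\<^sub>R y)
          \<le> (1 - t) * h x + t * h y - \<mu> / 2 * t * (1 - t) * (norm (x - y))\<^sup>2"
  shows "h x \<le> h y + e * norm (x - y) - \<mu> / 2 * (norm (x - y))\<^sup>2"
proof -
  let ?d = "norm (x - y)"
  \<comment> \<open>The distance need not be attained, hence the extra \<open>r\<close>.\<close>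
  have sub: "h x \<le> h w + (e + r) * norm (x - w)" if w: "w \<in> S" and "0 < r" for w r
  proof -
    obtain s where s: "s \<in> subdifferential k x" and ns: "norm s < e + r"
    proof -
      have "infdist 0 (subdifferential k x) < e + r" using dist \<open>0 < r\<close> by simp
      then show ?thesis using that ne
        by (auto simp: infdist_notempty cINF_less_iff[OF ne bdd_belowI2[of _ 0]])
    qed
    have "h x + s \<bullet> (w - x) \<le> h w"
      using s k[OF w] k[OF \<open>x \<in> S\<close>] by (auto simp: subdifferential_def dest!: spec[of _ w])
    moreover have "- (s \<bullet> (w - x)) \<le> norm s * norm (x - w)"
      by (metis abs_ge_minus_self Cauchy_Schwarz_ineq2 norm_minus_commute order_trans)
    moreover have "norm s * norm (x - w) \<le> (e + r) * norm (x - w)"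
      using ns by (intro mult_right_mono) auto
    ultimately show ?thesis by linarith
  qed
  \<comment> \<open>Apply \<open>sub\<close> at a point of the segment from \<open>x\<close> to \<open>y\<close>, divide by \<open>t\<close> and let \<open>t\<close> tend to 0.\<close>
  have step: "h x + \<mu> / 2 * (1 - t) * ?d\<^sup>2 \<le> h y + (e + r) * ?d" if "0 < r" "0 < t" "t < 1" for r t
  proof -
    have "(1 - t) *\<^sub>R x + t *\<^sub>R y \<in> S"
      using convexD_alt[OF \<open>convex S\<close> \<open>x \<in> S\<close> \<open>y \<in> S\<close>, of t] that by simp
    from sub[OF this \<open>0 < r\<close>]
    have "h x \<le> h ((1 - t) *\<^sub>R x + t *\<^sub>R y) + (e + r) * norm (t *\<^sub>R (x - y))"
      by (simp add: algebra_simps)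
    also have "\<dots> \<le> (1 - t) * h x + t * h y - \<mu> / 2 * t * (1 - t) * ?d\<^sup>2 + (e + r) * (t * ?d)"
      using sc[of t] that by simp
    finally have "t * (h x + \<mu> / 2 * (1 - t) * ?d\<^sup>2) \<le> t * (h y + (e + r) * ?d)"
      by (simp add: algebra_simps)
    then show ?thesis using that by simp
  qed
  have "((\<lambda>t. h x + \<mu> / 2 * (1 - t) * ?d\<^sup>2) \<longlongrightarrow> h x + \<mu> / 2 * (1 - 0) * ?d\<^sup>2) (at_right 0)"
    by (intro tendsto_intros)
  moreover have "((\<lambda>r. h y + (e + r) * ?d) \<longlongrightarrow> h y + (e + 0) * ?d) (at_right 0)"
    by (intro tendsto_intros)
  moreover have "\<forall>\<^sub>F t in at_right 0. h x + \<mu> / 2 * (1 - t) * ?d\<^sup>2 \<le> h y + (e + t) * ?d"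
    using eventually_at_right_real[OF zero_less_one] by eventually_elim (rule step, auto)
  ultimately have "h x + \<mu> / 2 * (1 - 0) * ?d\<^sup>2 \<le> h y + (e + 0) * ?d"
    by (intro tendsto_le[OF trivial_limit_at_right_real]) 
  then show ?thesis by simp
qed

section \<open>The dual search\<close>

text \<open>The predicate \<open>N z x\<close> says what the inner solver guarantees about its output \<open>x\<close> for the
  multiplier \<open>z\<close>.  The search needs two consequences of it: multipliers of at least \<open>M\<close> give almost
  feasible points, and \<open>\<psi>\<close> cannot drop by more than \<open>3\<delta>\<close> between two multipliers as close as the
  tolerance of the bisection.  The second one rules out that the bisection ends because its interval
  is short, so the returned point always satisfies approximate complementarity.\<close>

lemma runs_dual:
  fixes apgmu :: "'a apgmu" and \<psi>1 :: "'a \<Rightarrow> real" and \<psi>2 :: "'a \<Rightarrow> ereal"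
  defines "\<psi> \<equiv> \<lambda>x. \<psi>1 x + real_of_ereal (\<psi>2 x)"
  assumes pos: "0 < \<mu>" "0 < \<delta>" "1 \<le> M" and width: "\<mu> * \<delta> ^ 3 \<le> 1"
    and solver: "\<And>z. 0 \<le> z \<Longrightarrow> z \<le> 2 * M \<Longrightarrow>
      case apgmu \<mu> (L\<phi> + z * L\<psi>) (\<lambda>x. \<phi>1 x + z * \<psi>1 x) (\<lambda>x. \<phi>2 x + ereal z * \<psi>2 x)
        (\<mu> * \<delta>\<^sup>2) xin of (x, n) \<Rightarrow> N z x \<and> real n + 2 \<le> cost"
    and large: "\<And>z x. M \<le> z \<Longrightarrow> N z x \<Longrightarrow> \<psi> x \<le> \<delta>"
    and gap: "\<And>a b xa xb. 0 \<le> a \<Longrightarrow> a < b \<Longrightarrow> b - a \<le> \<mu> * \<delta> ^ 3 \<Longrightarrow> N a xa \<Longrightarrow> N b xb \<Longrightarrow>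
      \<psi> xa \<le> \<psi> xb + 3 * \<delta>"
  shows "runs (dual apgmu \<mu> L\<phi> L\<psi> \<phi>1 \<phi>2 \<psi>1 \<psi>2 1 M xin \<delta>)
    (\<lambda>(x, z) n. 0 \<le> z \<and> z \<le> 2 * M \<and> N z x \<and> \<psi> x \<le> \<delta> \<and> \<bar>z * \<psi> x\<bar> \<le> 4 * M * \<delta> \<and>
      real n \<le> cost * (4 + log 2 M + log 2 (2 * M / (\<mu> * \<delta> ^ 3))))"
proof -
  define A where "A = (\<lambda>z. do {
           x \<leftarrow> Some (apgmu \<mu> (L\<phi> + z * L\<psi>) (\<lambda>x. \<phi>1 x + z * \<psi>1 x) (\<lambda>x. \<phi>2 x + ereal z * \<psi>2 x)
                  (\<mu> * \<delta>\<^sup>2) xin);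
           v \<leftarrow> evaluate \<psi>1 \<psi>2 x;
           return (x, v) })"
  define w where "w = \<mu> * \<delta> ^ 3"
  define body1 where "body1 = (\<lambda>(a, b, xa, xb, vb).
     if max vb 0 > \<delta> \<and> b < M
     then do {
       (x, v) \<leftarrow> A (2 * b);
       return (Inl (b, 2 * b, xb, x, v)) }
     else return (Inr (a, b, xa, xb, vb)) :: ((real \<times> real \<times> 'a \<times> 'a \<times> real) + (real \<times> real \<times> 'a \<times> 'a \<times> real)) comp)"
  define body2 where "body2 = (\<lambda>(a, b, xa, xb).
     if b - a > w
     then do {
       let z = (a + b) / 2;
       (x, v) \<leftarrow> A z;
       return
         (if max v 0 > \<delta> then Inl (z, b, x, xb)
          else if \<bar>z * v\<bar> \<le> 4 * M * \<delta> then Inr (x, z)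
          else Inl (a, z, xa, x)) }
     else return (Inr (xb, b)) :: ((real \<times> real \<times> 'a \<times> 'a) + ('a \<times> real)) comp)"
  have dual: "dual apgmu \<mu> L\<phi> L\<psi> \<phi>1 \<phi>2 \<psi>1 \<psi>2 1 M xin \<delta> = do {
       (x0, v0) \<leftarrow> A 0;
       (if max v0 0 \<le> \<delta> then return (x0, 0)
        else do {
          (x\<sigma>, v\<sigma>) \<leftarrow> A 1;
          (a, b, xa, xb, vb) \<leftarrow> loop body1 (0, 1, x0, x\<sigma>, v\<sigma>);
          (if \<bar>b * vb\<bar> \<le> 4 * M * \<delta> then return (xb, b)
           else loop body2 (a, b, xa, xb)) }) }"
    unfolding dual_def Let_def A_def body1_def body2_def w_def ..
  have w: "0 < w" "w \<le> 1" using pos width by (auto simp: w_def)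
  have A: "runs (A z) (\<lambda>(x, v) n. N z x \<and> v = \<psi> x \<and> 1 \<le> n \<and> real n \<le> cost)"
    if "0 \<le> z" "z \<le> 2 * M" for z
    using solver[OF that] by (auto simp: A_def \<psi>_def split: prod.splits)
  have cost: "0 < cost"
    using A[of 0] pos by (auto simp: runs_def)

  define I1 where "I1 = (\<lambda>(a, b, xa, xb, vb). 0 \<le> a \<and> 1 \<le> b \<and> b \<le> 2 * M \<and> 1 / 2 \<le> b - a \<and>
    N a xa \<and> N b xb \<and> vb = \<psi> xb \<and> \<delta> < \<psi> xa)"
  have search: "runs (loop body1 s) (\<lambda>r n. (I1 r \<and> (case r of (a, b, xa, xb, vb) \<Rightarrow> vb \<le> \<delta>)) \<and>
      real n + 0 \<le> cost * (1 + log 2 (M / fst (snd s))))" if "I1 s" for s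
  proof (rule runs_loop[where I = I1 and \<Phi> = "\<lambda>s. cost * (1 + log 2 (M / fst (snd s)))"
        and \<Psi> = "\<lambda>_. 0", OF that])
    fix s assume I: "I1 s"
    obtain a b xa xb vb where s: "s = (a, b, xa, xb, vb)" by (cases s)
    have b: "1 \<le> b" "b \<le> 2 * M" using I by (auto simp: s I1_def)
    have "log 2 (1 / 2) \<le> log 2 (M / b)"
      using b by (subst log_le_cancel_iff) (auto simp: field_simps)
    then have nonneg: "0 \<le> 1 + log 2 (M / b)" by (simp add: log_divide)
    then show "0 \<le> cost * (1 + log 2 (M / fst (snd s)))" using cost by (simp add: s)
    show "runs (body1 s) (\<lambda>x n. case x of
        Inl s' \<Rightarrow> I1 s' \<and> 1 \<le> n \<and>
          real n + cost * (1 + log 2 (M / fst (snd s'))) \<le> cost * (1 + log 2 (M / fst (snd s)))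
      | Inr r \<Rightarrow> (I1 r \<and> (case r of (a, b, xa, xb, vb) \<Rightarrow> vb \<le> \<delta>)) \<and>
          real n + 0 \<le> cost * (1 + log 2 (M / fst (snd s))))"
    proof (cases "max vb 0 > \<delta> \<and> b < M")
      case True
      have "log 2 (M / b) = 1 + log 2 (M / (2 * b))"
        using True b by (simp add: log_divide log_mult)
      then have "real n + cost * (1 + log 2 (M / (2 * b))) \<le> cost * (1 + log 2 (M / b))"
        if "real n \<le> cost" for n
        using that by (simp add: algebra_simps)
      then show ?thesis
        using True I b pos by (auto simp: s body1_def I1_def intro!: runs_mono[OF A])
    next
      case False
      then have "vb \<le> \<delta>" using I large[of b xb] pos by (auto simp: s I1_def)
      moreover have "body1 s = return (Inr s)"
        using False by (simp only: s body1_def prod.case if_False)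
      ultimately show ?thesis using I nonneg cost by (simp add: s)
    qed
  qed

  define I2 where "I2 = (\<lambda>(a, b, xa, xb). 0 \<le> a \<and> b \<le> 2 * M \<and> w / 2 \<le> b - a \<and>
    N a xa \<and> N b xb \<and> \<delta> < \<psi> xa \<and> b * \<psi> xb < - (4 * M * \<delta>))"
  define R where "R = (\<lambda>(x, z). 0 \<le> z \<and> z \<le> 2 * M \<and> N z x \<and> \<psi> x \<le> \<delta> \<and> \<bar>z * \<psi> x\<bar> \<le> 4 * M * \<delta>)"
  define \<Phi>2 where "\<Phi>2 = (\<lambda>(a, b, xa :: 'a, xb :: 'a). cost * (1 + log 2 ((b - a) / w)))"
  \<comment> \<open>An almost feasible point that violates complementarity is strictly feasible.\<close>
  have sign: "z * \<psi> x < - (4 * M * \<delta>)"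
    if "\<psi> x \<le> \<delta>" "\<not> \<bar>z * \<psi> x\<bar> \<le> 4 * M * \<delta>" "0 \<le> z" "z \<le> 2 * M" for x z
  proof (rule ccontr)
    assume "\<not> z * \<psi> x < - (4 * M * \<delta>)"
    then have "4 * M * \<delta> < z * \<psi> x" using that by linarith
    also have "\<dots> \<le> (2 * M) * \<delta>"
      using that pos by (meson mult_left_mono mult_right_mono order_trans less_imp_le)
    finally show False using pos by simp
  qed
  have bisect: "runs (loop body2 s) (\<lambda>r n. R r \<and> real n + 0 \<le> \<Phi>2 s)" if "I2 s" for s
  proof (rule runs_loop[where I = I2 and \<Phi> = \<Phi>2 and \<Psi> = "\<lambda>_. 0", OF that])
    fix s assume I: "I2 s"
    obtain a b xa xb where s: "s = (a, b, xa, xb)" by (cases s)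
    have ab: "0 \<le> a" "b \<le> 2 * M" "w / 2 \<le> b - a" and N: "N a xa" "N b xb"
      and \<psi>: "\<delta> < \<psi> xa" "b * \<psi> xb < - (4 * M * \<delta>)"
      using I by (auto simp: s I2_def)
    have "log 2 (1 / 2) \<le> log 2 ((b - a) / w)"
      using ab w by (subst log_le_cancel_iff) (auto simp: field_simps)
    then have nonneg: "0 \<le> 1 + log 2 ((b - a) / w)" by (simp add: log_divide)
    then show "0 \<le> \<Phi>2 s" using cost by (simp add: s \<Phi>2_def)
    have long: "b - a > w"
    proof (rule ccontr)
      assume "\<not> b - a > w"
      then have "\<psi> xa \<le> \<psi> xb + 3 * \<delta>" using gap[of a b xa xb] ab N w by (auto simp: w_def)
      then have "- (2 * \<delta>) < \<psi> xb" using \<psi> by simp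
      have "- (4 * M * \<delta>) \<le> b * - (2 * \<delta>)"
        using ab w pos by (simp add: mult_right_mono)
      also have "\<dots> \<le> b * \<psi> xb" using \<open>- (2 * \<delta>) < \<psi> xb\<close> ab w by (intro mult_left_mono) auto
      finally show False using \<psi> by simp
    qed
    define z where "z = (a + b) / 2"
    have half: "b - z = (b - a) / 2" "z - a = (b - a) / 2" by (auto simp: z_def field_simps)
    have z: "0 \<le> z" "z \<le> 2 * M" and width: "w / 2 \<le> b - z" "w / 2 \<le> z - a"
      using ab long w half by linarith+
    have "log 2 ((b - a) / w) = 1 + log 2 ((b - a) / 2 / w)"
      using long w by (simp add: log_divide log_mult)
    then have \<Phi>: "real n + cost * (1 + log 2 ((b - a) / 2 / w)) \<le> cost * (1 + log 2 ((b - a) / w))"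
      if "real n \<le> cost" for n
      using that by (simp add: algebra_simps)
    have "cost \<le> cost * (1 + log 2 ((b - a) / w))" using cost long w by simp
    then have \<Phi>': "real n \<le> cost * (1 + log 2 ((b - a) / w))" if "real n \<le> cost" for n
      using that by linarith
    have \<Phi>2_half: "\<Phi>2 (z, b, x, y) = cost * (1 + log 2 ((b - a) / 2 / w))"
      "\<Phi>2 (a, z, x, y) = cost * (1 + log 2 ((b - a) / 2 / w))"
      "\<Phi>2 (a, b, x, y) = cost * (1 + log 2 ((b - a) / w))" for x y
      by (auto simp: \<Phi>2_def half)
    show "runs (body2 s) (\<lambda>x n. case x of
        Inl s' \<Rightarrow> I2 s' \<and> 1 \<le> n \<and> real n + \<Phi>2 s' \<le> \<Phi>2 s
      | Inr r \<Rightarrow> R r \<and> real n + 0 \<le> \<Phi>2 s)"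
      unfolding s body2_def Let_def prod.case z_def[symmetric]
      if_P[OF long] runs_bind
    proof (rule runs_mono[OF A[OF z]], clarify)
      fix x v and n :: nat assume x: "N z x" "1 \<le> n" "real n \<le> cost"
      consider "\<delta> < \<psi> x" | "\<psi> x \<le> \<delta>" "\<bar>z * \<psi> x\<bar> \<le> 4 * M * \<delta>"
        | "\<psi> x \<le> \<delta>" "\<not> \<bar>z * \<psi> x\<bar> \<le> 4 * M * \<delta>" by linarith
      then show "runs (return
          (if \<delta> < max (\<psi> x) 0 then Inl (z, b, x, xb)
           else if \<bar>z * \<psi> x\<bar> \<le> 4 * M * \<delta> then Inr (x, z) else Inl (a, z, xa, x)))
        (\<lambda>q j. case q of
            Inl s' \<Rightarrow> I2 s' \<and> 1 \<le> n + j \<and> real (n + j) + \<Phi>2 s' \<le> \<Phi>2 (a, b, xa, xb)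
          | Inr r \<Rightarrow> R r \<and> real (n + j) + 0 \<le> \<Phi>2 (a, b, xa, xb))"
      proof cases
        case 1
        then show ?thesis using x ab N \<psi> z width \<Phi>[OF x(3)] pos
          by (simp add: I2_def \<Phi>2_half)
      next
        case 2
        then show ?thesis using x z \<Phi>'[OF x(3)] pos by (auto simp: R_def \<Phi>2_half)
      next
        case 3
        then show ?thesis using x ab N \<psi> z width \<Phi>[OF x(3)] pos sign[OF 3 z]
          by (simp add: I2_def \<Phi>2_half)
      qed
    qed
  qed

  let ?T = "4 + log 2 M + log 2 (2 * M / w)"
  have logs: "0 \<le> log 2 M" "0 \<le> log 2 (2 * M / w)" using pos w by (auto simp: le_divide_eq)
  have T: "cost * ?T = cost + cost + cost * (1 + log 2 M) + cost * (1 + log 2 (2 * M / w))"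
    by (simp add: algebra_simps)
  have parts: "0 \<le> cost * (1 + log 2 M)" "0 \<le> cost * (1 + log 2 (2 * M / w))"
    using logs cost by auto
  have "runs (dual apgmu \<mu> L\<phi> L\<psi> \<phi>1 \<phi>2 \<psi>1 \<psi>2 1 M xin \<delta>) (\<lambda>r n. R r \<and> real n \<le> cost * ?T)"
    unfolding dual runs_bind
  proof (rule runs_mono[OF A[of 0]]; clarify?)
    fix x0 and n0 :: nat assume x0: "N 0 x0" "1 \<le> n0" "real n0 \<le> cost"
    show "runs (
        if max (\<psi> x0) 0 \<le> \<delta> then return (x0, 0)
        else do {
          (x\<sigma>, v\<sigma>) \<leftarrow> A 1;
          (a, b, xa, xb, vb) \<leftarrow> loop body1 (0, 1, x0, x\<sigma>, v\<sigma>);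
          (if \<bar>b * vb\<bar> \<le> 4 * M * \<delta> then return (xb, b)
           else loop body2 (a, b, xa, xb)) })
      (\<lambda>q j. R q \<and> real (n0 + j) \<le> cost * ?T)"
    proof (cases "max (\<psi> x0) 0 \<le> \<delta>")
      case True
      moreover have "real n0 \<le> cost * ?T" unfolding T using x0 parts cost by linarith
      ultimately show ?thesis using x0 pos by (simp add: R_def)
    next
      case False
      then have \<psi>0: "\<delta> < \<psi> x0" using pos by auto
      have "runs (A 1) (\<lambda>r n1. runs (case r of (x\<sigma>, v\<sigma>) \<Rightarrow> do {
          (a, b, xa, xb, vb) \<leftarrow> loop body1 (0, 1, x0, x\<sigma>, v\<sigma>);
          (if \<bar>b * vb\<bar> \<le> 4 * M * \<delta> then return (xb, b)
           else loop body2 (a, b, xa, xb)) }) (\<lambda>q j. R q \<and> real (n0 + (n1 + j)) \<le> cost * ?T))"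
      proof (rule runs_mono[OF A[of 1]])
        fix r and n1 :: nat
        assume "(case r of (x, v) \<Rightarrow> \<lambda>n. N 1 x \<and> v = \<psi> x \<and> 1 \<le> n \<and> real n \<le> cost) n1"
        then obtain x1 where r: "r = (x1, \<psi> x1)" and x1: "N 1 x1" "1 \<le> n1" "real n1 \<le> cost"
          by (cases r) auto
        have "I1 (0, 1, x0, x1, \<psi> x1)" using x0 x1 \<psi>0 pos by (simp add: I1_def)
        note search1 = search[OF this]
        have "runs (loop body1 (0, 1, x0, x1, \<psi> x1)) (\<lambda>r n2. runs (case r of (a, b, xa, xb, vb) \<Rightarrow>
            (if \<bar>b * vb\<bar> \<le> 4 * M * \<delta> then return (xb, b) else loop body2 (a, b, xa, xb)))
            (\<lambda>q j. R q \<and> real (n0 + (n1 + (n2 + j))) \<le> cost * ?T))"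
        proof (rule runs_mono[OF search1]; clarify?)
          fix a b xa xb vb and n2 :: nat
          assume I: "I1 (a, b, xa, xb, vb)" and vb: "vb \<le> \<delta>"
            and n2: "real n2 + 0 \<le> cost * (1 + log 2 (M / fst (snd (0, 1, x0, x1, \<psi> x1))))"
          have n2': "real n2 \<le> cost * (1 + log 2 M)" using n2 by simp
          have ab: "0 \<le> a" "1 \<le> b" "b \<le> 2 * M" "1 / 2 \<le> b - a" "N b xb" "vb = \<psi> xb"
            using I by (auto simp: I1_def)
          show "runs (if \<bar>b * vb\<bar> \<le> 4 * M * \<delta> then return (xb, b) else loop body2 (a, b, xa, xb))
            (\<lambda>q j. R q \<and> real (n0 + (n1 + (n2 + j))) \<le> cost * ?T)"
          proof (cases "\<bar>b * vb\<bar> \<le> 4 * M * \<delta>")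
            case True
            moreover have "real n0 + (real n1 + real n2) \<le> cost * ?T"
              unfolding T using x0 x1 n2' parts by linarith
            ultimately show ?thesis using ab vb by (simp add: R_def)
          next
            case False
            have "I2 (a, b, xa, xb)"
              using I sign[of xb b] False vb w ab by (auto simp: I1_def I2_def)
            note bisect1 = bisect[OF this]
            have "log 2 ((b - a) / w) \<le> log 2 (2 * M / w)"
              using ab w pos by (subst log_le_cancel_iff) (auto simp: divide_right_mono)
            then have "\<Phi>2 (a, b, xa, xb) \<le> cost * (1 + log 2 (2 * M / w))"
              using cost by (simp add: \<Phi>2_def)
            then show ?thesis
              unfolding T using False x0 x1 n2' by (auto intro!: runs_mono[OF bisect1])
          qed
        qed
        then show "runs (case r of (x\<sigma>, v\<sigma>) \<Rightarrow> do {
          (a, b, xa, xb, vb) \<leftarrow> loop body1 (0, 1, x0, x\<sigma>, v\<sigma>);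
          (if \<bar>b * vb\<bar> \<le> 4 * M * \<delta> then return (xb, b)
           else loop body2 (a, b, xa, xb)) }) (\<lambda>q j. R q \<and> real (n0 + (n1 + j)) \<le> cost * ?T)"
          unfolding r by simp
      qed (use pos in auto)
      then show ?thesis unfolding if_not_P[OF False] runs_bind .
    qed
  qed (use pos in auto)
  then show ?thesis by (rule runs_mono) (auto simp: R_def w_def)
qed

section \<open>The bilevel problem in real terms\<close>

lemma INF_attained:
  fixes h :: "'b \<Rightarrow> 'c::complete_lattice"
  assumes "x0 \<in> A" "\<And>x. x \<in> A \<Longrightarrow> h x0 \<le> h x"
  shows "(INF x\<in>A. h x) = h x0"
  using assms by (intro antisym INF_lower INF_greatest)

lemma SUP_attained:
  fixes h :: "'b \<Rightarrow> 'c::complete_lattice"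
  assumes "x0 \<in> A" "\<And>x. x \<in> A \<Longrightarrow> h x \<le> h x0"
  shows "(SUP x\<in>A. h x) = h x0"
  using assms by (intro antisym SUP_upper SUP_least)

text \<open>The data shared by all phases: the problem, black boxes that meet their specifications, a bound
  on the diameter of the domain and a Lipschitz constant of the upper objective on it.\<close>

locale bilevel =
  fixes P :: "'a::euclidean_space sbo" and apg0 :: "'a apg0" and apgmu :: "'a apgmu"
    and \<kappa> :: nat and K Dg Bf :: real
  assumes sbo: "sbo_problem P" and assumption_A: "assumption_A P"
    and apg0_spec: "apg0_spec \<kappa> K P apg0" and apgmu_spec: "apgmu_spec \<kappa> K P apgmu"
    and diam: "diameter (domg P) \<le> Dg" and Bf_ge_1: "1 \<le> Bf"
    and lipschitz_fobj: "Bf-lipschitz_on (domg P) (\<lambda>x. real_of_ereal (fobj P x))"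
begin

abbreviation S :: "'a set" where "S \<equiv> domg P"

text \<open>\<open>F\<close> and \<open>G\<close> are the objectives as real functions; they are meaningful on \<open>S\<close> only.\<close>

definition F :: "'a \<Rightarrow> real" where "F x = f1 P x + real_of_ereal (f2 P x)"

definition G :: "'a \<Rightarrow> real" where "G x = g1 P x + real_of_ereal (g2 P x)"

lemma runs_evalf [simp]: "runs (evalf P x) Q = Q (F x) 2"
  by (simp add: evalf_def F_def)

lemma runs_evalg [simp]: "runs (evalg P x) Q = Q (G x) 2"
  by (simp add: evalg_def G_def)

lemma Lf1_pos: "0 < Lf1 P" and Lg1_ge_1: "1 \<le> Lg1 P"
  and smooth_f1: "smooth_convex (Lf1 P) (f1 P)" and smooth_g1: "smooth_convex (Lg1 P) (g1 P)"
  and proper_lsc_convex_f2: "proper_lsc_convex (f2 P)" and proper_lsc_convex_g2: "proper_lsc_convex (g2 P)"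
  using sbo by (auto simp: sbo_problem_def)

lemma S_ne: "S \<noteq> {}" and compact_S: "compact S" and convex_S: "convex S"
  and S_subset: "S \<subseteq> effdom (f2 P)" and f_star_less: "f_star P < p_star P"
  using assumption_A by (auto simp: assumption_A_def)

lemma f2_finite: "x \<in> S \<Longrightarrow> f2 P x = ereal (real_of_ereal (f2 P x))"
  using S_subset proper_lsc_convex_f2 by (cases "f2 P x") (auto simp: effdom_def proper_lsc_convex_def)

lemma g2_finite: "x \<in> S \<Longrightarrow> g2 P x = ereal (real_of_ereal (g2 P x))"
  using proper_lsc_convex_g2 by (cases "g2 P x") (auto simp: effdom_def proper_lsc_convex_def)

lemma g2_outside: "x \<notin> S \<Longrightarrow> g2 P x = \<infinity>"
  by (auto simp: effdom_def)

lemma fobj_eq: "x \<in> S \<Longrightarrow> fobj P x = ereal (F x)"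
  by (simp add: fobj_def composite_def F_def) (metis f2_finite plus_ereal.simps(1))

lemma gobj_eq: "x \<in> S \<Longrightarrow> gobj P x = ereal (G x)"
  by (simp add: gobj_def composite_def G_def) (metis g2_finite plus_ereal.simps(1))

lemma gobj_outside: "x \<notin> S \<Longrightarrow> gobj P x = \<infinity>"
  by (simp add: gobj_def composite_def g2_outside)

lemma convex_f2: "convex_on S (\<lambda>x. real_of_ereal (f2 P x))"
  by (rule proper_lsc_convex_imp_convex_on[OF proper_lsc_convex_f2 convex_S S_subset])

lemma convex_g2: "convex_on S (\<lambda>x. real_of_ereal (g2 P x))"
  by (rule proper_lsc_convex_imp_convex_on[OF proper_lsc_convex_g2 convex_S order_refl])

lemma continuous_f2: "continuous_on S (\<lambda>x. real_of_ereal (f2 P x))"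
  using assumption_A by (auto simp: assumption_A_def dest: lipschitz_on_continuous_on)

lemma continuous_g2: "continuous_on S (\<lambda>x. real_of_ereal (g2 P x))"
proof (rule continuous_on_compose2[OF continuous_on_real])
  show "continuous_on S (g2 P)" using assumption_A by (auto simp: assumption_A_def)
  show "g2 P ` S \<subseteq> UNIV - {\<infinity>, -\<infinity>}" using g2_finite by (auto; metis MInfty_neq_ereal(1) PInfty_neq_ereal(1))
qed

lemma continuous_F: "continuous_on S F" and continuous_G: "continuous_on S G"
  unfolding F_def G_def
  by (intro continuous_on_add continuous_f2 continuous_g2
      continuous_on_smooth_convex[OF smooth_f1] continuous_on_smooth_convex[OF smooth_g1])+

lemma dist_le_Dg: "x \<in> S \<Longrightarrow> y \<in> S \<Longrightarrow> norm (x - y) \<le> Dg"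
  using diameter_bounded_bound[OF compact_imp_bounded[OF compact_S], of x y] diam
  by (simp add: dist_norm)

lemma F_lipschitz: "x \<in> S \<Longrightarrow> y \<in> S \<Longrightarrow> \<bar>F x - F y\<bar> \<le> Bf * norm (x - y)"
  using lipschitz_onD[OF lipschitz_fobj, of x y] by (simp add: fobj_eq dist_norm)

lemma lower_solutions_iff: "x \<in> lower_solutions P \<longleftrightarrow> x \<in> S \<and> (\<forall>y\<in>S. G x \<le> G y)"
proof -
  have "x \<in> S \<and> (\<forall>y\<in>S. G x \<le> G y)" if "\<forall>y. gobj P x \<le> gobj P y"
  proof -
    from S_ne obtain s where "s \<in> S" by auto
    with that have "x \<in> S" by (metis gobj_eq gobj_outside ereal_infty_less_eq(1) PInfty_neq_ereal(1))
    with that show ?thesis by (metis gobj_eq ereal_less_eq(3))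
  qed
  moreover have "gobj P x \<le> gobj P y" if "x \<in> S" "\<forall>y\<in>S. G x \<le> G y" for y
    using that by (cases "y \<in> S") (auto simp: gobj_eq gobj_outside)
  ultimately show ?thesis
    by (auto simp: lower_solutions_def argmin_set_def is_arg_min_linorder)
qed

lemma g_star_eq: "x \<in> lower_solutions P \<Longrightarrow> g_star P = G x"
  unfolding g_star_def
  by (subst INF_attained[of x]) (auto simp: lower_solutions_iff gobj_eq)

lemma g_star_le: "x \<in> S \<Longrightarrow> g_star P \<le> G x"
  using sbo g_star_eq by (auto simp: sbo_problem_def lower_solutions_iff)

lemma INF_gobj: "(INF y. gobj P y) = ereal (g_star P)"
proof -
  obtain x where x: "x \<in> lower_solutions P" using sbo by (auto simp: sbo_problem_def)
  have "gobj P x \<le> gobj P y" for y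
    using x by (cases "y \<in> S") (auto simp: lower_solutions_iff gobj_eq gobj_outside)
  then have "(INF y. gobj P y) = gobj P x" by (intro INF_attained) auto
  with x show ?thesis by (simp add: g_star_eq gobj_eq lower_solutions_iff)
qed

lemma lower_solutions_iff_g_star: "x \<in> lower_solutions P \<longleftrightarrow> x \<in> S \<and> G x = g_star P"
  using g_star_eq g_star_le by (metis lower_solutions_iff)

lemma sbo_solution:
  assumes "x \<in> sbo_solutions P"
  shows "x \<in> S" "G x = g_star P" "F x = p_star P"
    and "\<And>y. y \<in> S \<Longrightarrow> G y = g_star P \<Longrightarrow> p_star P \<le> F y"
proof -
  have x: "x \<in> lower_solutions P" "\<And>y. y \<in> lower_solutions P \<Longrightarrow> fobj P x \<le> fobj P y"
    using assms by (auto simp: sbo_solutions_def argmin_set_def is_arg_min_linorder)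
  then show *: "x \<in> S" "G x = g_star P" by (auto simp: lower_solutions_iff_g_star)
  have "p_star P = real_of_ereal (fobj P x)"
    unfolding p_star_def by (subst INF_attained[of x]) (use x in auto)
  with * show p: "F x = p_star P" by (simp add: fobj_eq)
  show "p_star P \<le> F y" if "y \<in> S" "G y = g_star P" for y
    using x(2)[of y] that * by (simp add: lower_solutions_iff_g_star fobj_eq flip: p)
qed

lemma p_star_attained: obtains x where "x \<in> S" "G x = g_star P" "F x = p_star P"
  using sbo sbo_solution by (auto simp: sbo_problem_def)

lemma p_star_le: "x \<in> S \<Longrightarrow> G x = g_star P \<Longrightarrow> p_star P \<le> F x"
  using sbo sbo_solution(4) by (auto simp: sbo_problem_def)

lemma f_star_attained: obtains x where "x \<in> S" "F x = f_star P"
  and "\<And>x. x \<in> S \<Longrightarrow> f_star P \<le> F x"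
proof -
  obtain x where x: "x \<in> S" "\<forall>y\<in>S. F x \<le> F y"
    using continuous_attains_inf[OF compact_S S_ne continuous_F] by auto
  have "f_star P = real_of_ereal (fobj P x)"
    unfolding f_star_def by (subst INF_attained[of x]) (use x in \<open>auto simp: fobj_eq\<close>)
  with x that show thesis by (simp add: fobj_eq)
qed

lemma Dg_pos: "0 < Dg"
proof -
  obtain x where x: "x \<in> S" "F x = p_star P" using p_star_attained by metis
  obtain y where y: "y \<in> S" "F y = f_star P" using f_star_attained by metis
  have "x \<noteq> y" using x y f_star_less by auto
  then show ?thesis using dist_le_Dg[OF x(1) y(1)] by (metis less_le_trans zero_less_norm_iff right_minus_eq)
qed

text \<open>Below the level halfway between \<open>f*\<close> and \<open>p*\<close> the lower level cannot be solved to better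
  than \<open>m\<^sub>0 > 0\<close>.\<close>

lemma m_0_pos: "0 < m_0 P"
  and m_0_le: "x \<in> S \<Longrightarrow> F x \<le> (p_star P + f_star P) / 2 \<Longrightarrow> g_star P + m_0 P \<le> G x"
proof -
  let ?c = "(p_star P + f_star P) / 2"
  let ?B = "{x\<in>S. F x \<le> ?c}"
  obtain y where y: "y \<in> S" "F y = f_star P" using f_star_attained by metis
  have "?B \<noteq> {}" using y f_star_less by auto
  moreover have "compact ?B"
    using continuous_closedin_preimage[OF continuous_F closed_atMost[of ?c]] compact_S
    by (auto simp: Int_def vimage_def conj_commute intro: closedin_compact)
  moreover have "continuous_on ?B G" using continuous_G by (rule continuous_on_subset) auto
  ultimately obtain x where x: "x \<in> ?B" "\<forall>y\<in>?B. G x \<le> G y"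
    using continuous_attains_inf by blast
  have "gobj P x \<le> gobj P y" if "fobj P y \<le> ereal ?c" for y
    using x that by (cases "y \<in> S") (auto simp: gobj_eq fobj_eq gobj_outside)
  then have "(INF y\<in>{y. fobj P y \<le> ereal ?c}. gobj P y) = gobj P x"
    using x by (intro INF_attained) (auto simp: fobj_eq)
  then have m: "m_0 P = G x - g_star P" using x by (simp add: m_0_def g_bar_def gobj_eq)
  have "G x \<noteq> g_star P"
  proof
    assume "G x = g_star P"
    then have "p_star P \<le> F x" using x by (intro p_star_le) auto
    then show False using x f_star_less by simp
  qed
  then show "0 < m_0 P" using g_star_le[of x] x m by simp
  show "g_star P + m_0 P \<le> G x" if "x \<in> S" "F x \<le> ?c" for x
    using that x m by simp
qed

lemma Omega_ge: "x \<in> S \<Longrightarrow> G x - g_star P + 1 \<le> Omega_g P"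
proof -
  obtain y where y: "y \<in> S" "\<forall>x\<in>S. G x \<le> G y"
    using continuous_attains_sup[OF compact_S S_ne continuous_G] by auto
  have "(SUP x\<in>S. gobj P x - ereal (g_star P) + 1) = gobj P y - ereal (g_star P) + 1"
    by (rule SUP_attained) (use y in \<open>auto simp: gobj_eq one_ereal_def\<close>)
  then have "Omega_g P = G y - g_star P + 1" using y by (simp add: Omega_g_def gobj_eq one_ereal_def)
  then show "x \<in> S \<Longrightarrow> G x - g_star P + 1 \<le> Omega_g P" using y by simp
qed

lemma Omega_ge_1: "1 \<le> Omega_g P"
  using Omega_ge g_star_le S_ne by fastforce

section \<open>Calls of the black boxes\<close>

text \<open>The constant in front of the bounds on the black boxes, counted in basic operations.\<close>

abbreviation K' :: real where "K' \<equiv> real \<kappa> * max K 0"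

lemma basic_ops_le:
  assumes "n \<le> \<kappa> * N" "real N \<le> K * b" "b \<le> b'" "0 \<le> b"
  shows "real n \<le> K' * b'"
proof -
  have "K * b \<le> max K 0 * b'" using assms(3,4) by (intro mult_mono) auto
  then have "real N \<le> max K 0 * b'" using assms(2) by linarith
  then have "real \<kappa> * real N \<le> real \<kappa> * (max K 0 * b')" by (intro mult_left_mono) auto
  moreover have "real n \<le> real \<kappa> * real N" using assms(1) by (metis of_nat_le_iff of_nat_mult)
  ultimately show ?thesis by (simp add: mult.assoc)
qed

lemma proper_lsc_convex_g2_plus_f2:
  assumes "0 \<le> z"
  shows "proper_lsc_convex (\<lambda>x. g2 P x + ereal z * f2 P x)"
    and "effdom (\<lambda>x. g2 P x + ereal z * f2 P x) = S"
proof -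
  have eq: "(\<lambda>x. g2 P x + ereal z * f2 P x)
    = (\<lambda>x. if x \<in> S then ereal (real_of_ereal (g2 P x) + z * real_of_ereal (f2 P x)) else \<infinity>)"
  proof
    fix x
    show "g2 P x + ereal z * f2 P x
      = (if x \<in> S then ereal (real_of_ereal (g2 P x) + z * real_of_ereal (f2 P x)) else \<infinity>)"
    proof (cases "x \<in> S")
      case True
      then obtain a b where "f2 P x = ereal a" "g2 P x = ereal b" using f2_finite g2_finite by blast
      with True show ?thesis by simp
    qed (simp add: g2_outside)
  qed
  show "proper_lsc_convex (\<lambda>x. g2 P x + ereal z * f2 P x)"
    unfolding eq
    by (intro proper_lsc_convex_extension S_ne compact_imp_closed[OF compact_S] convex_on_add convex_g2
        convex_on_cmul assms convex_f2 continuous_intros continuous_f2 continuous_g2)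
  show "effdom (\<lambda>x. g2 P x + ereal z * f2 P x) = S"
    unfolding eq by (auto simp: effdom_def)
qed

lemma proper_lsc_convex_f2_plus_ind:
  "proper_lsc_convex (\<lambda>x. f2 P x + ind S x)" "effdom (\<lambda>x. f2 P x + ind S x) = S"
proof -
  have eq: "(\<lambda>x. f2 P x + ind S x) = (\<lambda>x. if x \<in> S then ereal (real_of_ereal (f2 P x)) else \<infinity>)"
    using f2_finite by (auto simp: ind_def fun_eq_iff)
  show "proper_lsc_convex (\<lambda>x. f2 P x + ind S x)"
    unfolding eq
    by (intro proper_lsc_convex_extension S_ne compact_imp_closed[OF compact_S] convex_f2 continuous_f2)
  show "effdom (\<lambda>x. f2 P x + ind S x) = S"
    unfolding eq by (auto simp: effdom_def)
qed

lemma infdist_le_Dg: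
  assumes "x \<in> S" "A \<subseteq> S" "A \<noteq> {}"
  shows "infdist x A \<le> Dg"
proof -
  from assms obtain a where "a \<in> A" "a \<in> S" by auto
  then show ?thesis using infdist_le[of a A x] dist_le_Dg[of x a] assms(1) by (simp add: dist_norm)
qed

lemma apg0_lower:
  assumes "xin \<in> S" "0 < \<delta>"
  shows "case apg0 (Lg1 P) (g1 P) (g2 P) \<delta> xin Dg of (x, n) \<Rightarrow>
    x \<in> S \<and> G x \<le> g_star P + \<delta> \<and> real n \<le> K' * (1 + Dg * sqrt (Lg1 P / \<delta>))"
proof -
  obtain x n where xn: "apg0 (Lg1 P) (g1 P) (g2 P) \<delta> xin Dg = (x, n)" by force
  have avail: "prox_available P (g2 P)"
    unfolding prox_available_def
    by (intro disjI1 exI[of _ 0]) (simp add: zero_ereal_def[symmetric])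
  have argmin: "argmin_set (composite (g1 P) (g2 P)) UNIV = lower_solutions P"
    by (simp add: lower_solutions_def gobj_def[abs_def])
  have *: "lower_solutions P \<noteq> {}" "infdist xin (lower_solutions P) \<le> Dg"
    using sbo lower_solutions_iff by (auto simp: sbo_problem_def intro!: infdist_le_Dg assms)
  from apg0_spec[unfolded apg0_spec_def, rule_format, of "Lg1 P" "g1 P" "g2 P" \<delta> xin Dg]
  obtain N where "x \<in> S" "gobj P x - (INF y. gobj P y) \<le> ereal \<delta>"
    "n \<le> \<kappa> * N" "real N \<le> K * (1 + Dg * sqrt (Lg1 P / \<delta>))"
    using avail argmin * smooth_g1 Lg1_ge_1 proper_lsc_convex_g2 assms by (auto simp: xn gobj_def)
  then show ?thesis
    using basic_ops_le[of n N "1 + Dg * sqrt (Lg1 P / \<delta>)"] Dg_pos Lg1_ge_1 \<open>0 < \<delta>\<close>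
    by (auto simp: xn gobj_eq INF_gobj)
qed

lemma apg0_upper:
  assumes "xin \<in> S" "0 < \<delta>"
  shows "case apg0 (Lf1 P) (f1 P) (\<lambda>x. f2 P x + ind S x) \<delta> xin Dg of (x, n) \<Rightarrow>
    x \<in> S \<and> F x \<le> f_star P + \<delta> \<and> real n \<le> K' * (1 + Dg * sqrt (Lf1 P / \<delta>))"
proof -
  let ?h = "composite (f1 P) (\<lambda>x. f2 P x + ind S x)"
  obtain x n where xn: "apg0 (Lf1 P) (f1 P) (\<lambda>x. f2 P x + ind S x) \<delta> xin Dg = (x, n)" by force
  obtain y where y: "y \<in> S" "F y = f_star P" and min: "\<And>x. x \<in> S \<Longrightarrow> f_star P \<le> F x"
    using f_star_attained by metis
  have h: "?h x = (if x \<in> S then ereal (F x) else \<infinity>)" for x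
  proof (cases "x \<in> S")
    case True
    then show ?thesis using fobj_eq[OF True] by (simp add: ind_def composite_def fobj_def)
  next
    case False
    have "f2 P x \<noteq> -\<infinity>" using proper_lsc_convex_f2 by (simp add: proper_lsc_convex_def)
    with False show ?thesis by (simp add: ind_def composite_def)
  qed
  have INF: "(INF z. ?h z) = ereal (f_star P)"
    using INF_attained[of y UNIV ?h] y min by (auto simp: h)
  have y_argmin: "y \<in> argmin_set ?h UNIV"
    using y min by (auto simp: argmin_set_def is_arg_min_linorder h)
  have "argmin_set ?h UNIV \<subseteq> S"
    using y by (auto simp: argmin_set_def is_arg_min_linorder h split: if_splits)
  then have *: "infdist xin (argmin_set ?h UNIV) \<le> Dg"
    using y_argmin by (intro infdist_le_Dg assms) auto
  have avail: "prox_available P (\<lambda>x. f2 P x + ind S x)" by (simp add: prox_available_def)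
  from apg0_spec[unfolded apg0_spec_def, rule_format,
      of "Lf1 P" "f1 P" "\<lambda>x. f2 P x + ind S x" \<delta> xin Dg]
  obtain N where "x \<in> S" "?h x - (INF y. ?h y) \<le> ereal \<delta>"
    "n \<le> \<kappa> * N" "real N \<le> K * (1 + Dg * sqrt (Lf1 P / \<delta>))"
    using avail * y_argmin smooth_f1 Lf1_pos proper_lsc_convex_f2_plus_ind assms by (auto simp: xn)
  moreover from this(1,2) have "F x \<le> f_star P + \<delta>"
    unfolding INF by (simp add: h)
  ultimately show ?thesis
    using basic_ops_le[of n N "1 + Dg * sqrt (Lf1 P / \<delta>)"] Dg_pos Lf1_pos \<open>0 < \<delta>\<close>
    by (auto simp: xn)
qed

text \<open>\<open>penalized \<eta> xf c z\<close> is the objective \<open>G\<^sub>\<eta> + z (f - c)\<close> of the subproblems of the dual search,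
  and \<open>near_min\<close> is the estimate that holds at an approximately stationary point of it.\<close>

definition penalized :: "real \<Rightarrow> 'a \<Rightarrow> real \<Rightarrow> real \<Rightarrow> 'a \<Rightarrow> real" where
  "penalized \<eta> xf c z x = G x + \<eta> / 2 * (norm (x - xf))\<^sup>2 + z * (F x - c)"

definition near_min :: "real \<Rightarrow> 'a \<Rightarrow> real \<Rightarrow> real \<Rightarrow> real \<Rightarrow> 'a \<Rightarrow> bool" where
  "near_min \<eta> xf c e z x \<longleftrightarrow> x \<in> S \<and>
     (\<forall>y\<in>S. penalized \<eta> xf c z x
       \<le> penalized \<eta> xf c z y + e * norm (x - y) - \<eta> / 2 * (norm (x - y))\<^sup>2)"

lemma near_minI:
  assumes "0 \<le> z" "x \<in> S"
    and k: "k = composite (\<lambda>x. g1 P x + \<eta> / 2 * (norm (x - xf))\<^sup>2 + z * (f1 P x - c))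
        (\<lambda>x. g2 P x + ereal z * f2 P x)"
    and sub: "subdifferential k x \<noteq> {}" "infdist 0 (subdifferential k x) \<le> e"
  shows "near_min \<eta> xf c e z x"
  unfolding near_min_def
proof (intro conjI ballI)
  fix y assume y: "y \<in> S"
  show "penalized \<eta> xf c z x
    \<le> penalized \<eta> xf c z y + e * norm (x - y) - \<eta> / 2 * (norm (x - y))\<^sup>2"
  proof (rule near_stationary_estimate[OF convex_S \<open>x \<in> S\<close> y _ sub])
    fix y assume "y \<in> S"
    then obtain a b where "f2 P y = ereal a" "g2 P y = ereal b" using f2_finite g2_finite by blast
    then show "k y = ereal (penalized \<eta> xf c z y)"
      by (simp add: k composite_def penalized_def F_def G_def algebra_simps)
  next
    fix t :: real assume t: "0 < t" "t < 1"
    let ?q = "\<lambda>w. g1 P w + z * (f1 P w - c)"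
    let ?r = "\<lambda>w. real_of_ereal (g2 P w) + z * real_of_ereal (f2 P w)"
    have p: "penalized \<eta> xf c z w = (?q w + \<eta> / 2 * (norm (w - xf))\<^sup>2) + ?r w" for w
      by (simp add: penalized_def F_def G_def algebra_simps)
    have "convex_on UNIV ?q"
      using smooth_convex_add_scaled[OF smooth_g1 smooth_convex_diff_const[OF smooth_f1] \<open>0 \<le> z\<close>]
      by (simp add: smooth_convex_def)
    then have "strongly_convex \<eta> (\<lambda>w. ?q w + \<eta> / 2 * (norm (w - xf))\<^sup>2)"
      by (rule strongly_convex_add[OF strongly_convex_quadratic])
    then have 1: "?q ((1 - t) *\<^sub>R x + t *\<^sub>R y) + \<eta> / 2 * (norm ((1 - t) *\<^sub>R x + t *\<^sub>R y - xf))\<^sup>2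
      \<le> (1 - t) * (?q x + \<eta> / 2 * (norm (x - xf))\<^sup>2) + t * (?q y + \<eta> / 2 * (norm (y - xf))\<^sup>2)
        - \<eta> / 2 * t * (1 - t) * (norm (x - y))\<^sup>2"
      using t unfolding strongly_convex_def by (metis atLeastAtMost_iff less_imp_le)
    have "convex_on S ?r"
      by (intro convex_on_add convex_g2 convex_on_cmul \<open>0 \<le> z\<close> convex_f2)
    then have 2: "?r ((1 - t) *\<^sub>R x + t *\<^sub>R y) \<le> (1 - t) * ?r x + t * ?r y"
      using t y \<open>x \<in> S\<close> by (intro convex_onD) auto
    show "penalized \<eta> xf c z ((1 - t) *\<^sub>R x + t *\<^sub>R y)
      \<le> (1 - t) * penalized \<eta> xf c z x + t * penalized \<eta> xf c z y
        - \<eta> / 2 * t * (1 - t) * (norm (x - y))\<^sup>2"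
      unfolding p distrib_left[of "1 - t" "_ + _" "?r x"] distrib_left[of t "_ + _" "?r y"]
      using 1 2 by linarith
  qed
qed fact

lemma apgmu_call:
  assumes "0 < \<eta>" "0 \<le> z" "0 < e" "xin \<in> S" "Lg1 P + \<eta> + z * Lf1 P \<le> L"
  shows "case apgmu \<eta> (Lg1 P + \<eta> + z * Lf1 P)
      (\<lambda>x. g1 P x + \<eta> / 2 * (norm (x - xf))\<^sup>2 + z * (f1 P x - c))
      (\<lambda>x. g2 P x + ereal z * f2 P x) e xin of (x, n) \<Rightarrow>
    near_min \<eta> xf c e z x \<and>
    real n \<le> K' * (sqrt (L / \<eta>) * (2 + max 0 (log 2 (L * Dg / e))))"
proof -
  let ?L = "Lg1 P + \<eta> + z * Lf1 P"
  let ?p1 = "\<lambda>x. g1 P x + \<eta> / 2 * (norm (x - xf))\<^sup>2 + z * (f1 P x - c)"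
  let ?p2 = "\<lambda>x. g2 P x + ereal z * f2 P x"
  obtain x n where xn: "apgmu \<eta> ?L ?p1 ?p2 e xin = (x, n)" by force
  have L: "0 < ?L" using assms Lf1_pos Lg1_ge_1 by (simp add: add_pos_nonneg)
  have quad: "smooth_convex (Lg1 P + \<eta>) (\<lambda>x. g1 P x + \<eta> / 2 * (norm (x - xf))\<^sup>2)"
    using smooth_convex_add_scaled[OF smooth_g1 smooth_convex_quadratic[of \<eta> xf], of 1] assms by simp
  have smooth: "smooth_convex ?L ?p1"
    by (intro smooth_convex_add_scaled quad smooth_convex_diff_const smooth_f1 assms)
  have "convex_on UNIV (\<lambda>w. g1 P w + z * (f1 P w - c))"
    using smooth_convex_add_scaled[OF smooth_g1 smooth_convex_diff_const[OF smooth_f1] \<open>0 \<le> z\<close>]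
    by (simp add: smooth_convex_def)
  from strongly_convex_add[OF strongly_convex_quadratic this]
  have "strongly_convex \<eta> (\<lambda>w. g1 P w + z * (f1 P w - c) + \<eta> / 2 * (norm (w - xf))\<^sup>2)" .
  moreover have "?p1 = (\<lambda>w. g1 P w + z * (f1 P w - c) + \<eta> / 2 * (norm (w - xf))\<^sup>2)"
    by (simp add: fun_eq_iff)
  ultimately have sc: "strongly_convex \<eta> ?p1" by (simp only:)
  have avail: "prox_available P ?p2" using assms by (auto simp: prox_available_def)
  have bdd: "bounded (effdom ?p2)" "diameter (effdom ?p2) \<le> Dg"
    using proper_lsc_convex_g2_plus_f2(2)[OF \<open>0 \<le> z\<close>] compact_imp_bounded[OF compact_S] diam by auto
  have "0 < ?L \<and> smooth_convex ?L ?p1 \<and> 0 < \<eta> \<and> strongly_convex \<eta> ?p1 \<and>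
      proper_lsc_convex ?p2 \<and> prox_available P ?p2 \<and> 0 < e \<and>
      bounded (effdom ?p2) \<and> diameter (effdom ?p2) \<le> Dg \<and> xin \<in> effdom ?p2"
    by (intro conjI L smooth sc avail bdd assms proper_lsc_convex_g2_plus_f2) (simp add: proper_lsc_convex_g2_plus_f2 assms)
  from apgmu_spec[unfolded apgmu_spec_def, rule_format, OF this, unfolded xn prod.case]
  obtain N where x: "x \<in> effdom ?p2" "subdifferential (composite ?p1 ?p2) x \<noteq> {}"
      "infdist 0 (subdifferential (composite ?p1 ?p2) x) \<le> e"
    and n: "n \<le> \<kappa> * N"
      "real N \<le> K * (sqrt (?L / \<eta>) * (1 + of_int (max 0 \<lceil>log 2 (?L * Dg / e)\<rceil>)))"
    by blast
  have "near_min \<eta> xf c e z x"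
    using x proper_lsc_convex_g2_plus_f2(2)[OF \<open>0 \<le> z\<close>] \<open>0 \<le> z\<close> by (intro near_minI) auto
  moreover have "real n \<le> K' * (sqrt (L / \<eta>) * (2 + max 0 (log 2 (L * Dg / e))))"
  proof (rule basic_ops_le[OF n])
    have "log 2 (?L * Dg / e) \<le> log 2 (L * Dg / e)"
      using assms L Dg_pos by (simp add: divide_right_mono)
    then have "1 + of_int (max 0 \<lceil>log 2 (?L * Dg / e)\<rceil>) \<le> 2 + max 0 (log 2 (L * Dg / e))"
      by linarith
    moreover have "sqrt (?L / \<eta>) \<le> sqrt (L / \<eta>)" using assms by (simp add: divide_right_mono)
    ultimately show "sqrt (?L / \<eta>) * (1 + of_int (max 0 \<lceil>log 2 (?L * Dg / e)\<rceil>))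
      \<le> sqrt (L / \<eta>) * (2 + max 0 (log 2 (L * Dg / e)))"
      using assms L by (intro mult_mono) auto
  qed (use assms L in auto)
  ultimately show ?thesis unfolding xn prod.case by (rule conjI)
qed

section \<open>The value function test\<close>

text \<open>The point \<open>xf\<close> is strictly feasible with slack \<open>\<Delta>\<close>, and \<open>M \<ge> (g(xf) - g*) / \<Delta>\<close>; so a point that
  is nearly minimal for a multiplier of at least \<open>M\<close> cannot be much worse than feasible.\<close>

lemma runs_dual_penalized:
  assumes \<eta>: "0 < \<eta>" "\<eta> \<le> 1" "\<eta> * Dg \<le> 1" and \<delta>: "0 < \<delta>" "Bf * \<delta> \<le> 1 / 4" and M: "1 \<le> M"
    and xin: "xin \<in> S" and xf: "xf \<in> S" and \<Delta>: "0 < \<Delta>" "F xf + \<Delta> \<le> c" "G xf - g_star P \<le> M * \<Delta>"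
    and L: "L = Lg1 P + \<eta> + 2 * M * Lf1 P"
  shows "runs (dual_penalized P apgmu \<eta> xf c M xin \<delta>)
    (\<lambda>(x, z) n. x \<in> S \<and> F x \<le> c + \<delta> \<and>
      (\<forall>y\<in>S. F y \<le> c \<longrightarrow> G x \<le> G y + \<eta> / 2 * Dg\<^sup>2 + 4 * M * \<delta> + \<eta> * \<delta>\<^sup>2 * Dg) \<and>
      real n \<le> (K' * (sqrt (L / \<eta>) * (2 + max 0 (log 2 (L * Dg / (\<eta> * \<delta>\<^sup>2))))) + 2) *
        (4 + log 2 M + log 2 (2 * M / (\<eta> * \<delta> ^ 3))))"
proof -
  have \<delta>_le: "\<delta> \<le> 1 / 4"
    using mult_right_mono[OF Bf_ge_1 less_imp_le[OF \<delta>(1)]] \<delta>(2) by simp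
  let ?e = "\<eta> * \<delta>\<^sup>2"
  let ?N = "near_min \<eta> xf c ?e"
  let ?\<psi> = "\<lambda>x. f1 P x - c + real_of_ereal (f2 P x)"
  have \<psi>: "?\<psi> x = F x - c" for x by (simp add: F_def)
  have eDg: "?e * norm (x - y) \<le> ?e * Dg" if "x \<in> S" "y \<in> S" for x y
    using dist_le_Dg[OF that] \<eta> by (intro mult_left_mono) auto
  have small: "?e * Dg \<le> \<delta>\<^sup>2"
    using mult_right_mono[OF \<eta>(3), of "\<delta>\<^sup>2"] by (simp add: ac_simps)
  have sq: "\<delta>\<^sup>2 \<le> \<delta>" using \<delta> \<delta>_le by (simp add: power2_eq_square mult_left_le_one_le)
  have main: "runs (dual_penalized P apgmu \<eta> xf c M xin \<delta>)
    (\<lambda>(x, z) n. 0 \<le> z \<and> z \<le> 2 * M \<and> ?N z x \<and> ?\<psi> x \<le> \<delta> \<and> \<bar>z * ?\<psi> x\<bar> \<le> 4 * M * \<delta> \<and>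
      real n \<le> (K' * (sqrt (L / \<eta>) * (2 + max 0 (log 2 (L * Dg / (\<eta> * \<delta>\<^sup>2))))) + 2) *
        (4 + log 2 M + log 2 (2 * M / (\<eta> * \<delta> ^ 3))))"
    unfolding dual_penalized_def
  proof (rule runs_dual)
    have "\<delta> ^ 3 \<le> 1" using \<delta> \<delta>_le by (intro power_le_one) auto
    then show "\<eta> * \<delta> ^ 3 \<le> 1" using \<eta> \<delta> by (intro mult_le_one) auto
  next
    fix z assume z: "0 \<le> z" "z \<le> 2 * M"
    have "z * Lf1 P \<le> 2 * M * Lf1 P" using z Lf1_pos by (intro mult_right_mono) auto
    then have "Lg1 P + \<eta> + z * Lf1 P \<le> L" by (simp add: L)
    moreover have "0 < ?e" using \<eta> \<delta> by simp
    ultimately show "case apgmu \<eta> (Lg1 P + \<eta> + z * Lf1 P)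
        (\<lambda>x. g1 P x + \<eta> / 2 * (norm (x - xf))\<^sup>2 + z * (f1 P x - c))
        (\<lambda>x. g2 P x + ereal z * f2 P x) ?e xin of (x, n) \<Rightarrow>
      ?N z x \<and> real n + 2 \<le> K' * (sqrt (L / \<eta>) * (2 + max 0 (log 2 (L * Dg / ?e)))) + 2"
      using apgmu_call[of \<eta> z ?e xin L xf c] \<eta> z xin by (simp split: prod.splits)
  next
    fix z x assume z: "M \<le> z" and N: "?N z x"
    have x: "x \<in> S" using N by (simp add: near_min_def)
    have "penalized \<eta> xf c z x
        \<le> penalized \<eta> xf c z xf + ?e * norm (x - xf) - \<eta> / 2 * (norm (x - xf))\<^sup>2"
      using N xf by (auto simp: near_min_def)
    then have "G x + z * (F x - c) \<le> G xf + z * (F xf - c) + ?e * norm (x - xf) - \<eta> * (norm (x - xf))\<^sup>2"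
      by (simp add: penalized_def)
    moreover have "0 \<le> \<eta> * (norm (x - xf))\<^sup>2" using \<eta> by simp
    moreover have "z * (F xf - c) \<le> z * - \<Delta>" using \<Delta> z M by (intro mult_left_mono) auto
    moreover have "M * \<Delta> \<le> z * \<Delta>" using \<Delta> z by (intro mult_right_mono) auto
    ultimately have "z * (F x - c) \<le> \<delta>"
      using \<Delta>(3) eDg[OF x xf] small sq g_star_le[OF x] by simp
    moreover have "\<delta> < z * (F x - c)" if "\<delta> < F x - c"
    proof -
      have "1 * (F x - c) \<le> z * (F x - c)" using that \<delta> z M by (intro mult_right_mono) auto
      with that show ?thesis by simp
    qed
    ultimately show "?\<psi> x \<le> \<delta>" unfolding \<psi> by fastforce
  next
    fix a b xa xb
    assume ab: "0 \<le> a" "a < b" "b - a \<le> \<eta> * \<delta> ^ 3" and N: "?N a xa" "?N b xb"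
    have S: "xa \<in> S" "xb \<in> S" using N by (auto simp: near_min_def)
    define d where "d = norm (xa - xb)"
    have d: "norm (xb - xa) = d" by (simp add: d_def norm_minus_commute)
    \<comment> \<open>Adding the two near-minimality estimates cancels \<open>G\<^sub>\<eta>\<close> and bounds \<open>d\<close> by \<open>2\<delta>\<^sup>2 + Bf \<delta>\<^sup>3\<close>.\<close>
    have "penalized \<eta> xf c a xa \<le> penalized \<eta> xf c a xb + ?e * d - \<eta> / 2 * d\<^sup>2"
      using N S unfolding d_def near_min_def by blast
    moreover have "penalized \<eta> xf c b xb \<le> penalized \<eta> xf c b xa + ?e * d - \<eta> / 2 * d\<^sup>2"
      using N S unfolding d[symmetric] near_min_def by blast
    ultimately have "\<eta> * d\<^sup>2 \<le> 2 * (?e * d) + (b - a) * (F xa - F xb)"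
      by (simp add: penalized_def algebra_simps)
    moreover have lip: "F xa - F xb \<le> Bf * d" using F_lipschitz[OF S] by (simp add: d_def)
    have "(b - a) * (F xa - F xb) \<le> (b - a) * (Bf * d)" using ab lip by (intro mult_left_mono) auto
    also have "\<dots> \<le> \<eta> * \<delta> ^ 3 * (Bf * d)"
      using ab Bf_ge_1 by (intro mult_right_mono) (auto simp: d_def)
    ultimately have "\<eta> * d\<^sup>2 \<le> 2 * (?e * d) + \<eta> * \<delta> ^ 3 * (Bf * d)" by linarith
    then have "\<eta> * d * d \<le> \<eta> * d * (2 * \<delta>\<^sup>2 + Bf * \<delta> ^ 3)"
      by (simp add: algebra_simps power2_eq_square)
    then have "d \<le> 2 * \<delta>\<^sup>2 + Bf * \<delta> ^ 3"
      using \<eta> \<delta> Bf_ge_1 by (cases "d = 0") (auto simp: d_def)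
    then have "Bf * d \<le> Bf * (2 * \<delta>\<^sup>2 + Bf * \<delta> ^ 3)" using Bf_ge_1 by (intro mult_left_mono) auto
    also have "\<dots> = 2 * (Bf * \<delta>) * \<delta> + (Bf * \<delta>) * (Bf * \<delta>) * \<delta>"
      by (simp add: algebra_simps power2_eq_square power3_eq_cube)
    also have "\<dots> \<le> 2 * (1 / 4) * \<delta> + 1 * 1 * \<delta>"
      using \<delta> Bf_ge_1 by (intro add_mono mult_mono) auto
    also have "\<dots> \<le> 3 * \<delta>" using \<delta> by simp
    finally show "?\<psi> xa \<le> ?\<psi> xb + 3 * \<delta>" unfolding \<psi> using lip by simp
  qed (use assms in auto)
  show ?thesis
  proof (rule runs_mono[OF main], clarify)
    fix x z and n :: nat
    assume z: "0 \<le> z" "z \<le> 2 * M" and N: "?N z x" and f: "?\<psi> x \<le> \<delta>" "\<bar>z * ?\<psi> x\<bar> \<le> 4 * M * \<delta>"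
      and n: "real n \<le> (K' * (sqrt (L / \<eta>) * (2 + max 0 (log 2 (L * Dg / (\<eta> * \<delta>\<^sup>2))))) + 2) *
        (4 + log 2 M + log 2 (2 * M / (\<eta> * \<delta> ^ 3)))"
    have x: "x \<in> S" using N by (simp add: near_min_def)
    have "G x \<le> G y + \<eta> / 2 * Dg\<^sup>2 + 4 * M * \<delta> + \<eta> * \<delta>\<^sup>2 * Dg" if y: "y \<in> S" "F y \<le> c" for y
    proof -
      have "penalized \<eta> xf c z x
          \<le> penalized \<eta> xf c z y + ?e * norm (x - y) - \<eta> / 2 * (norm (x - y))\<^sup>2"
        using N y by (auto simp: near_min_def)
      moreover have "z * (F y - c) \<le> 0" using z y by (simp add: mult_nonneg_nonpos)
      moreover have "0 \<le> \<eta> / 2 * (norm (x - y))\<^sup>2" "0 \<le> \<eta> / 2 * (norm (x - xf))\<^sup>2" using \<eta> by auto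
      moreover have "\<eta> / 2 * (norm (y - xf))\<^sup>2 \<le> \<eta> / 2 * Dg\<^sup>2"
        using dist_le_Dg[OF y(1) xf] \<eta> by (intro mult_left_mono power_mono) auto
      ultimately show ?thesis
        using eDg[OF x y(1)] f(2) unfolding penalized_def \<psi> by linarith
    qed
    then show "x \<in> S \<and> F x \<le> c + \<delta> \<and>
      (\<forall>y\<in>S. F y \<le> c \<longrightarrow> G x \<le> G y + \<eta> / 2 * Dg\<^sup>2 + 4 * M * \<delta> + \<eta> * \<delta>\<^sup>2 * Dg) \<and>
      real n \<le> (K' * (sqrt (L / \<eta>) * (2 + max 0 (log 2 (L * Dg / (\<eta> * \<delta>\<^sup>2))))) + 2) *
        (4 + log 2 M + log 2 (2 * M / (\<eta> * \<delta> ^ 3)))"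
      using x f n unfolding \<psi> by auto
  qed
qed

lemma C_D_ge_1: "1 \<le> C_D Dg"
  using Dg_pos by (simp add: C_D_def)

text \<open>The cost of a test at level \<open>t\<close>.  The number \<open>X\<close> bounds the data, \<open>R\<close> bounds the square root of
  the condition number of the subproblems, and \<open>W\<close> bounds all logarithms.\<close>

lemma test_cost_arith:
  assumes t: "0 < t" "t \<le> 1" and M: "1 \<le> M" "M \<le> 2 * X\<^sup>2"
    and X: "Lf1 P \<le> X" "Lg1 P \<le> X" "1 + Dg \<le> X" and W: "1 \<le> W" "log 2 X \<le> 2 * W" "log 2 (1 / t) \<le> 4 * W"
    and R: "sqrt (2 * (C_D Dg / t) * (Lg1 P + M * Lf1 P)) \<le> R"
    and \<eta>: "\<eta> = t / C_D Dg" and \<delta>: "\<delta> = t / (4 * C_D Dg * M)"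
    and L: "L = Lg1 P + \<eta> + 2 * M * Lf1 P"
  shows "(K' * (sqrt (L / \<eta>) * (2 + max 0 (log 2 (L * Dg / (\<eta> * \<delta>\<^sup>2))))) + 2) *
        (4 + log 2 M + log 2 (2 * M / (\<eta> * \<delta> ^ 3))) \<le> 68 * (51 * K' + 2) * R * W\<^sup>2"
proof -
  have C: "1 \<le> C_D Dg" by (rule C_D_ge_1)
  have X1: "1 \<le> X" using X Dg_pos by simp
  have \<eta>1: "0 < \<eta>" "\<eta> \<le> 1" using t C by (auto simp: \<eta> divide_le_eq)
  have K': "0 \<le> K'" by simp
  have MLf: "0 < M * Lf1 P" using M Lf1_pos by simp
  have L0: "0 < L" using Lg1_ge_1 \<eta>1 MLf by (simp add: L)
  have "C_D Dg \<le> (1 + Dg)\<^sup>2" using Dg_pos by (simp add: C_D_def power2_eq_square algebra_simps)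
  also have "\<dots> \<le> X\<^sup>2" using X Dg_pos by (intro power_mono) auto
  finally have "log 2 (C_D Dg) \<le> log 2 (X\<^sup>2)" using C X1 by simp
  then have lC: "log 2 (C_D Dg) \<le> 4 * W" using X1 W by (simp add: log_nat_power)
  have "log 2 M \<le> log 2 (2 * X\<^sup>2)" using M X1 by (subst log_le_cancel_iff) auto
  then have lM: "log 2 M \<le> 1 + 4 * W" using X1 W by (simp add: log_nat_power log_mult)
  have lD: "log 2 Dg \<le> 2 * W"
  proof -
    have "log 2 Dg \<le> log 2 X" using X Dg_pos by simp
    with W show ?thesis by simp
  qed
  have "M * Lf1 P \<le> 2 * X\<^sup>2 * X" using M X Lf1_pos by (intro mult_mono) auto
  then have "L \<le> X + 1 + 4 * X ^ 3" using \<eta>1 X by (simp add: L power3_eq_cube power2_eq_square)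
  also have "\<dots> \<le> 8 * X ^ 3"
    using X1 self_le_power[OF X1, of 3] one_le_power[OF X1, of 3] by linarith
  finally have "log 2 L \<le> log 2 (2 ^ 3 * X ^ 3)" using L0 X1 by simp
  then have lL: "log 2 L \<le> 3 + 6 * W"
    using X1 W by (simp only: log_mult log_nat_power) (simp add: log_mult log_nat_power)
  have lt: "- log 2 t \<le> 4 * W" using W t by (simp add: log_divide)
  have pos: "0 < C_D Dg" "0 < M" using C M by auto
  have l\<eta>: "log 2 \<eta> = log 2 t - log 2 (C_D Dg)" using t pos by (simp add: \<eta> log_divide)
  have "log 2 (4::real) = 2" using log_pow_cancel[of 2 2] by simp
  then have l\<delta>: "log 2 \<delta> = log 2 t - (2 + log 2 (C_D Dg) + log 2 M)"
    using t pos by (simp add: \<delta> log_divide log_mult)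
  have \<delta>0: "0 < \<delta>" using t pos by (simp add: \<delta>)
  \<comment> \<open>The logarithms below sum up to at most \<open>9 + 40 W\<close> and \<open>11 + 48 W\<close>.\<close>
  have "log 2 (L * Dg / (\<eta> * \<delta>\<^sup>2)) = log 2 L + log 2 Dg - (log 2 \<eta> + 2 * log 2 \<delta>)"
    using L0 Dg_pos \<eta>1 \<delta>0 by (simp add: log_divide log_mult log_nat_power)
  also have "\<dots> \<le> 49 * W" unfolding l\<eta> l\<delta> using lL lD lC lM lt W(1) by argo
  finally have log1: "2 + max 0 (log 2 (L * Dg / (\<eta> * \<delta>\<^sup>2))) \<le> 51 * W" using W by simp
  have "log 2 (2 * M / (\<eta> * \<delta> ^ 3)) = 1 + log 2 M - (log 2 \<eta> + 3 * log 2 \<delta>)"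
    using pos \<eta>1 \<delta>0 by (simp add: log_divide log_mult log_nat_power)
  also have "\<dots> \<le> 59 * W" unfolding l\<eta> l\<delta> using lC lM lt W(1) by argo
  finally have log2: "4 + log 2 M + log 2 (2 * M / (\<eta> * \<delta> ^ 3)) \<le> 68 * W" using lM W by linarith
  have "L \<le> 2 * (Lg1 P + M * Lf1 P)" using \<eta>1 Lg1_ge_1 by (simp add: L)
  then have "L / \<eta> \<le> 2 * (Lg1 P + M * Lf1 P) / \<eta>" using \<eta>1 by (intro divide_right_mono) auto
  also have "\<dots> = 2 * (C_D Dg / t) * (Lg1 P + M * Lf1 P)" by (simp add: \<eta>)
  finally have sR: "sqrt (L / \<eta>) \<le> R" using R by (meson order_trans real_sqrt_le_mono)
  have "\<eta> \<le> L" using Lg1_ge_1 MLf by (simp add: L)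
  then have "1 \<le> sqrt (L / \<eta>)" using \<eta>1 by simp
  with sR have R1: "1 \<le> R" by linarith
  have "sqrt (L / \<eta>) * (2 + max 0 (log 2 (L * Dg / (\<eta> * \<delta>\<^sup>2)))) \<le> R * (51 * W)"
    using sR log1 R1 L0 \<eta>1 by (intro mult_mono) auto
  then have "K' * (sqrt (L / \<eta>) * (2 + max 0 (log 2 (L * Dg / (\<eta> * \<delta>\<^sup>2))))) \<le> K' * (R * (51 * W))"
    by (intro mult_left_mono K')
  moreover have "1 * 1 \<le> R * W" using R1 W by (intro mult_mono) auto
  ultimately have c: "K' * (sqrt (L / \<eta>) * (2 + max 0 (log 2 (L * Dg / (\<eta> * \<delta>\<^sup>2))))) + 2
      \<le> (51 * K' + 2) * (R * W)"
    by (simp add: algebra_simps)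
  have "(K' * (sqrt (L / \<eta>) * (2 + max 0 (log 2 (L * Dg / (\<eta> * \<delta>\<^sup>2))))) + 2) *
        (4 + log 2 M + log 2 (2 * M / (\<eta> * \<delta> ^ 3))) \<le>
     (K' * (sqrt (L / \<eta>) * (2 + max 0 (log 2 (L * Dg / (\<eta> * \<delta>\<^sup>2))))) + 2) * (68 * W)"
    using log2 L0 \<eta>1 by (intro mult_left_mono) (auto intro!: add_nonneg_nonneg mult_nonneg_nonneg)
  also have "\<dots> \<le> (51 * K' + 2) * (R * W) * (68 * W)" using c W by (intro mult_right_mono) auto
  also have "\<dots> = 68 * (51 * K' + 2) * R * W\<^sup>2" by (simp add: power2_eq_square)
  finally show ?thesis .
qed

text \<open>The constant in front of the cost of one test.\<close>

abbreviation K1 :: real where "K1 \<equiv> 68 * (51 * K' + 2)"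

lemma runs_VTest:
  assumes t: "0 < t" "t \<le> 1 / Bf" and M: "1 \<le> M" "M \<le> 2 * X\<^sup>2"
    and X: "Lf1 P \<le> X" "Lg1 P \<le> X" "1 + Dg \<le> X" and W: "1 \<le> W" "log 2 X \<le> 2 * W" "log 2 (1 / t) \<le> 4 * W"
    and R: "sqrt (2 * (C_D Dg / t) * (Lg1 P + M * Lf1 P)) \<le> R"
    and xin: "xin \<in> S" and xf: "xf \<in> S" and \<Delta>: "0 < \<Delta>" "F xf + \<Delta> \<le> c" "G xf - g_star P \<le> M * \<Delta>"
  shows "runs (VTest P apgmu Dg xf M c t xin)
    (\<lambda>(x, z) n. x \<in> S \<and> F x \<le> c + t / 4 \<and> (\<forall>y\<in>S. F y \<le> c \<longrightarrow> G x \<le> G y + t) \<and>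
      real n \<le> K1 * R * W\<^sup>2)"
proof -
  let ?\<eta> = "t / C_D Dg" and ?\<delta> = "t / (4 * C_D Dg * M)"
  have C: "1 \<le> C_D Dg" by (rule C_D_ge_1)
  have t1: "t \<le> 1" using t Bf_ge_1 by (smt (verit) divide_le_eq_1)
  have \<eta>: "0 < ?\<eta>" "?\<eta> \<le> 1" using t t1 C by (auto simp: divide_le_eq)
  have "t * Dg \<le> 1 * C_D Dg" using t t1 Dg_pos by (intro mult_mono) (auto simp: C_D_def distrib_left)
  then have \<eta>D: "?\<eta> * Dg \<le> 1" using C by (simp add: divide_le_eq)
  have CM: "1 \<le> C_D Dg * M" using C M mult_mono[of 1 "C_D Dg" 1 M] by simp
  then have \<delta>: "0 < ?\<delta>" using t C M by (intro divide_pos_pos mult_pos_pos) auto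
  have "4 * 1 * t \<le> 4 * (C_D Dg * M) * t" using CM t by (intro mult_right_mono) auto
  then have \<delta>t: "?\<delta> \<le> t / 4" using CM by (simp add: divide_le_eq field_simps)
  have "Bf * ?\<delta> \<le> Bf * (t / 4)" using \<delta>t Bf_ge_1 by (intro mult_left_mono) auto
  also have "\<dots> \<le> 1 / 4" using t Bf_ge_1 by (simp add: field_simps)
  finally have B\<delta>: "Bf * ?\<delta> \<le> 1 / 4" .
  have "?\<delta> \<le> 1" using \<delta>t t1 by linarith
  then have \<delta>1: "?\<delta>\<^sup>2 \<le> 1" using \<delta> by (intro power_le_one) auto
  \<comment> \<open>The factor \<open>C_D = 1 + Dg + Dg\<^sup>2\<close> absorbs the complementarity gap, the solver accuracy and the
    quadratic penalty, in this order.\<close>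
  have total: "?\<eta> / 2 * Dg\<^sup>2 + 4 * M * ?\<delta> + ?\<eta> * ?\<delta>\<^sup>2 * Dg \<le> t"
  proof -
    have "4 * M * ?\<delta> = ?\<eta>" using M by simp
    then have "?\<eta> / 2 * Dg\<^sup>2 + 4 * M * ?\<delta> + ?\<eta> * ?\<delta>\<^sup>2 * Dg = ?\<eta> * (Dg\<^sup>2 / 2 + 1 + ?\<delta>\<^sup>2 * Dg)"
      by (simp add: algebra_simps)
    also have "\<dots> \<le> ?\<eta> * C_D Dg"
    proof (intro mult_left_mono)
      have *: "Dg\<^sup>2 / 2 + 1 + q \<le> C_D Dg" if "q \<le> 1 * Dg" for q
        using that zero_le_square[of Dg] unfolding C_D_def power2_eq_square distrib_left by linarith
      show "Dg\<^sup>2 / 2 + 1 + ?\<delta>\<^sup>2 * Dg \<le> C_D Dg"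
        using \<delta>1 Dg_pos by (intro * mult_right_mono) auto
    qed (use \<eta> in auto)
    also have "\<dots> = t" using C by simp
    finally show ?thesis .
  qed
  show ?thesis
    unfolding VTest_def
  proof (rule runs_mono[OF runs_dual_penalized[OF \<eta> \<eta>D \<delta> B\<delta> M(1) xin xf \<Delta> refl]], clarify)
    fix x z and n :: nat
    assume x: "x \<in> S" and f: "F x \<le> c + ?\<delta>"
      and g: "\<forall>y\<in>S. F y \<le> c \<longrightarrow> G x \<le> G y + ?\<eta> / 2 * Dg\<^sup>2 + 4 * M * ?\<delta> + ?\<eta> * ?\<delta>\<^sup>2 * Dg"
      and n: "real n \<le> (K' * (sqrt ((Lg1 P + ?\<eta> + 2 * M * Lf1 P) / ?\<eta>) *
          (2 + max 0 (log 2 ((Lg1 P + ?\<eta> + 2 * M * Lf1 P) * Dg / (?\<eta> * ?\<delta>\<^sup>2))))) + 2) *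
        (4 + log 2 M + log 2 (2 * M / (?\<eta> * ?\<delta> ^ 3)))"
    have "G x \<le> G y + t" if "y \<in> S" "F y \<le> c" for y using g[rule_format, OF that] total by linarith
    moreover have "real n \<le> K1 * R * W\<^sup>2"
      using n test_cost_arith[OF t(1) t1 M X W R refl refl refl] by (rule order_trans)
    moreover have "F x \<le> c + t / 4" using f \<delta>t by linarith
    ultimately show "F x \<le> c + t / 4 \<and> (\<forall>y\<in>S. F y \<le> c \<longrightarrow> G x \<le> G y + t) \<and>
      real n \<le> K1 * R * W\<^sup>2"
      by blast
  qed
qed

end

section \<open>The initialisation\<close>

text \<open>In addition, an admissible initial level \<open>\<delta>init\<close>.\<close>

locale bilevel_run = bilevel +
  fixes \<delta>init :: real
  assumes \<delta>init: "0 < \<delta>init" "\<delta>init \<le> 1 / Bf"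
begin

abbreviation Q :: real where "Q \<equiv> Q_init P \<delta>init"

abbreviation \<Omega> :: real where "\<Omega> \<equiv> Omega_g P"

abbreviation \<Lambda> :: real where "\<Lambda> \<equiv> log_data P Dg Bf \<delta>init"

text \<open>The argument of the logarithm in \<open>\<Lambda>\<close>; it dominates all problem data.\<close>

definition X :: real where "X = 1 + Lf1 P + Lg1 P + Dg + Bf + \<Omega> + Q"

lemma \<Lambda>_eq: "\<Lambda> = 1 + ln X"
  by (simp add: log_data_def X_def)

lemma Q_ge: "1 / \<delta>init \<le> Q" "8 / (p_star P - f_star P) \<le> Q" "8 / m_0 P \<le> Q"
  by (auto simp: Q_init_def)

lemma Q_ge_1: "1 \<le> Q"
proof -
  have "\<delta>init \<le> 1" using \<delta>init Bf_ge_1 by (smt (verit) divide_le_eq_1)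
  then have "1 \<le> 1 / \<delta>init" using \<delta>init by simp
  with Q_ge(1) show ?thesis by linarith
qed

lemma X_ge: "1 \<le> X" "Lf1 P \<le> X" "Lg1 P \<le> X" "1 + Dg \<le> X" "Bf \<le> X" "\<Omega> \<le> X" "Q \<le> X"
  using Lf1_pos Lg1_ge_1 Dg_pos Bf_ge_1 Omega_ge_1 Q_ge_1 by (auto simp: X_def)

lemma \<Lambda>_ge_1: "1 \<le> \<Lambda>"
  using X_ge by (simp add: \<Lambda>_eq)

lemma log2_le_ln: "1 \<le> x \<Longrightarrow> log 2 x \<le> 2 * ln x" for x :: real
proof -
  assume x: "1 \<le> x"
  have "1 / 2 \<le> ln (2::real)" using ln_le_minus_one[of "1 / 2"] by (simp add: ln_div)
  then have "ln x * 1 \<le> ln x * (2 * ln 2)" using x by (intro mult_left_mono) auto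
  then show ?thesis by (simp add: log_def divide_le_eq)
qed

lemma log_X: "log 2 X \<le> 2 * \<Lambda>"
  using log2_le_ln[OF X_ge(1)] by (simp add: \<Lambda>_eq)

lemma M_le:
  assumes "0 < \<Delta>" "1 / \<Delta> \<le> 2 * Q" "M \<le> \<Omega> / \<Delta>"
  shows "M \<le> 2 * (\<Omega> * Q)" "M \<le> 2 * X\<^sup>2"
proof -
  have "\<Omega> / \<Delta> = \<Omega> * (1 / \<Delta>)" by simp
  also have "\<dots> \<le> \<Omega> * (2 * Q)" using assms Omega_ge_1 by (intro mult_left_mono) auto
  finally show 1: "M \<le> 2 * (\<Omega> * Q)" using assms by simp
  have "\<Omega> * Q \<le> X * X" using X_ge Omega_ge_1 Q_ge_1 by (intro mult_mono) auto
  with 1 show "M \<le> 2 * X\<^sup>2" by (simp add: power2_eq_square)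
qed

text \<open>\<open>B\<close> is the bound on the initialisation without its logarithmic factor.\<close>

definition B :: real where
  "B = sqrt (C_D Dg * Lf1 P * \<Omega>) * Q + sqrt (C_D Dg * Lg1 P) * sqrt Q"

lemma B_ge_1: "1 \<le> B"
proof -
  have "1 * 1 \<le> C_D Dg * Lg1 P" using C_D_ge_1 Lg1_ge_1 by (intro mult_mono) auto
  then have "1 * 1 \<le> sqrt (C_D Dg * Lg1 P) * sqrt Q" using Q_ge_1 by (intro mult_mono) auto
  moreover have "0 \<le> sqrt (C_D Dg * Lf1 P * \<Omega>) * Q"
    using C_D_ge_1 Lf1_pos Omega_ge_1 Q_ge_1 by simp
  ultimately show ?thesis by (simp add: B_def)
qed

text \<open>The constant in front of the cost of one round of the initialisation.\<close>

abbreviation K2 :: real where "K2 \<equiv> 4 * K' + 8 + 4 * K1"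

lemma init_round_arith:
  assumes \<Delta>: "0 < \<Delta>" "1 / \<Delta> \<le> 2 * Q" and M: "1 \<le> M" "M \<le> 2 * (\<Omega> * Q)"
  shows "sqrt (2 * (C_D Dg / \<Delta>) * (Lg1 P + M * Lf1 P)) \<le> 4 * B"
    and "K' * (1 + Dg * sqrt (Lf1 P / \<Delta>)) + K' * (1 + Dg * sqrt (Lg1 P / \<Delta>)) + 8 + K1 * (4 * B) * \<Lambda>\<^sup>2
      \<le> K2 * B * \<Lambda>\<^sup>2"
proof -
  have C: "1 \<le> C_D Dg" by (rule C_D_ge_1)
  let ?a = "C_D Dg * Lf1 P * \<Omega>" and ?b = "C_D Dg * Lg1 P"
  have ab: "0 \<le> ?a" "0 \<le> ?b" using C Lf1_pos Lg1_ge_1 Omega_ge_1 by auto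
  have C\<Delta>: "C_D Dg / \<Delta> \<le> C_D Dg * (2 * Q)"
    using mult_left_mono[OF \<Delta>(2), of "C_D Dg"] C by simp
  have "0 \<le> Lg1 P + M * Lf1 P" using Lg1_ge_1 M Lf1_pos by simp
  then have "2 * (C_D Dg / \<Delta>) * (Lg1 P + M * Lf1 P) \<le> 2 * (C_D Dg * (2 * Q)) * (Lg1 P + M * Lf1 P)"
    using C\<Delta> by (intro mult_right_mono mult_left_mono) auto
  also have "\<dots> \<le> 2 * (C_D Dg * (2 * Q)) * (Lg1 P + 2 * (\<Omega> * Q) * Lf1 P)"
    using C Q_ge_1 M Lf1_pos by (intro mult_left_mono add_left_mono mult_right_mono) auto
  also have "\<dots> = 4 * (?b * Q) + 8 * (?a * Q\<^sup>2)"
    by (simp add: algebra_simps power2_eq_square)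
  also have "\<dots> \<le> 4 * (?b * Q) + 16 * (?a * Q\<^sup>2)"
    using mult_nonneg_nonneg[OF ab(1) zero_le_power2[of Q]] by linarith
  finally have "2 * (C_D Dg / \<Delta>) * (Lg1 P + M * Lf1 P) \<le> 4 * (?b * Q) + 16 * (?a * Q\<^sup>2)" .
  then have "sqrt (2 * (C_D Dg / \<Delta>) * (Lg1 P + M * Lf1 P)) \<le> sqrt (4 * (?b * Q) + 16 * (?a * Q\<^sup>2))"
    by simp
  also have "\<dots> \<le> sqrt (4 * (?b * Q)) + sqrt (16 * (?a * Q\<^sup>2))"
    using ab Q_ge_1 by (intro sqrt_add_le_add_sqrt) auto
  also have "\<dots> = 2 * (sqrt ?b * sqrt Q) + 4 * (sqrt ?a * Q)"
    using Q_ge_1 by (simp add: real_sqrt_mult)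
  also have "\<dots> \<le> 4 * B" using ab Q_ge_1 by (simp add: B_def)
  finally show "sqrt (2 * (C_D Dg / \<Delta>) * (Lg1 P + M * Lf1 P)) \<le> 4 * B" .

  have Dg_C: "Dg \<le> sqrt (C_D Dg)"
    using Dg_pos by (intro real_le_rsqrt) (simp add: C_D_def power2_eq_square distrib_left)
  have apg: "Dg * sqrt (l / \<Delta>) \<le> 2 * (sqrt (C_D Dg * l) * sqrt Q)" if "0 \<le> l" for l
  proof -
    have "l / \<Delta> \<le> l * (2 * Q)" using mult_left_mono[OF \<Delta>(2) that] by simp
    also have "\<dots> \<le> 4 * (l * Q)" using that Q_ge_1 by simp
    finally have "sqrt (l / \<Delta>) \<le> sqrt (4 * (l * Q))" by simp
    then have "Dg * sqrt (l / \<Delta>) \<le> sqrt (C_D Dg) * sqrt (4 * (l * Q))"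
      using Dg_C Dg_pos that \<Delta> C by (intro mult_mono) auto
    then show ?thesis by (simp add: real_sqrt_mult)
  qed
  have "sqrt (C_D Dg * Lf1 P) \<le> sqrt ?a"
    using C Lf1_pos Omega_ge_1 mult_left_mono[of 1 \<Omega> "C_D Dg * Lf1 P"] by simp
  moreover have "sqrt Q \<le> Q"
    using Q_ge_1 by (intro real_le_lsqrt) (auto simp: self_le_power)
  ultimately have "sqrt (C_D Dg * Lf1 P) * sqrt Q \<le> sqrt ?a * Q"
    using ab Q_ge_1 by (intro mult_mono) auto
  then have f: "Dg * sqrt (Lf1 P / \<Delta>) \<le> 2 * (sqrt ?a * Q)" using apg[of "Lf1 P"] Lf1_pos by simp
  have g: "Dg * sqrt (Lg1 P / \<Delta>) \<le> 2 * (sqrt ?b * sqrt Q)" using apg[of "Lg1 P"] Lg1_ge_1 by simp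
  have "(1 + Dg * sqrt (Lf1 P / \<Delta>)) + (1 + Dg * sqrt (Lg1 P / \<Delta>)) \<le> 4 * B"
    using f g B_ge_1 by (simp add: B_def)
  then have "K' * ((1 + Dg * sqrt (Lf1 P / \<Delta>)) + (1 + Dg * sqrt (Lg1 P / \<Delta>))) \<le> K' * (4 * B)"
    by (intro mult_left_mono) auto
  moreover have \<Lambda>2: "1 \<le> \<Lambda>\<^sup>2" using \<Lambda>_ge_1 by simp
  then have "K' * (4 * B) * 1 \<le> K' * (4 * B) * \<Lambda>\<^sup>2"
    using B_ge_1 by (intro mult_left_mono) auto
  moreover have "1 * 1 \<le> B * \<Lambda>\<^sup>2" using \<Lambda>2 B_ge_1 by (intro mult_mono) auto
  ultimately show "K' * (1 + Dg * sqrt (Lf1 P / \<Delta>)) + K' * (1 + Dg * sqrt (Lg1 P / \<Delta>)) + 8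
      + K1 * (4 * B) * \<Lambda>\<^sup>2 \<le> K2 * B * \<Lambda>\<^sup>2"
    by (simp add: distrib_left distrib_right mult.assoc)
qed

text \<open>What the later phases use of the output of the initialisation: a valid lower bound \<open>l\<close>, a point
  \<open>xf\<close> with slack \<open>\<Delta>\<close> for every value \<open>c \<ge> l\<close>, and a bound \<open>M\<close> on the multipliers.\<close>

definition init_ok :: "real \<times> real \<times> 'a \<times> real \<Rightarrow> bool" where
  "init_ok = (\<lambda>(l, \<Delta>, xf, M). xf \<in> S \<and> 0 < \<Delta> \<and> 1 / \<Delta> \<le> 2 * Q \<and> l = F xf + \<Delta> \<and>
     1 \<le> M \<and> M \<le> \<Omega> / \<Delta> \<and> G xf - g_star P \<le> M * \<Delta> \<and> l \<le> p_star P)"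

text \<open>A test at a level of at least \<open>p*\<close> finds a point that is almost optimal for the lower level.\<close>

lemma test_lower_bound:
  assumes "\<forall>y\<in>S. F y \<le> c \<longrightarrow> G x \<le> G y + t" "t < G x - G y" "y \<in> S"
  shows "c < p_star P"
proof (rule ccontr)
  assume "\<not> c < p_star P"
  moreover obtain z where "z \<in> S" "G z = g_star P" "F z = p_star P" by (rule p_star_attained)
  ultimately have "G x \<le> g_star P + t" using assms(1) by fastforce
  then show False using assms g_star_le[of y] by simp
qed

lemma runs_LBInit:
  assumes "xfinit \<in> S" "xginit \<in> S"
  shows "runs (LBInit P apg0 apgmu \<delta>init Dg Bf xfinit xginit)
    (\<lambda>r n. init_ok r \<and> real n \<le> 2 * K2 * \<Lambda> ^ 3 * B)"
proof -
  define c0 where "c0 = K2 * B * \<Lambda>\<^sup>2"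
  have c0: "0 \<le> c0" using B_ge_1 by (simp add: c0_def)
  \<comment> \<open>The state holds the value of \<open>\<Delta>\<close> before it is halved.\<close>
  define I where "I = (\<lambda>(\<Delta>, xf, xref, xt). xf \<in> S \<and> xref \<in> S \<and> xt \<in> S \<and> 1 / Q \<le> \<Delta> \<and> \<Delta> \<le> 2 * \<delta>init)"
  define \<Phi> where "\<Phi> = (\<lambda>(\<Delta>, xf :: 'a, xref :: 'a, xt :: 'a). c0 * (1 + log 2 (\<Delta> * Q)))"
  have "1 / Q \<le> \<delta>init" using Q_ge(1) Q_ge_1 \<delta>init by (simp add: field_simps)
  then have start: "I (2 * \<delta>init, xfinit, xginit, xfinit)" using assms \<delta>init by (simp add: I_def)
  have "runs (LBInit P apg0 apgmu \<delta>init Dg Bf xfinit xginit)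
    (\<lambda>r n. init_ok r \<and> real n + 0 \<le> \<Phi> (2 * \<delta>init, xfinit, xginit, xfinit))"
    unfolding LBInit_def
  proof (rule runs_loop[where I = I and \<Psi> = "\<lambda>_. 0", OF start])
    fix s assume I: "I s"
    obtain \<Delta>' xf' xref' xt' where s: "s = (\<Delta>', xf', xref', xt')" by (cases s)
    have in_S: "xf' \<in> S" "xref' \<in> S" "xt' \<in> S" and \<Delta>': "1 / Q \<le> \<Delta>'" "\<Delta>' \<le> 2 * \<delta>init"
      using I by (auto simp: I_def s)
    have "1 \<le> \<Delta>' * Q" using \<Delta>' Q_ge_1 by (simp add: field_simps)
    then have lQ: "0 \<le> log 2 (\<Delta>' * Q)" by simp
    then show "0 \<le> \<Phi> s" using c0 by (simp add: \<Phi>_def s)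
    define \<Delta> where "\<Delta> = \<Delta>' / 2"
    have \<Delta>: "0 < \<Delta>" "\<Delta> \<le> \<delta>init" "1 / \<Delta> \<le> 2 * Q"
      using \<Delta>' Q_ge_1 less_le_trans[of 0 "1 / Q" \<Delta>'] by (auto simp: \<Delta>_def field_simps)
    obtain xf nf where xf_eq: "apg0 (Lf1 P) (f1 P) (\<lambda>x. f2 P x + ind S x) \<Delta> xf' Dg = (xf, nf)"
      and xf: "xf \<in> S" "F xf \<le> f_star P + \<Delta>" and nf: "real nf \<le> K' * (1 + Dg * sqrt (Lf1 P / \<Delta>))"
      using apg0_upper[OF in_S(1) \<Delta>(1)] by (auto split: prod.splits)
    obtain xref ng where xref_eq: "apg0 (Lg1 P) (g1 P) (g2 P) \<Delta> xref' Dg = (xref, ng)"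
      and xref: "xref \<in> S" "G xref \<le> g_star P + \<Delta>"
      and ng: "real ng \<le> K' * (1 + Dg * sqrt (Lg1 P / \<Delta>))"
      using apg0_lower[OF in_S(2) \<Delta>(1)] by (auto split: prod.splits)
    define M where "M = max ((G xf - G xref + 1) / \<Delta>) 1"
    define l where "l = F xf + \<Delta>"
    have \<Delta>1: "\<Delta> \<le> 1" using \<Delta> \<delta>init Bf_ge_1 by (smt (verit) divide_le_eq_1)
    have M1: "1 \<le> M" by (simp add: M_def)
    have "G xf - g_star P \<le> G xf - G xref + 1" using xref \<Delta>1 by simp
    also have "\<dots> = (G xf - G xref + 1) / \<Delta> * \<Delta>" using \<Delta> by simp
    also have "\<dots> \<le> M * \<Delta>" using \<Delta> by (intro mult_right_mono) (auto simp: M_def)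
    finally have M\<Delta>: "G xf - g_star P \<le> M * \<Delta>" .
    have "G xf - G xref + 1 \<le> \<Omega>" using Omega_ge[OF xf(1)] g_star_le[OF xref(1)] by simp
    then have M\<Omega>: "M \<le> \<Omega> / \<Delta>"
      unfolding M_def using \<Delta> \<Delta>1 Omega_ge_1
      by (intro max.boundedI divide_right_mono) (auto simp: le_divide_eq)
    note M_bounds = M_le[OF \<Delta>(1,3) M\<Omega>]
    have "log 2 (1 / \<Delta>) \<le> log 2 (2 * Q)" using \<Delta> Q_ge_1 by (subst log_le_cancel_iff) auto
    also have "\<dots> \<le> 1 + log 2 X"
      using Q_ge_1 X_ge by (simp add: log_mult)
    also have "\<dots> \<le> 4 * \<Lambda>" using log_X \<Lambda>_ge_1 by linarith
    finally have l\<Delta>: "log 2 (1 / \<Delta>) \<le> 4 * \<Lambda>" .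
    have \<Delta>B: "\<Delta> \<le> 1 / Bf" using \<Delta> \<delta>init by simp
    note VT = runs_VTest[OF \<Delta>(1) \<Delta>B M1 M_bounds(2) X_ge(2-4) \<Lambda>_ge_1 log_X l\<Delta>
        init_round_arith(1)[OF \<Delta>(1,3) M1 M_bounds(1)] in_S(3) xf(1) \<Delta>(1) eq_refl[OF l_def[symmetric]] M\<Delta>,
        unfolded VTest_def]
    have "\<Delta>' * Q = 2 * (\<Delta> * Q)" by (simp add: \<Delta>_def)
    then have l\<Delta>': "log 2 (\<Delta>' * Q) = 1 + log 2 (\<Delta> * Q)" using \<Delta> Q_ge_1 by (simp add: log_mult)
    show "runs ((\<lambda>(\<Delta>', xf', xref', xt'). do {
       let \<Delta> = \<Delta>' / 2;
       xf \<leftarrow> Some (apg0 (Lf1 P) (f1 P) (\<lambda>x. f2 P x + ind (domg P) x) \<Delta> xf' Dg);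
       xref \<leftarrow> Some (apg0 (Lg1 P) (g1 P) (g2 P) \<Delta> xref' Dg);
       vf \<leftarrow> evalf P xf;
       let l = vf + \<Delta>;
       vgf \<leftarrow> evalg P xf;
       vgref \<leftarrow> evalg P xref;
       let M = max ((vgf - vgref + 1) / \<Delta>) 1;
       let C = 4 * C_D Dg * M;
       let \<eta> = \<Delta> / C_D Dg;
       (xt, z) \<leftarrow> dual_penalized P apgmu \<eta> xf l M xt' (\<Delta> / C);
       vgt \<leftarrow> evalg P xt;
       return (if vgt - vgref > \<Delta> then Inr (l, \<Delta>, xf, M) else Inl (\<Delta>, xf, xref, xt))
     }) s) (\<lambda>x n. case x of
        Inl s' \<Rightarrow> I s' \<and> 1 \<le> n \<and> real n + \<Phi> s' \<le> \<Phi> s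
      | Inr r \<Rightarrow> init_ok r \<and> real n + 0 \<le> \<Phi> s)"
      unfolding s prod.case Let_def \<Delta>_def[symmetric] xf_eq xref_eq runs_bind runs_Some
        runs_evalf runs_evalg M_def[symmetric] l_def[symmetric]
    proof (rule runs_mono[OF VT])
      fix r and nt :: nat
      assume r: "(case r of (x, z) \<Rightarrow> \<lambda>n. x \<in> S \<and> F x \<le> l + \<Delta> / 4 \<and>
        (\<forall>y\<in>S. F y \<le> l \<longrightarrow> G x \<le> G y + \<Delta>) \<and> real n \<le> K1 * (4 * B) * \<Lambda>\<^sup>2) nt"
      obtain xt z where rz: "r = (xt, z)" by (cases r)
      have xt: "xt \<in> S" "F xt \<le> l + \<Delta> / 4" "\<forall>y\<in>S. F y \<le> l \<longrightarrow> G xt \<le> G y + \<Delta>"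
        and nt: "real nt \<le> K1 * (4 * B) * \<Lambda>\<^sup>2"
        using r by (auto simp: rz)
      have cost: "real nf + real ng + 8 + real nt \<le> c0"
        using nf ng nt init_round_arith(2)[OF \<Delta>(1,3) M1 M_bounds(1)] unfolding c0_def by linarith
      show "runs (case r of (xt, z) \<Rightarrow> bind_comp (evalg P xt) (\<lambda>vgt. return
          (if vgt - G xref > \<Delta> then Inr (l, \<Delta>, xf, M) else Inl (\<Delta>, xf, xref, xt))))
        (\<lambda>q j. case q of
          Inl s' \<Rightarrow> I s' \<and> 1 \<le> nf + (ng + (2 + (2 + (2 + (nt + j))))) \<and>
            real (nf + (ng + (2 + (2 + (2 + (nt + j)))))) + \<Phi> s' \<le> \<Phi> (\<Delta>', xf', xref', xt')
        | Inr r \<Rightarrow> init_ok r \<and>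
            real (nf + (ng + (2 + (2 + (2 + (nt + j)))))) + 0 \<le> \<Phi> (\<Delta>', xf', xref', xt'))"
      proof (cases "G xt - G xref > \<Delta>")
        case True
        have "l \<le> p_star P"
          using test_lower_bound[OF xt(3) True xref(1)] by simp
        then have "init_ok (l, \<Delta>, xf, M)"
          using xf \<Delta> M1 M\<Omega> M\<Delta> by (simp add: init_ok_def l_def)
        moreover have "c0 \<le> \<Phi> (\<Delta>', xf', xref', xt')"
          using lQ c0 by (simp add: \<Phi>_def mult_left_le algebra_simps)
        ultimately show ?thesis using True cost by (simp add: rz)
      next
        case False
        \<comment> \<open>Otherwise the tested value is so close to \<open>f*\<close> that \<open>xt\<close> misses \<open>g*\<close> by at least \<open>m\<^sub>0 \<ge> 8\<Delta>\<close>.\<close>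
        have "1 / Q \<le> \<Delta>"
        proof (rule ccontr)
          assume "\<not> 1 / Q \<le> \<Delta>"
          then have "\<Delta> \<le> 1 / Q" by simp
          moreover have "1 / Q \<le> (p_star P - f_star P) / 8" "1 / Q \<le> m_0 P / 8"
            using Q_ge(2,3) Q_ge_1 f_star_less m_0_pos by (auto simp: field_simps)
          ultimately have small: "\<Delta> \<le> (p_star P - f_star P) / 8" "\<Delta> \<le> m_0 P / 8" by linarith+
          have "F xt \<le> (p_star P + f_star P) / 2"
            using xt(2) xf(2) small(1) \<Delta>(1) unfolding l_def by (simp add: field_simps)
          from m_0_le[OF xt(1) this] show False using False xref(2) small(2) m_0_pos by simp
        qed
        then have "I (\<Delta>, xf, xref, xt)" using xf xref xt \<Delta> by (simp add: I_def)
        moreover have "c0 + \<Phi> (\<Delta>, xf, xref, xt) \<le> \<Phi> (\<Delta>', xf', xref', xt')"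
          by (simp add: \<Phi>_def l\<Delta>' algebra_simps)
        ultimately show ?thesis using False cost by (simp add: rz)
      qed
    qed
  qed
  moreover have "\<Phi> (2 * \<delta>init, xfinit, xginit, xfinit) \<le> 2 * K2 * \<Lambda> ^ 3 * B"
  proof -
    have d1: "\<delta>init \<le> 1" using \<delta>init Bf_ge_1 by (smt (verit) divide_le_eq_1)
    have "log 2 (2 * \<delta>init * Q) = 1 + log 2 \<delta>init + log 2 Q"
      using \<delta>init Q_ge_1 by (simp add: log_mult)
    also have "\<dots> \<le> 1 + 0 + log 2 X" using d1 \<delta>init Q_ge_1 X_ge by (intro add_mono) auto
    also have "\<dots> \<le> 1 + 2 * (\<Lambda> - 1)" using log2_le_ln[OF X_ge(1)] by (simp add: \<Lambda>_eq)
    finally have "1 + log 2 (2 * \<delta>init * Q) \<le> 2 * \<Lambda>" by simp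
    then have "\<Phi> (2 * \<delta>init, xfinit, xginit, xfinit) \<le> c0 * (2 * \<Lambda>)"
      unfolding \<Phi>_def prod.case using c0 by (intro mult_left_mono)
    also have "\<dots> = 2 * K2 * \<Lambda> ^ 3 * B" by (simp add: c0_def power2_eq_square power3_eq_cube)
    finally show ?thesis .
  qed
  ultimately show ?thesis by (elim runs_mono) auto
qed

section \<open>The search phase\<close>


text \<open>The inner loop of the method: it halves the level of the test until its outcome is conclusive.\<close>

definition refine :: "real \<Rightarrow> 'a \<Rightarrow> real \<Rightarrow> real \<Rightarrow> real \<Rightarrow> 'a \<times> real \<times> real \<Rightarrow> ('a \<times> real \<times> real) comp" where
  "refine \<epsilon> xf M c vg = loop (\<lambda>(x, \<delta>, v).
     if \<epsilon> / 2 < v - vg \<and> v - vg \<le> \<delta>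
     then do {
       (x', z') \<leftarrow> VTest P apgmu Dg xf M c (\<delta> / 2) x;
       v' \<leftarrow> evalg P x';
       return (Inl (x', \<delta> / 2, v')) }
     else return (Inr (x, \<delta>, v)))"

text \<open>The outer loop of the method: the bisection of the bracket \<open>[l, u]\<close>, where \<open>vg\<close> is the reference value for \<open>g\<close>.\<close>

definition search :: "real \<Rightarrow> 'a \<Rightarrow> real \<Rightarrow> real \<Rightarrow> real \<times> real \<times> 'a \<times> real \<Rightarrow> 'a comp" where
  "search \<epsilon> xf M vg = loop (\<lambda>(l, u, xu, \<delta>in).
     if u - l > \<epsilon>
     then do {
       let w = u - l;
       let c = (l + u) / 2;
       let \<delta>0 = min \<delta>in (w / 4);
       (x0, z0) \<leftarrow> VTest P apgmu Dg xf M c \<delta>0 xu;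
       v0 \<leftarrow> evalg P x0;
       (xc, \<delta>, v) \<leftarrow> refine \<epsilon> xf M c vg (x0, \<delta>0, v0);
       (if v - vg > \<delta> then return (Inl (c, u, xu, \<delta>))
        else do {
          u' \<leftarrow> evalf P xc;
          return (Inl (l, u', xc, \<delta>)) }) }
     else return (Inr xu))"

lemma BiVFA_eq:
  "BiVFA P apg0 apgmu \<epsilon> Dg Bf \<delta>init xfinit xginit = do {
     (l0, \<Delta>, xf, M) \<leftarrow> LBInit P apg0 apgmu \<delta>init Dg Bf xfinit xginit;
     xg \<leftarrow> Some (apg0 (Lg1 P) (g1 P) (g2 P) (\<epsilon> / 2) xginit Dg);
     u0 \<leftarrow> evalf P xg;
     (if u0 - l0 \<le> \<epsilon> then return xg
      else do {
        vg \<leftarrow> evalg P xg;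
        search \<epsilon> xf M vg (l0, u0, xg, \<delta>init) }) }"
  unfolding BiVFA_def search_def refine_def ..

text \<open>\<open>passed c t x\<close>: the point \<open>x\<close> is a possible outcome of the test for the value \<open>c\<close> at level
  \<open>t\<close>.\<close>

definition passed :: "real \<Rightarrow> real \<Rightarrow> 'a \<Rightarrow> bool" where
  "passed c t x \<longleftrightarrow> x \<in> S \<and> F x \<le> c + t / 4 \<and> (\<forall>y\<in>S. F y \<le> c \<longrightarrow> G x \<le> G y + t)"

text \<open>\<open>A\<close> is the square root in the bound, and \<open>W\<close> collects the logarithms.\<close>

definition A :: "real \<Rightarrow> real" where
  "A \<epsilon> = sqrt (C_D Dg / \<epsilon> * (Lg1 P + Lf1 P * \<Omega> * Q))"

definition W :: "real \<Rightarrow> real" where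
  "W \<epsilon> = \<Lambda> * (1 + ln (1 / \<epsilon>))"

text \<open>The cost of one test together with the evaluations that accompany it in a round.\<close>

definition test_cost :: "real \<Rightarrow> real" where
  "test_cost \<epsilon> = K1 * (4 * A \<epsilon>) * (W \<epsilon>)\<^sup>2 + 4"

context
  fixes \<epsilon> :: real
  assumes \<epsilon>: "0 < \<epsilon>" "\<epsilon> \<le> 1" "\<epsilon> \<le> 4 * \<delta>init"
begin

lemma ln_eps: "0 \<le> ln (1 / \<epsilon>)"
  using \<epsilon> by simp

lemma W_ge: "1 \<le> W \<epsilon>" "\<Lambda> \<le> W \<epsilon>" "1 + ln (1 / \<epsilon>) \<le> W \<epsilon>"
proof -
  show 1: "\<Lambda> \<le> W \<epsilon>" "1 + ln (1 / \<epsilon>) \<le> W \<epsilon>"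
    using mult_left_mono[of 1 "1 + ln (1 / \<epsilon>)" \<Lambda>] mult_right_mono[of 1 \<Lambda> "1 + ln (1 / \<epsilon>)"]
      \<Lambda>_ge_1 ln_eps by (auto simp: W_def)
  show "1 \<le> W \<epsilon>" using 1 \<Lambda>_ge_1 by linarith
qed

lemma A_ge_1: "1 \<le> A \<epsilon>"
proof -
  have "1 * 1 \<le> C_D Dg / \<epsilon> * (Lg1 P + Lf1 P * \<Omega> * Q)"
  proof (intro mult_mono)
    show "1 \<le> C_D Dg / \<epsilon>" using C_D_ge_1 \<epsilon> by simp
    show "1 \<le> Lg1 P + Lf1 P * \<Omega> * Q"
      using Lg1_ge_1 Lf1_pos Omega_ge_1 Q_ge_1 by (simp add: add_increasing2)
  qed (use \<epsilon> C_D_ge_1 in auto)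
  then show ?thesis by (simp add: A_def)
qed

lemma test_cost_ge: "4 \<le> test_cost \<epsilon>"
  using A_ge_1 W_ge by (simp add: test_cost_def)

lemma runs_test:
  assumes init: "init_ok (l0, \<Delta>, xf, M)" and c: "l0 \<le> c" and t: "\<epsilon> / 4 \<le> t" "t \<le> \<delta>init"
    and xin: "xin \<in> S"
  shows "runs (VTest P apgmu Dg xf M c t xin)
    (\<lambda>(x, z) n. passed c t x \<and> real n + 4 \<le> test_cost \<epsilon>)"
proof -
  have xf: "xf \<in> S" and \<Delta>: "0 < \<Delta>" "1 / \<Delta> \<le> 2 * Q" "F xf + \<Delta> \<le> c" "G xf - g_star P \<le> M * \<Delta>"
    and M: "1 \<le> M" "M \<le> \<Omega> / \<Delta>"
    using init c by (auto simp: init_ok_def)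
  have t0: "0 < t" "t \<le> 1 / Bf" using t \<epsilon> \<delta>init by auto
  have inv: "1 / t \<le> 4 / \<epsilon>" using t \<epsilon> t0 by (simp add: field_simps)
  note M_bounds = M_le[OF \<Delta>(1,2) M(2)]
  have "log 2 (1 / t) \<le> log 2 (4 / \<epsilon>)" using inv t0 \<epsilon> by (subst log_le_cancel_iff) auto
  also have "\<dots> = 2 + log 2 (1 / \<epsilon>)"
    using \<epsilon> log_pow_cancel[of 2 2] by (simp add: log_divide)
  also have "\<dots> \<le> 2 + 2 * ln (1 / \<epsilon>)" using log2_le_ln[of "1 / \<epsilon>"] \<epsilon> by simp
  finally have lt: "log 2 (1 / t) \<le> 4 * W \<epsilon>" using W_ge by linarith
  have lX: "log 2 X \<le> 2 * W \<epsilon>" using log_X W_ge by linarith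
  have R: "sqrt (2 * (C_D Dg / t) * (Lg1 P + M * Lf1 P)) \<le> 4 * A \<epsilon>"
  proof -
    have "C_D Dg / t \<le> C_D Dg * (4 / \<epsilon>)"
      using mult_left_mono[OF inv, of "C_D Dg"] C_D_ge_1 by simp
    moreover have "M * Lf1 P \<le> 2 * (\<Omega> * Q) * Lf1 P"
      using M_bounds Lf1_pos by (intro mult_right_mono) auto
    moreover have "0 \<le> Lg1 P + M * Lf1 P" using Lg1_ge_1 M Lf1_pos by simp
    ultimately have "2 * (C_D Dg / t) * (Lg1 P + M * Lf1 P)
        \<le> 2 * (C_D Dg * (4 / \<epsilon>)) * (Lg1 P + 2 * (\<Omega> * Q) * Lf1 P)"
      using C_D_ge_1 \<epsilon> t0 by (intro mult_mono) auto
    also have "\<dots> \<le> 2 * (C_D Dg * (4 / \<epsilon>)) * (2 * (Lg1 P + Lf1 P * \<Omega> * Q))"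
      using C_D_ge_1 \<epsilon> Lg1_ge_1 by (intro mult_left_mono) (auto simp: algebra_simps)
    also have "\<dots> = 4\<^sup>2 * (C_D Dg / \<epsilon> * (Lg1 P + Lf1 P * \<Omega> * Q))" by simp
    finally have "sqrt (2 * (C_D Dg / t) * (Lg1 P + M * Lf1 P))
      \<le> sqrt (4\<^sup>2 * (C_D Dg / \<epsilon> * (Lg1 P + Lf1 P * \<Omega> * Q)))" by (rule real_sqrt_le_mono)
    then show ?thesis unfolding A_def real_sqrt_mult[of "4\<^sup>2"] by simp
  qed
  show ?thesis
    by (rule runs_mono[OF runs_VTest[OF t0 M(1) M_bounds(2) X_ge(2-4) W_ge(1) lX lt R xin xf \<Delta>(1,3,4)]])
      (auto simp: passed_def test_cost_def)
qed

text \<open>Each halving is paid for by the decrease of \<open>log 2 (4 \<delta> / \<epsilon>)\<close>, so the number of all halvings in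
  the search phase is bounded by the initial value of this logarithm.  A level is halved only if it
  exceeds \<open>\<epsilon>/2\<close>, which keeps it above \<open>\<epsilon>/4\<close>.\<close>

lemma runs_refine:
  assumes init: "init_ok (l0, \<Delta>, xf, M)" and c: "l0 \<le> c"
    and x0: "passed c \<delta>0 x0" and \<delta>0: "\<epsilon> / 4 \<le> \<delta>0" "\<delta>0 \<le> \<delta>init"
  shows "runs (refine \<epsilon> xf M c vg (x0, \<delta>0, G x0))
    (\<lambda>(x, \<delta>, v) n. passed c \<delta> x \<and> v = G x \<and> \<epsilon> / 4 \<le> \<delta> \<and> \<delta> \<le> \<delta>0 \<and>
      \<not> (\<epsilon> / 2 < v - vg \<and> v - vg \<le> \<delta>) \<and>
      real n + test_cost \<epsilon> * log 2 (4 * \<delta> / \<epsilon>) \<le> test_cost \<epsilon> * log 2 (4 * \<delta>0 / \<epsilon>))"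
proof -
  let ?I = "\<lambda>(x, \<delta>, v). passed c \<delta> x \<and> v = G x \<and> \<epsilon> / 4 \<le> \<delta> \<and> \<delta> \<le> \<delta>0"
  let ?R = "\<lambda>(x, \<delta>, v). ?I (x, \<delta>, v) \<and> \<not> (\<epsilon> / 2 < v - vg \<and> v - vg \<le> \<delta>)"
  let ?\<Phi> = "\<lambda>(x, \<delta>, v). test_cost \<epsilon> * log 2 (4 * \<delta> / \<epsilon>)"
  have "runs (refine \<epsilon> xf M c vg (x0, \<delta>0, G x0))
    (\<lambda>r n. ?R r \<and> real n + ?\<Phi> r \<le> ?\<Phi> (x0, \<delta>0, G x0))"
    unfolding refine_def
  proof (rule runs_loop[where I = ?I])
    show "?I (x0, \<delta>0, G x0)" using x0 \<delta>0 by simp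
    show "0 \<le> ?\<Phi> s" if "?I s" for s
      using that \<epsilon> test_cost_ge by (auto simp: le_divide_eq intro!: mult_nonneg_nonneg)
  next
    fix s assume I: "?I s"
    obtain x \<delta> v where s: "s = (x, \<delta>, v)" by (cases s)
    have x: "passed c \<delta> x" "v = G x" "\<epsilon> / 4 \<le> \<delta>" "\<delta> \<le> \<delta>0" using I by (auto simp: s)
    show "runs ((\<lambda>(x, \<delta>, v).
         if \<epsilon> / 2 < v - vg \<and> v - vg \<le> \<delta>
         then do {
           (x', z') \<leftarrow> VTest P apgmu Dg xf M c (\<delta> / 2) x;
           v' \<leftarrow> evalg P x';
           return (Inl (x', \<delta> / 2, v')) }
         else return (Inr (x, \<delta>, v))) s)
      (\<lambda>y n. case y of
        Inl s' \<Rightarrow> ?I s' \<and> 1 \<le> n \<and> real n + ?\<Phi> s' \<le> ?\<Phi> s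
      | Inr r \<Rightarrow> ?R r \<and> real n + ?\<Phi> r \<le> ?\<Phi> s)"
    proof (cases "\<epsilon> / 2 < v - vg \<and> v - vg \<le> \<delta>")
      case True
      then have \<delta>: "\<epsilon> / 4 \<le> \<delta> / 2" "\<delta> / 2 \<le> \<delta>init" "\<delta> / 2 \<le> \<delta>0" using x \<delta>0 \<epsilon> by linarith+
      have "log 2 (4 * \<delta> / \<epsilon>) = 1 + log 2 (4 * (\<delta> / 2) / \<epsilon>)"
        using \<delta> \<epsilon> log_pow_cancel[of 2 2] by (simp add: log_divide log_mult)
      then have "test_cost \<epsilon> + test_cost \<epsilon> * log 2 (4 * (\<delta> / 2) / \<epsilon>) = test_cost \<epsilon> * log 2 (4 * \<delta> / \<epsilon>)"
        by (simp add: algebra_simps)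
      moreover have "x \<in> S" using x by (simp add: passed_def)
      ultimately show ?thesis
        using True \<delta> unfolding s prod.case if_P[OF True] runs_bind
        by (intro runs_mono[OF runs_test[OF init c \<delta>(1,2)]]) auto
    next
      case False
      then show ?thesis using x unfolding s prod.case if_not_P[OF False] by simp
    qed
  qed
  then show ?thesis by (rule runs_mono) auto
qed

text \<open>The potential of the width \<open>w\<close> of the bracket; it drops by one when the width shrinks by the
  factor \<open>3/4\<close>, because \<open>4 ln (4/3) \<ge> 1\<close>.\<close>

definition width_potential :: "real \<Rightarrow> real" where
  "width_potential w = (if \<epsilon> < w then 1 + 4 * ln (w / \<epsilon>) else 0)"

lemma width_potential_nonneg: "0 \<le> width_potential w"
  using \<epsilon> by (simp add: width_potential_def)

lemma width_potential_step:
  assumes "\<epsilon> < w" "w' \<le> 3 / 4 * w"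
  shows "1 + width_potential w' \<le> width_potential w"
proof -
  have "0 \<le> ln (w / \<epsilon>)" using assms \<epsilon> by simp
  moreover have "1 + 4 * ln (w' / \<epsilon>) \<le> 4 * ln (w / \<epsilon>)" if "\<epsilon> < w'"
  proof -
    have "ln (3 / 4 :: real) \<le> 3 / 4 - 1" by (rule ln_le_minus_one) simp
    moreover have "ln (w' / \<epsilon>) \<le> ln (3 / 4 * (w / \<epsilon>))"
      using assms that \<epsilon> divide_right_mono[OF assms(2), of \<epsilon>] by (subst ln_le_cancel_iff) auto
    moreover have "ln (3 / 4 * (w / \<epsilon>)) = ln (3 / 4) + ln (w / \<epsilon>)"
      using assms \<epsilon> by (intro ln_mult_pos) auto
    ultimately show ?thesis by linarith
  qed
  ultimately show ?thesis using assms by (simp add: width_potential_def)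
qed

lemma runs_search:
  assumes init: "init_ok (l0, \<Delta>, xf, M)" and xg: "xg \<in> S" "G xg \<le> g_star P + \<epsilon> / 2"
  shows "runs (search \<epsilon> xf M (G xg) (l0, F xg, xg, \<delta>init))
    (\<lambda>x n. x \<in> S \<and> F x \<le> p_star P + \<epsilon> \<and> G x \<le> g_star P + \<epsilon> \<and>
      real n \<le> 14 * W \<epsilon> * test_cost \<epsilon>)"
proof -
  let ?I = "\<lambda>(l, u, xu, \<delta>in). l0 \<le> l \<and> l \<le> p_star P \<and> u = F xu \<and> xu \<in> S \<and> G xu \<le> g_star P + \<epsilon> \<and>
    \<epsilon> / 4 \<le> \<delta>in \<and> \<delta>in \<le> \<delta>init"
  let ?R = "\<lambda>x. x \<in> S \<and> F x \<le> p_star P + \<epsilon> \<and> G x \<le> g_star P + \<epsilon>"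
  \<comment> \<open>One unit of \<open>test_cost\<close> for every halving still possible and for every round still needed.\<close>
  let ?\<Phi> = "\<lambda>(l, u, xu, \<delta>in). test_cost \<epsilon> * (log 2 (4 * \<delta>in / \<epsilon>) + width_potential (u - l))"
  have "runs (search \<epsilon> xf M (G xg) (l0, F xg, xg, \<delta>init))
    (\<lambda>r n. ?R r \<and> real n + 0 \<le> ?\<Phi> (l0, F xg, xg, \<delta>init))"
    unfolding search_def
  proof (rule runs_loop[where I = ?I and \<Psi> = "\<lambda>_. 0"])
    show "?I (l0, F xg, xg, \<delta>init)" using init xg \<epsilon> by (simp add: init_ok_def)
    show "0 \<le> ?\<Phi> s" if "?I s" for s
      using that \<epsilon> test_cost_ge width_potential_nonneg
      by (auto simp: le_divide_eq intro!: mult_nonneg_nonneg add_nonneg_nonneg)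
  next
    fix s assume I: "?I s"
    obtain l u xu \<delta>in where s: "s = (l, u, xu, \<delta>in)" by (cases s)
    have l: "l0 \<le> l" "l \<le> p_star P" and u: "u = F xu" "xu \<in> S" "G xu \<le> g_star P + \<epsilon>"
      and \<delta>in: "\<epsilon> / 4 \<le> \<delta>in" "\<delta>in \<le> \<delta>init"
      using I by (auto simp: s)
    show "runs ((\<lambda>(l, u, xu, \<delta>in).
       if u - l > \<epsilon>
       then do {
         let w = u - l;
         let c = (l + u) / 2;
         let \<delta>0 = min \<delta>in (w / 4);
         (x0, z0) \<leftarrow> VTest P apgmu Dg xf M c \<delta>0 xu;
         v0 \<leftarrow> evalg P x0;
         (xc, \<delta>, v) \<leftarrow> refine \<epsilon> xf M c (G xg) (x0, \<delta>0, v0);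
         (if v - G xg > \<delta> then return (Inl (c, u, xu, \<delta>))
          else do {
            u' \<leftarrow> evalf P xc;
            return (Inl (l, u', xc, \<delta>)) }) }
       else return (Inr xu)) s)
      (\<lambda>y n. case y of
        Inl s' \<Rightarrow> ?I s' \<and> 1 \<le> n \<and> real n + ?\<Phi> s' \<le> ?\<Phi> s
      | Inr r \<Rightarrow> ?R r \<and> real n + 0 \<le> ?\<Phi> s)"
    proof (cases "u - l > \<epsilon>")
      case False
      have "0 \<le> test_cost \<epsilon> * (log 2 (4 * \<delta>in / \<epsilon>) + width_potential (u - l))"
        using \<delta>in \<epsilon> test_cost_ge width_potential_nonneg
        by (auto simp: le_divide_eq intro!: mult_nonneg_nonneg add_nonneg_nonneg)
      then show ?thesis using False l u by (simp add: s)
    next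
      case True
      define c where "c = (l + u) / 2"
      define \<delta>0 where "\<delta>0 = min \<delta>in ((u - l) / 4)"
      have c: "l0 \<le> c" and half: "u - c = (u - l) / 2" "c - l = (u - l) / 2"
        using True l \<epsilon> by (auto simp: c_def field_simps)
      have "\<epsilon> / 4 \<le> \<delta>0" unfolding \<delta>0_def using True \<delta>in by (intro min.boundedI) auto
      moreover have "\<delta>0 \<le> \<delta>in" "\<delta>0 \<le> (u - l) / 4" by (simp_all only: \<delta>0_def min.cobounded1 min.cobounded2)
      ultimately have \<delta>0: "\<epsilon> / 4 \<le> \<delta>0" "\<delta>0 \<le> \<delta>init" "\<delta>0 \<le> \<delta>in" "\<delta>0 \<le> (u - l) / 4"
        using \<delta>in by linarith+
      \<comment> \<open>The two outcomes of a conclusive test: \<open>c\<close> is a lower bound, or \<open>xc\<close> replaces \<open>xu\<close>.\<close>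
      have next_round: "case (if v - G xg > \<delta> then (c, u, xu, \<delta>) else (l, F xc, xc, \<delta>)) of s' \<Rightarrow>
          ?I s' \<and> test_cost \<epsilon> * log 2 (4 * \<delta>0 / \<epsilon>) + test_cost \<epsilon> + ?\<Phi> s'
            \<le> ?\<Phi> s + test_cost \<epsilon> * log 2 (4 * \<delta> / \<epsilon>)"
        if xc: "passed c \<delta> xc" "v = G xc" and \<delta>: "\<epsilon> / 4 \<le> \<delta>" "\<delta> \<le> \<delta>0"
          and stop: "\<not> (\<epsilon> / 2 < v - G xg \<and> v - G xg \<le> \<delta>)" for xc \<delta> v
      proof -
        have \<Phi>: "test_cost \<epsilon> * log 2 (4 * \<delta>0 / \<epsilon>) + test_cost \<epsilon>
            + test_cost \<epsilon> * (log 2 (4 * \<delta> / \<epsilon>) + width_potential w')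
            \<le> ?\<Phi> s + test_cost \<epsilon> * log 2 (4 * \<delta> / \<epsilon>)" if "w' \<le> 3 / 4 * (u - l)" for w'
        proof -
          have "log 2 (4 * \<delta>0 / \<epsilon>) \<le> log 2 (4 * \<delta>in / \<epsilon>)"
            using \<delta>0 \<epsilon> by (subst log_le_cancel_iff) (auto simp: divide_right_mono)
          then have "test_cost \<epsilon> * (log 2 (4 * \<delta>0 / \<epsilon>) + (1 + width_potential w'))
              \<le> test_cost \<epsilon> * (log 2 (4 * \<delta>in / \<epsilon>) + width_potential (u - l))"
            using width_potential_step[OF True that] test_cost_ge by (intro mult_left_mono add_mono) auto
          then show ?thesis by (simp add: s algebra_simps)
        qed
        show ?thesis
        proof (cases "v - G xg > \<delta>")
          case up: True
          then have "c < p_star P"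
            using xc xg by (intro test_lower_bound[of c xc \<delta> xg]) (auto simp: passed_def)
          moreover have "l0 \<le> c" by (rule c)
          ultimately show ?thesis
            using up u \<delta> \<delta>0 \<Phi>[of "u - c"] half True \<epsilon> by auto
        next
          case down: False
          then have "G xc \<le> g_star P + \<epsilon>" using stop xc(2) xg by linarith
          moreover have "F xc - l \<le> 3 / 4 * (u - l)"
          proof -
            have "F xc \<le> c + \<delta> / 4" using xc by (simp add: passed_def)
            then show ?thesis using half \<delta> \<delta>0 True \<epsilon> by linarith
          qed
          ultimately show ?thesis
            using down l xc \<delta> \<delta>0 \<Phi>[of "F xc - l"] by (auto simp: passed_def)
        qed
      qed
      let ?\<Phi>s = "test_cost \<epsilon> * (log 2 (4 * \<delta>in / \<epsilon>) + width_potential (u - l))"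
      show ?thesis
        unfolding s prod.case if_P[OF True] Let_def c_def[symmetric] \<delta>0_def[symmetric] runs_bind
      proof (rule runs_mono[OF runs_test[OF init c \<delta>0(1,2) u(2)]], clarify)
        fix x0 z0 and n0 :: nat assume x0: "passed c \<delta>0 x0" and n0: "real n0 + 4 \<le> test_cost \<epsilon>"
        show "runs (do {
            v0 \<leftarrow> evalg P x0;
            (xc, \<delta>, v) \<leftarrow> refine \<epsilon> xf M c (G xg) (x0, \<delta>0, v0);
            (if v - G xg > \<delta> then return (Inl (c, u, xu, \<delta>))
             else do {
               u' \<leftarrow> evalf P xc;
               return (Inl (l, u', xc, \<delta>)) }) })
          (\<lambda>y j. case y of
            Inl s' \<Rightarrow> ?I s' \<and> 1 \<le> n0 + j \<and> real (n0 + j) + ?\<Phi> s' \<le> ?\<Phi>s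
          | Inr r \<Rightarrow> ?R r \<and> real (n0 + j) + 0 \<le> ?\<Phi>s)"
          unfolding runs_bind runs_evalg
        proof (rule runs_mono[OF runs_refine[OF init c x0 \<delta>0(1,2)]])
          fix r and n2 :: nat
          assume r: "(case r of (x, \<delta>, v) \<Rightarrow> \<lambda>n. passed c \<delta> x \<and> v = G x \<and> \<epsilon> / 4 \<le> \<delta> \<and> \<delta> \<le> \<delta>0 \<and>
            \<not> (\<epsilon> / 2 < v - G xg \<and> v - G xg \<le> \<delta>) \<and>
            real n + test_cost \<epsilon> * log 2 (4 * \<delta> / \<epsilon>) \<le> test_cost \<epsilon> * log 2 (4 * \<delta>0 / \<epsilon>)) n2"
          obtain xc \<delta> v where rr: "r = (xc, \<delta>, v)" by (cases r)
          have xc: "passed c \<delta> xc" "v = G xc" "\<epsilon> / 4 \<le> \<delta>" "\<delta> \<le> \<delta>0"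
              "\<not> (\<epsilon> / 2 < v - G xg \<and> v - G xg \<le> \<delta>)"
            and n2: "real n2 + test_cost \<epsilon> * log 2 (4 * \<delta> / \<epsilon>) \<le> test_cost \<epsilon> * log 2 (4 * \<delta>0 / \<epsilon>)"
            using r by (auto simp: rr)
          show "runs (case r of (xc, \<delta>, v) \<Rightarrow>
              if v - G xg > \<delta> then return (Inl (c, u, xu, \<delta>))
              else bind_comp (evalf P xc) (\<lambda>u'. return (Inl (l, u', xc, \<delta>))))
            (\<lambda>y j. case y of
              Inl s' \<Rightarrow> ?I s' \<and> 1 \<le> n0 + (2 + (n2 + j)) \<and>
                real (n0 + (2 + (n2 + j))) + ?\<Phi> s' \<le> ?\<Phi>s
            | Inr r \<Rightarrow> ?R r \<and> real (n0 + (2 + (n2 + j))) + 0 \<le> ?\<Phi>s)"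
          proof (cases "v - G xg > \<delta>")
            case up: True
            then show ?thesis using next_round[OF xc] n0 n2 by (auto simp: rr s)
          next
            case down: False
            then show ?thesis using next_round[OF xc] n0 n2 by (auto simp: rr s)
          qed
        qed
      qed
    qed
  qed
  moreover have "?\<Phi> (l0, F xg, xg, \<delta>init) \<le> 14 * W \<epsilon> * test_cost \<epsilon>"
  proof -
    have xf: "xf \<in> S" and l0: "F xf \<le> l0" using init by (auto simp: init_ok_def)
    have d1: "\<delta>init \<le> 1" using \<delta>init Bf_ge_1 by (smt (verit) divide_le_eq_1)
    have "log 2 (4 * \<delta>init / \<epsilon>) \<le> log 2 (4 * (1 / \<epsilon>))"
      using d1 \<delta>init \<epsilon> by (subst log_le_cancel_iff) (auto simp: divide_right_mono)
    also have "\<dots> = 2 + log 2 (1 / \<epsilon>)"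
      using \<epsilon> log_pow_cancel[of 2 2] by (simp add: log_divide)
    also have "\<dots> \<le> 2 + 2 * ln (1 / \<epsilon>)" using log2_le_ln[of "1 / \<epsilon>"] \<epsilon> by simp
    finally have 1: "log 2 (4 * \<delta>init / \<epsilon>) \<le> 2 * W \<epsilon>" using W_ge by linarith
    have "width_potential (F xg - l0) \<le> 12 * W \<epsilon>"
    proof (cases "\<epsilon> < F xg - l0")
      case False
      then show ?thesis using W_ge by (simp add: width_potential_def)
    next
      case True
      have "F xg - l0 \<le> Bf * norm (xg - xf)" using F_lipschitz[OF xg(1) xf] l0 by linarith
      also have "\<dots> \<le> X * X"
        using dist_le_Dg[OF xg(1) xf] X_ge Bf_ge_1 Dg_pos by (intro mult_mono) auto
      finally have "(F xg - l0) / \<epsilon> \<le> X * X / \<epsilon>" using \<epsilon> by (intro divide_right_mono) auto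
      then have "ln ((F xg - l0) / \<epsilon>) \<le> ln (X * X * (1 / \<epsilon>))"
        using True \<epsilon> X_ge by (subst ln_le_cancel_iff) auto
      also have "\<dots> = 2 * ln X + ln (1 / \<epsilon>)"
        using X_ge(1) \<epsilon> by (simp add: ln_mult_pos ln_div)
      finally have "width_potential (F xg - l0) \<le> 1 + 8 * ln X + 4 * ln (1 / \<epsilon>)"
        using True by (simp add: width_potential_def)
      moreover have "ln X \<le> W \<epsilon> - 1" using W_ge by (simp add: \<Lambda>_eq)
      ultimately show ?thesis using W_ge by linarith
    qed
    with 1 have "test_cost \<epsilon> * (log 2 (4 * \<delta>init / \<epsilon>) + width_potential (F xg - l0))
        \<le> test_cost \<epsilon> * (14 * W \<epsilon>)"
      using test_cost_ge by (intro mult_left_mono) auto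
    then show ?thesis by (simp add: mult.commute)
  qed
  ultimately show ?thesis by (elim runs_mono) auto
qed

text \<open>The constant in front of the cost of everything after the initialisation.\<close>

abbreviation K3 :: real where "K3 \<equiv> 2 * K' + 60 + 56 * K1"

lemma runs_after_init:
  assumes init: "init_ok (l0, \<Delta>, xf, M)" and xginit: "xginit \<in> S"
  shows "runs (do {
     xg \<leftarrow> Some (apg0 (Lg1 P) (g1 P) (g2 P) (\<epsilon> / 2) xginit Dg);
     u0 \<leftarrow> evalf P xg;
     (if u0 - l0 \<le> \<epsilon> then return xg
      else do {
        vg \<leftarrow> evalg P xg;
        search \<epsilon> xf M vg (l0, u0, xg, \<delta>init) }) })
    (\<lambda>x n. x \<in> S \<and> F x \<le> p_star P + \<epsilon> \<and> G x \<le> g_star P + \<epsilon> \<and>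
      real n \<le> K3 * \<Lambda> ^ 3 * (Dg * sqrt (Lg1 P / \<epsilon>) + A \<epsilon> * (1 + ln (1 / \<epsilon>)) ^ 3))"
    (is "runs _ (\<lambda>x n. _ \<and> _ \<and> _ \<and> real n \<le> ?bound)")
proof -
  obtain xg n1 where xg_eq: "apg0 (Lg1 P) (g1 P) (g2 P) (\<epsilon> / 2) xginit Dg = (xg, n1)"
    and xg: "xg \<in> S" "G xg \<le> g_star P + \<epsilon> / 2" and n1: "real n1 \<le> K' * (1 + Dg * sqrt (Lg1 P / (\<epsilon> / 2)))"
    using apg0_lower[of xginit "\<epsilon> / 2"] xginit \<epsilon> by (auto split: prod.splits)
  let ?a = "Dg * sqrt (Lg1 P / \<epsilon>)" and ?E = "1 + ln (1 / \<epsilon>)"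
  have total: "real n1 + 4 + 14 * W \<epsilon> * test_cost \<epsilon> \<le> ?bound"
  proof -
    have a: "0 \<le> ?a" using Dg_pos Lg1_ge_1 \<epsilon> by simp
    have W3: "W \<epsilon> ^ 3 = \<Lambda> ^ 3 * ?E ^ 3" by (simp add: W_def power_mult_distrib)
    have \<Lambda>3: "1 \<le> \<Lambda> ^ 3" using \<Lambda>_ge_1 by (rule one_le_power)
    have "sqrt (Lg1 P / (\<epsilon> / 2)) \<le> sqrt (2\<^sup>2 * (Lg1 P / \<epsilon>))"
      using Lg1_ge_1 \<epsilon> by (simp add: field_simps)
    also have "\<dots> = 2 * sqrt (Lg1 P / \<epsilon>)" unfolding real_sqrt_mult by simp
    finally have "Dg * sqrt (Lg1 P / (\<epsilon> / 2)) \<le> Dg * (2 * sqrt (Lg1 P / \<epsilon>))"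
      using Dg_pos by (intro mult_left_mono) auto
    then have "K' * (1 + Dg * sqrt (Lg1 P / (\<epsilon> / 2))) \<le> K' * (1 + 2 * ?a)"
      by (intro mult_left_mono) auto
    then have n1': "real n1 \<le> K' * (1 + 2 * ?a)" using n1 by linarith
    define V where "V = A \<epsilon> * W \<epsilon> ^ 3"
    have "1 * 1 \<le> V" unfolding V_def using A_ge_1 W_ge by (intro mult_mono one_le_power) auto
    then have V: "1 \<le> V" by simp
    have WV: "W \<epsilon> \<le> V"
    proof -
      have "1 * W \<epsilon> \<le> A \<epsilon> * W \<epsilon> ^ 3"
        using A_ge_1 W_ge self_le_power[OF W_ge(1), of 3] by (intro mult_mono) auto
      then show ?thesis by (simp add: V_def)
    qed
    have "14 * W \<epsilon> * test_cost \<epsilon> = 56 * K1 * V + 56 * W \<epsilon>"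
      by (simp add: test_cost_def V_def power2_eq_square power3_eq_cube algebra_simps)
    then have "real n1 + 4 + 14 * W \<epsilon> * test_cost \<epsilon> \<le> K' * (1 + 2 * ?a) + 4 + 56 * K1 * V + 56 * V"
      using n1' WV by linarith
    also have "\<dots> \<le> K3 * (?a + V)"
    proof -
      have "k * (1 + 2 * ?a) + 4 + 56 * k1 * V + 56 * V \<le> (2 * k + 60 + 56 * k1) * (?a + V)"
        if "0 \<le> k" "0 \<le> k1" for k k1
      proof -
        have "k * 1 \<le> k * V" using V that by (intro mult_left_mono) auto
        moreover have "0 \<le> k1 * ?a" "0 \<le> k * V" using a V that by simp_all
        ultimately show ?thesis using a V by (simp add: distrib_left distrib_right)
      qed
      from this[of K' K1] show ?thesis by simp
    qed
    also have "\<dots> \<le> K3 * (\<Lambda> ^ 3 * ?a + V)"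
      using mult_right_mono[OF \<Lambda>3 a] by (intro mult_left_mono add_right_mono) auto
    also have "\<dots> = ?bound" by (simp add: V_def W3 algebra_simps)
    finally show ?thesis .
  qed
  have cost: "0 \<le> 14 * W \<epsilon> * test_cost \<epsilon>" using W_ge test_cost_ge by simp
  show ?thesis
  proof (cases "F xg - l0 \<le> \<epsilon>")
    case True
    moreover have "l0 \<le> p_star P" using init by (simp add: init_ok_def)
    ultimately show ?thesis using xg_eq xg total cost \<epsilon> by simp
  next
    case False
    have "runs (search \<epsilon> xf M (G xg) (l0, F xg, xg, \<delta>init))
      (\<lambda>x n. x \<in> S \<and> F x \<le> p_star P + \<epsilon> \<and> G x \<le> g_star P + \<epsilon> \<and>
        real (n1 + (2 + (2 + n))) \<le> ?bound)"
      by (rule runs_mono[OF runs_search[OF init xg]]) (use total in auto)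
    then show ?thesis
      unfolding xg_eq runs_bind runs_Some runs_evalf if_not_P[OF False] runs_evalg .
  qed
qed

end

end

theorem theorem3p2:
  fixes \<kappa> :: nat and K_apg :: real
  shows "\<exists>(K::real) (p::nat).
    \<forall>(P :: 'a::euclidean_space sbo) apg0 apgmu Dg Bf \<delta>init xfinit xginit \<epsilon>.
      sbo_problem P \<and> assumption_A P \<and>
      apg0_spec \<kappa> K_apg P apg0 \<and> apgmu_spec \<kappa> K_apg P apgmu \<and>
      diameter (domg P) \<le> Dg \<and>
      1 \<le> Bf \<and> Bf-lipschitz_on (domg P) (\<lambda>x. real_of_ereal (fobj P x)) \<and>
      0 < \<delta>init \<and> \<delta>init \<le> 1 / Bf \<and>
      0 < \<epsilon> \<and> \<epsilon> \<le> min 1 (4 * \<delta>init) \<and>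
      xfinit \<in> domg P \<and> xginit \<in> domg P
      \<longrightarrow> (\<exists>x T out T_pre.
            BiVFA P apg0 apgmu \<epsilon> Dg Bf \<delta>init xfinit xginit = Some (x, T) \<and>
            eps_optimal P \<epsilon> \<epsilon> x \<and>
            LBInit P apg0 apgmu \<delta>init Dg Bf xfinit xginit = Some (out, T_pre) \<and>
            real T_pre \<le> K * log_data P Dg Bf \<delta>init ^ p * bound_pre P Dg \<delta>init \<and>
            \<bar>real T - real T_pre\<bar>
              \<le> K * log_data P Dg Bf \<delta>init ^ p * bound_main P Dg \<delta>init \<epsilon>)"
proof -
  define K' where "K' = real \<kappa> * max K_apg 0"
  define K1 where "K1 = 68 * (51 * K' + 2)"
  define K where "K = 2 * (4 * K' + 8 + 4 * K1) + (2 * K' + 60 + 56 * K1)"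
  have K': "0 \<le> K'" by (simp add: K'_def)
  then have K1: "0 \<le> K1" by (simp add: K1_def)
  have K_ge: "2 * (4 * K' + 8 + 4 * K1) \<le> K" "2 * K' + 60 + 56 * K1 \<le> K"
    using K' K1 by (auto simp: K_def)
  have "\<exists>x T out T_pre.
      BiVFA P apg0 apgmu \<epsilon> Dg Bf \<delta>init xfinit xginit = Some (x, T) \<and>
      eps_optimal P \<epsilon> \<epsilon> x \<and>
      LBInit P apg0 apgmu \<delta>init Dg Bf xfinit xginit = Some (out, T_pre) \<and>
      real T_pre \<le> K * log_data P Dg Bf \<delta>init ^ 3 * bound_pre P Dg \<delta>init \<and>
      \<bar>real T - real T_pre\<bar> \<le> K * log_data P Dg Bf \<delta>init ^ 3 * bound_main P Dg \<delta>init \<epsilon>"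
    if asm: "sbo_problem P" "assumption_A P" "apg0_spec \<kappa> K_apg P apg0" "apgmu_spec \<kappa> K_apg P apgmu"
      "diameter (domg P) \<le> Dg" "1 \<le> Bf" "Bf-lipschitz_on (domg P) (\<lambda>x. real_of_ereal (fobj P x))"
      "0 < \<delta>init" "\<delta>init \<le> 1 / Bf"
      and \<epsilon>: "0 < \<epsilon>" "\<epsilon> \<le> min 1 (4 * \<delta>init)" and init: "xfinit \<in> domg P" "xginit \<in> domg P"
    for P :: "'a sbo" and apg0 apgmu Dg Bf \<delta>init xfinit xginit \<epsilon>
  proof -
    interpret bilevel_run P apg0 apgmu \<kappa> K_apg Dg Bf \<delta>init
      by unfold_locales (use asm in auto)
    have \<epsilon>': "\<epsilon> \<le> 1" "\<epsilon> \<le> 4 * \<delta>init" using \<epsilon> by auto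
    have pre_eq: "bound_pre P Dg \<delta>init = B * (1 + ln Q)\<^sup>2"
      by (simp add: bound_pre_def B_def)
    have main_eq: "bound_main P Dg \<delta>init \<epsilon> = Dg * sqrt (Lg1 P / \<epsilon>) + A \<epsilon> * (1 + ln (1 / \<epsilon>)) ^ 3"
      by (simp add: bound_main_def A_def)
    from runs_LBInit[OF init]
    obtain l0 \<Delta> xf M T_pre where pre: "LBInit P apg0 apgmu \<delta>init Dg Bf xfinit xginit = Some ((l0, \<Delta>, xf, M), T_pre)"
      and ok: "init_ok (l0, \<Delta>, xf, M)" and T_pre: "real T_pre \<le> 2 * (4 * K' + 8 + 4 * K1) * \<Lambda> ^ 3 * B"
      unfolding K1_def K'_def by (auto simp: runs_def)
    from runs_after_init[OF \<epsilon>(1) \<epsilon>' ok init(2)]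
    obtain x n where main: "do {
         xg \<leftarrow> Some (apg0 (Lg1 P) (g1 P) (g2 P) (\<epsilon> / 2) xginit Dg);
         u0 \<leftarrow> evalf P xg;
         (if u0 - l0 \<le> \<epsilon> then return xg
          else do {
            vg \<leftarrow> evalg P xg;
            search \<epsilon> xf M vg (l0, u0, xg, \<delta>init) }) } = Some (x, n)"
      and x: "x \<in> S" "F x \<le> p_star P + \<epsilon>" "G x \<le> g_star P + \<epsilon>"
      and n: "real n \<le> (2 * K' + 60 + 56 * K1) * \<Lambda> ^ 3 * bound_main P Dg \<delta>init \<epsilon>"
      unfolding main_eq K1_def K'_def by (auto simp: runs_def)
    have T: "BiVFA P apg0 apgmu \<epsilon> Dg Bf \<delta>init xfinit xginit = Some (x, T_pre + n)"
      unfolding BiVFA_eq pre by (subst bind_comp_def) (simp add: main)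
    have opt: "eps_optimal P \<epsilon> \<epsilon> x"
      using x by (simp add: eps_optimal_def fobj_eq gobj_eq)
    have \<Lambda>3: "0 \<le> \<Lambda> ^ 3" using \<Lambda>_ge_1 by simp
    have "1 \<le> (1 + ln Q)\<^sup>2" using Q_ge_1 by simp
    then have "B * 1 \<le> bound_pre P Dg \<delta>init"
      unfolding pre_eq using B_ge_1 by (intro mult_left_mono) auto
    then have "2 * (4 * K' + 8 + 4 * K1) * \<Lambda> ^ 3 * B \<le> K * \<Lambda> ^ 3 * bound_pre P Dg \<delta>init"
      using K_ge K' K1 \<Lambda>3 B_ge_1 by (intro mult_mono) auto
    with T_pre have 1: "real T_pre \<le> K * \<Lambda> ^ 3 * bound_pre P Dg \<delta>init" by linarith
    have "0 \<le> bound_main P Dg \<delta>init \<epsilon>"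
      unfolding main_eq using Dg_pos Lg1_ge_1 \<epsilon> A_ge_1[OF \<epsilon>(1) \<epsilon>'] ln_eps[OF \<epsilon>(1) \<epsilon>']
      by (intro add_nonneg_nonneg mult_nonneg_nonneg) auto
    then have "(2 * K' + 60 + 56 * K1) * \<Lambda> ^ 3 * bound_main P Dg \<delta>init \<epsilon>
        \<le> K * \<Lambda> ^ 3 * bound_main P Dg \<delta>init \<epsilon>"
      using K_ge \<Lambda>3 by (intro mult_right_mono) auto
    with n have 2: "\<bar>real (T_pre + n) - real T_pre\<bar> \<le> K * \<Lambda> ^ 3 * bound_main P Dg \<delta>init \<epsilon>" by simp
    show ?thesis using T opt pre 1 2 by blast
  qed
  then show ?thesis by (intro exI[of _ K] exI[of _ 3]) blast
qed

end
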